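(* Let $R$ be a finite (nonzero, commutative, with identity) reduced ring and let $\Gamma(R)$ be its ring-theoretic zero-divisor graph. Then $\chi'(\Gamma(R))=\Delta(\Gamma(R))$, and both $\Gamma(R)$ and its complement $\Gamma^c(R)$ satisfy the Total Coloring Conjecture. Moreover, $\Gamma(R)$ is of type II if and only if $R=F_1\times F_2$ (up to isomorphism) for fields $F_1,F_2$ with $|F_1|=|F_2|$.
   Context: $\Gamma(R)$ is the simple graph whose vertices are the nonzero zero-divisors of $R$, with distinct $x,y$ adjacent iff $xy=0$. $\Delta$ is maximum degree; $\chi'$ is the edge chromatic number; $\chi''$ is the total chromatic number: the least number of colors in a coloring of vertices and edges in which adjacent vertices, edges sharing an endpoint, and incident vertex–edge pairs get different colors. A graph $G$ satisfies the Total Coloring Conjecture if $\chi''(G)\in\{\Delta(G)+1,\Delta(G)+2\}$; it is of type II if $\chi''(G)=\Delta(G)+2$. The null graph (no vertices) is regarded as satisfying $\chi'=\Delta=0$ and the Total Coloring Conjecture, and as not being of type II. *)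

theory Defs
  imports "HOL-Algebra.Algebra"
begin

section \<open>Simple graphs and their colorings\<close>

text \<open>Edges are two-element sets of vertices; all graphs used here are finite.\<close>

record 'a graph =
  vertices :: "'a set"
  edges :: "'a set set"

definition complement_graph :: "'a graph \<Rightarrow> 'a graph" where
  "complement_graph G =
     \<lparr>vertices = vertices G,
      edges = {{x, y} | x y. x \<in> vertices G \<and> y \<in> vertices G \<and> x \<noteq> y \<and> {x, y} \<notin> edges G}\<rparr>"

definition vertex_degree :: "'a graph \<Rightarrow> 'a \<Rightarrow> nat" where
  "vertex_degree G v = card {e \<in> edges G. v \<in> e}"

definition max_degree :: "'a graph \<Rightarrow> nat" where
  "max_degree G = (if vertices G = {} then 0 else Max (vertex_degree G ` vertices G))"

definition proper_vertex_coloring :: "'a graph \<Rightarrow> ('a \<Rightarrow> nat) \<Rightarrow> bool" where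
  "proper_vertex_coloring G c \<longleftrightarrow> (\<forall>x y. {x, y} \<in> edges G \<and> x \<noteq> y \<longrightarrow> c x \<noteq> c y)"

definition proper_edge_coloring :: "'a graph \<Rightarrow> ('a set \<Rightarrow> nat) \<Rightarrow> bool" where
  "proper_edge_coloring G c \<longleftrightarrow>
     (\<forall>e\<in>edges G. \<forall>f\<in>edges G. e \<noteq> f \<and> e \<inter> f \<noteq> {} \<longrightarrow> c e \<noteq> c f)"

text \<open>A total coloring is given by its restrictions to vertices and to edges, which draw
  on the same colors.\<close>

definition proper_total_coloring :: "'a graph \<Rightarrow> ('a \<Rightarrow> nat) \<Rightarrow> ('a set \<Rightarrow> nat) \<Rightarrow> bool" where
  "proper_total_coloring G cv ce \<longleftrightarrow>
     proper_vertex_coloring G cv \<and> proper_edge_coloring G ce \<and>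
     (\<forall>v\<in>vertices G. \<forall>e\<in>edges G. v \<in> e \<longrightarrow> cv v \<noteq> ce e)"

definition edge_chromatic_number :: "'a graph \<Rightarrow> nat" where
  "edge_chromatic_number G =
     (LEAST k. \<exists>c. proper_edge_coloring G c \<and> c ` edges G \<subseteq> {..<k})"

definition total_chromatic_number :: "'a graph \<Rightarrow> nat" where
  "total_chromatic_number G =
     (LEAST k. \<exists>cv ce. proper_total_coloring G cv ce \<and>
        cv ` vertices G \<subseteq> {..<k} \<and> ce ` edges G \<subseteq> {..<k})"

text \<open>By convention the null graph satisfies the Total Coloring Conjecture and is not of
  type II, although its total chromatic number is 0.\<close>

definition satisfies_TCC :: "'a graph \<Rightarrow> bool" where
  "satisfies_TCC G \<longleftrightarrow> vertices G = {} \<or>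
     total_chromatic_number G \<in> {max_degree G + 1, max_degree G + 2}"

definition type_II :: "'a graph \<Rightarrow> bool" where
  "type_II G \<longleftrightarrow> vertices G \<noteq> {} \<and> total_chromatic_number G = max_degree G + 2"

section \<open>Reduced rings and zero-divisor graphs\<close>

definition reduced_ring :: "('a, 'm) ring_scheme \<Rightarrow> bool" where
  "reduced_ring R \<longleftrightarrow>
     (\<forall>x\<in>carrier R. \<forall>n::nat. x [^]\<^bsub>R\<^esub> n = \<zero>\<^bsub>R\<^esub> \<longrightarrow> x = \<zero>\<^bsub>R\<^esub>)"

definition nonzero_zero_divisors :: "('a, 'm) ring_scheme \<Rightarrow> 'a set" where
  "nonzero_zero_divisors R =
     {x \<in> carrier R. x \<noteq> \<zero>\<^bsub>R\<^esub> \<and> (\<exists>y\<in>carrier R. y \<noteq> \<zero>\<^bsub>R\<^esub> \<and> x \<otimes>\<^bsub>R\<^esub> y = \<zero>\<^bsub>R\<^esub>)}"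

definition zero_divisor_graph :: "('a, 'm) ring_scheme \<Rightarrow> 'a graph" where
  "zero_divisor_graph R =
     \<lparr>vertices = nonzero_zero_divisors R,
      edges = {{x, y} | x y. x \<in> nonzero_zero_divisors R \<and> y \<in> nonzero_zero_divisors R \<and>
                 x \<noteq> y \<and> x \<otimes>\<^bsub>R\<^esub> y = \<zero>\<^bsub>R\<^esub>}\<rparr>"

text \<open>HOL cannot quantify existentially over types, so the two fields are taken over the
  element type of the ring; by the lemma below this is no restriction.\<close>

definition product_of_two_equicardinal_fields :: "('a, 'm) ring_scheme \<Rightarrow> bool" where
  "product_of_two_equicardinal_fields R \<longleftrightarrow>
     (\<exists>(F1 :: 'a ring) (F2 :: 'a ring). field F1 \<and> field F2 \<and> R \<simeq> RDirProd F1 F2 \<and>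
        card (carrier F1) = card (carrier F2))"

lemma product_of_two_equicardinal_fieldsI:
  fixes R :: "('a, 'm) ring_scheme" and F1 :: "('b, 'k) ring_scheme" and F2 :: "('c, 'l) ring_scheme"
  assumes F: "field F1" "field F2" and iso: "R \<simeq> RDirProd F1 F2"
    and card: "card (carrier F1) = card (carrier F2)"
  shows "product_of_two_equicardinal_fields R"
proof -
  interpret F1: field F1 by fact
  interpret F2: field F2 by fact
  obtain f where f: "f \<in> ring_iso R (RDirProd F1 F2)"
    using iso by (auto simp: is_ring_iso_def)
  then have im: "f ` carrier R = carrier F1 \<times> carrier F2"
    by (auto simp: ring_iso_def bij_betw_def RDirProd_carrier)
  define g where "g = inv_into (carrier R) f"
  define g1 where "g1 = (\<lambda>x. g (x, \<zero>\<^bsub>F2\<^esub>))"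
  define g2 where "g2 = (\<lambda>y. g (\<zero>\<^bsub>F1\<^esub>, y))"
  have g: "inj_on g (carrier F1 \<times> carrier F2)"
    unfolding g_def im[symmetric] by (rule inj_on_inv_into) simp
  have inj: "inj_on g1 (carrier F1)" "inj_on g2 (carrier F2)"
    using F1.zero_closed F2.zero_closed g unfolding g1_def g2_def inj_on_def by blast+
  have fields: "field (image_ring g1 F1)" "field (image_ring g2 F2)"
    using F1.inj_imp_image_ring_is_field[OF inj(1)] F2.inj_imp_image_ring_is_field[OF inj(2)] .
  have "(\<lambda>(r, s). (g1 r, g2 s)) \<in>
      ring_iso (RDirProd F1 F2) (RDirProd (image_ring g1 F1) (image_ring g2 F2))"
    by (intro RDirProd_iso6 inj_imp_image_ring_iso inj)
  then have "R \<simeq> RDirProd (image_ring g1 F1) (image_ring g2 F2)"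
    using ring_iso_set_trans[OF f] by (auto simp: is_ring_iso_def)
  moreover have "card (carrier (image_ring g1 F1)) = card (carrier (image_ring g2 F2))"
    using card by (simp add: image_ring_carrier card_image inj)
  ultimately show ?thesis
    using fields unfolding product_of_two_equicardinal_fields_def by blast
qed

end

theory Submission
  imports Defs
begin

text \<open>
  A finite reduced ring is a product of finite fields, say with \<open>1 + a i\<close> elements for \<open>i\<close> in a set
  \<open>I\<close> of \<open>n\<close> coordinates. The product of two elements is zero if and only if their supports are disjoint,
  and \<open>\<Prod>i\<in>S. a i\<close> elements have support \<open>S\<close>. The zero-divisor graph depends on nothing else, so it is
  studied as the disjointness graph of supports (locale \<open>support_graph\<close>). Here the coordinates are the
  maximal ideals; they have a trivial intersection, and the elements are counted one ideal at a time
  (\<open>card_vanishing\<close>).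

  For \<open>n = 1\<close> the graph is null. For \<open>n = 2\<close> it is complete bipartite, and explicit cyclic colorings
  give all claims; for sides of equal size a counting argument excludes a total coloring with only one color
  more than the maximum degree (\<open>not_total_colorable_plus_1\<close>). So type II has to be excluded for \<open>n \<ge> 3\<close>.

  Let \<open>n \<ge> 3\<close> and let \<open>b\<close> be the least of the numbers \<open>a i\<close>. The vertices of maximum degree \<open>Delta\<close> are
  those whose support is a single coordinate \<open>i\<close> with \<open>a i = b\<close>. Call their set \<open>L i\<close> and let \<open>D i\<close> be
  the set of elements that vanish exactly at \<open>i\<close>. The vertices of \<open>D i\<close> have no neighbors except those
  in \<open>L i\<close>. If the edges between \<open>L i\<close> and \<open>D i\<close> are deleted for all such \<open>i\<close>, then all degrees are below
  \<open>Delta\<close>, and Vizing's theorem colors the remaining edges with \<open>Delta\<close> colors. There is room to put the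
  deleted edges back: a vertex of \<open>L i\<close> still misses as many colors as it has lost edges, the
  vertices of \<open>D i\<close> are still free of colors, and \<open>D i\<close> has at least \<open>b\<^sup>2\<close> elements whereas \<open>L i\<close> has \<open>b\<close>; so a Latin
  rectangle can be filled row by row (\<open>add_bipartite\<close>). For the total coloring one more color is
  allowed. Join a new vertex to all vertices whose support is a single coordinate before the deleted edges
  are restored; the colors of the new edges become the colors of these vertices. All other vertices
  have so small a degree that they can be colored greedily at the end.

  In the complement for \<open>n \<ge> 3\<close> the maximum degree is \<open>card V - 1 - b\<close>. Joining a new vertex to all
  vertices would give them pairwise different colors, which is \<open>b - 1\<close> colors too many. Instead
  \<open>b - 1\<close> disjoint pairs of nonadjacent vertices of small degree share a color. The edges that
  get this color too form a matching that covers all vertices of large degree; these lie in a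
  clique, and the matchings are rounds of a round-robin tournament (\<open>clique_factors\<close>). What
  remains is again within reach of Vizing's theorem with a new vertex (\<open>vizing_cone\<close>).

  Vizing's theorem comes from a statement on the extension of an edge coloring to a new vertex
  (\<open>edge_color_new_vertex\<close>), with the proof of Ehrenfeucht, Faber and Kierstead by Kempe swaps. There
  the new vertex may have as many neighbors as there are colors, which is what the total colorings need.
\<close>

section \<open>Colorings of edge sets\<close>

text \<open>The proofs add and delete edges all the time, so they work with edge sets instead of graphs.\<close>

definition simple_edges :: "'a set set \<Rightarrow> bool" where
  "simple_edges E \<longleftrightarrow> finite E \<and> (\<forall>e\<in>E. card e = 2)"

definition edge_degree :: "'a set set \<Rightarrow> 'a \<Rightarrow> nat" where
  "edge_degree E v = card {e \<in> E. v \<in> e}"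

definition edge_colored :: "'a set set \<Rightarrow> ('a set \<Rightarrow> nat) \<Rightarrow> nat set \<Rightarrow> bool" where
  "edge_colored E c C \<longleftrightarrow>
     c ` E \<subseteq> C \<and> (\<forall>e\<in>E. \<forall>f\<in>E. e \<noteq> f \<and> e \<inter> f \<noteq> {} \<longrightarrow> c e \<noteq> c f)"

definition missing :: "'a set set \<Rightarrow> ('a set \<Rightarrow> nat) \<Rightarrow> nat set \<Rightarrow> 'a \<Rightarrow> nat set" where
  "missing E c C v = {i \<in> C. \<forall>e\<in>E. v \<in> e \<longrightarrow> c e \<noteq> i}"

lemma simple_edges_subset: "simple_edges E \<Longrightarrow> F \<subseteq> E \<Longrightarrow> simple_edges F"
  by (auto simp: simple_edges_def intro: finite_subset)

lemma edge_colored_subset: "edge_colored E c C \<Longrightarrow> F \<subseteq> E \<Longrightarrow> edge_colored F c C"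
  unfolding edge_colored_def by blast

lemma edge_colored_in: "edge_colored E c C \<Longrightarrow> e \<in> E \<Longrightarrow> c e \<in> C"
  unfolding edge_colored_def by blast

lemma edge_colored_neq:
  "edge_colored E c C \<Longrightarrow> e \<in> E \<Longrightarrow> f \<in> E \<Longrightarrow> e \<noteq> f \<Longrightarrow> v \<in> e \<Longrightarrow> v \<in> f \<Longrightarrow> c e \<noteq> c f"
  unfolding edge_colored_def by blast

lemma missing_subset: "missing E c C v \<subseteq> C"
  by (auto simp: missing_def)

lemma card_missing:
  assumes "finite E" "finite C" "edge_colored E c C"
  shows "card (missing E c C v) + edge_degree E v = card C"
proof -
  have inj: "inj_on c {e \<in> E. v \<in> e}"
    using assms(3) unfolding inj_on_def edge_colored_def by blast
  have sub: "c ` {e \<in> E. v \<in> e} \<subseteq> C"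
    using assms(3) unfolding edge_colored_def by blast
  have "missing E c C v = C - c ` {e \<in> E. v \<in> e}"
    unfolding missing_def by blast
  then have "card (missing E c C v) = card C - card {e \<in> E. v \<in> e}"
    using sub inj assms by (simp add: card_Diff_subset card_image)
  moreover have "card {e \<in> E. v \<in> e} \<le> card C"
    using card_mono[OF assms(2) sub] inj by (simp add: card_image)
  ultimately show ?thesis by (simp add: edge_degree_def)
qed

section \<open>Kempe components\<close>

text \<open>The vertices of the component of \<open>u\<close> in the subgraph of the edges of colors \<open>i\<close> and \<open>j\<close>.\<close>
definition kempe :: "'a set set \<Rightarrow> ('a set \<Rightarrow> nat) \<Rightarrow> nat \<Rightarrow> nat \<Rightarrow> 'a \<Rightarrow> 'a set" where
  "kempe E c i j u = {(p, q). \<exists>e\<in>E. c e \<in> {i, j} \<and> p \<in> e \<and> q \<in> e}\<^sup>* `` {u}"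

lemma kempe_self: "u \<in> kempe E c i j u"
  by (simp add: kempe_def)

lemma kempe_closed:
  assumes "e \<in> E" "c e \<in> {i, j}" "e \<inter> kempe E c i j u \<noteq> {}"
  shows "e \<subseteq> kempe E c i j u"
proof
  fix q assume q: "q \<in> e"
  let ?r = "{(p, q). \<exists>e\<in>E. c e \<in> {i, j} \<and> p \<in> e \<and> q \<in> e}"
  obtain p where p: "p \<in> e" "(u, p) \<in> ?r\<^sup>*"
    using assms(3) unfolding kempe_def by blast
  have "(p, q) \<in> ?r" using assms(1,2) p(1) q by blast
  with p(2) have "(u, q) \<in> ?r\<^sup>*" by (rule rtrancl_into_rtrancl)
  then show "q \<in> kempe E c i j u" unfolding kempe_def by blast
qed

lemma kempe_subset: "kempe E c i j u \<subseteq> insert u (\<Union>E)"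
proof
  fix v assume "v \<in> kempe E c i j u"
  then have "(u, v) \<in> {(p, q). \<exists>e\<in>E. c e \<in> {i, j} \<and> p \<in> e \<and> q \<in> e}\<^sup>*"
    unfolding kempe_def by simp
  then show "v \<in> insert u (\<Union>E)"
    by (induction rule: rtrancl_induct) auto
qed

lemma finite_Union_simple: "simple_edges E \<Longrightarrow> finite (\<Union>E)"
  unfolding simple_edges_def by (intro finite_Union) (auto intro: card_ge_0_finite)

lemma kempe_finite: "simple_edges E \<Longrightarrow> finite (kempe E c i j u)"
  using finite_subset[OF kempe_subset] finite_Union_simple by (metis finite_insert)

text \<open>The component is connected: a largest tree in it that contains \<open>u\<close> reaches all its vertices, since
  an edge that leaves the tree could be added.\<close>
lemma kempe_edges:
  fixes c i j u
  assumes E: "simple_edges E"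
  defines "K \<equiv> kempe E c i j u"
  shows "card K \<le> card {e \<in> E. c e \<in> {i, j} \<and> e \<subseteq> K} + 1"
proof -
  let ?F = "{e \<in> E. c e \<in> {i, j} \<and> e \<subseteq> K}"
  have finF: "finite ?F" using E by (simp add: simple_edges_def)
  have finK: "finite K" unfolding K_def by (rule kempe_finite[OF E])
  define P where "P S \<longleftrightarrow> u \<in> S \<and> S \<subseteq> K \<and> (\<exists>F\<subseteq>?F. \<Union>F \<subseteq> S \<and> card S = card F + 1)" for S
  have "P {u}" unfolding P_def
    by (intro conjI exI[of _ "{}"]) (auto simp: K_def kempe_self)
  moreover have "\<forall>S. P S \<longrightarrow> card S < Suc (card K)"
    using card_mono[OF finK] unfolding P_def by (simp add: less_Suc_eq_le)
  ultimately have "\<exists>S. P S \<and> (\<forall>T. P T \<longrightarrow> card T \<le> card S)"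
    by (intro ex_has_greatest_nat)
  then obtain S where S: "P S" and max: "\<And>T. P T \<Longrightarrow> card T \<le> card S"
    by (elim exE conjE) simp
  then obtain F where F: "F \<subseteq> ?F" "\<Union>F \<subseteq> S" "card S = card F + 1" "u \<in> S" "S \<subseteq> K"
    unfolding P_def by blast
  have finS: "finite S" and finF': "finite F" using F finK finF finite_subset by blast+
  have "K \<subseteq> S"
  proof
    fix v assume "v \<in> K"
    then have "(u, v) \<in> {(p, q). \<exists>e\<in>E. c e \<in> {i, j} \<and> p \<in> e \<and> q \<in> e}\<^sup>*"
      unfolding K_def kempe_def by simp
    then show "v \<in> S"
    proof (induction rule: rtrancl_induct)
      case (step p q)
      then obtain e where e: "e \<in> E" "c e \<in> {i, j}" "p \<in> e" "q \<in> e" by blast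
      have eK: "e \<subseteq> K"
        using kempe_closed[OF e(1), of c i j u] e(2) step.IH F(5) e(3) unfolding K_def by blast
      show ?case
      proof (rule ccontr)
        assume q: "q \<notin> S"
        have e2: "card e = 2" using E e(1) by (simp add: simple_edges_def)
        have "p \<noteq> q" using step.IH q by blast
        have "e = {p, q}"
        proof -
          have "finite e" using e2 card_ge_0_finite by force
          moreover have "{p, q} \<subseteq> e" using e by blast
          ultimately show ?thesis
            using e2 \<open>p \<noteq> q\<close> card_subset_eq[of e "{p, q}"] by simp
        qed
        moreover have "e \<notin> F" using F(2) q e(4) by blast
        ultimately have "P (insert q S)"
          unfolding P_def using F e eK q finS finF' step.IH
          by (intro conjI exI[of _ "insert e F"]) auto
        then show False using max q finS by fastforce
      qed
    qed (use F in auto)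
  qed
  then have "card K \<le> card S" using finS by (simp add: card_mono)
  also have "\<dots> \<le> card ?F + 1" using F(1,3) finF card_mono by fastforce
  finally show ?thesis .
qed

text \<open>A component of two matchings is a path or a cycle; only the ends of a path miss one of the
  two colors, and an isolated vertex misses both. Counting the edges of a connected graph gives this bound without the path.\<close>
lemma kempe_missing:
  fixes u
  assumes E: "simple_edges E" and c: "edge_colored E c C" and ij: "i \<noteq> j"
  defines "K \<equiv> kempe E c i j u"
  shows "(\<Sum>v\<in>K. card (missing E c {i, j} v)) \<le> 2"
proof -
  let ?E = "{e \<in> E. c e \<in> {i, j}}" and ?F = "{e \<in> E. c e \<in> {i, j} \<and> e \<subseteq> K}"
  have finK: "finite K" unfolding K_def by (rule kempe_finite[OF E])
  have fin: "finite E" using E by (simp add: simple_edges_def)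
  have col: "edge_colored ?E c {i, j}"
    using c unfolding edge_colored_def by blast
  have two: "card (missing E c {i, j} v) + card {e \<in> ?F. v \<in> e} = 2" if "v \<in> K" for v
  proof -
    have "missing E c {i, j} v = missing ?E c {i, j} v"
      unfolding missing_def by blast
    moreover have "{e \<in> ?F. v \<in> e} = {e \<in> ?E. v \<in> e}"
      using that kempe_closed[of _ E c i j u] unfolding K_def by blast
    ultimately show ?thesis
      using card_missing[OF _ _ col, of v] fin ij by (simp add: edge_degree_def)
  qed
  have "\<forall>e\<in>?F. card {v \<in> K. v \<in> e} = 2"
  proof
    fix e assume "e \<in> ?F"
    then have "{v \<in> K. v \<in> e} = e" by blast
    then show "card {v \<in> K. v \<in> e} = 2" using E \<open>e \<in> ?F\<close> by (auto simp: simple_edges_def)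
  qed
  then have "(\<Sum>v\<in>K. card {e \<in> ?F. v \<in> e}) = 2 * card ?F"
    using fin by (intro sum_multicount[OF finK]) auto
  moreover have "(\<Sum>v\<in>K. card (missing E c {i, j} v) + card {e \<in> ?F. v \<in> e}) = 2 * card K"
    using two by simp
  ultimately have "(\<Sum>v\<in>K. card (missing E c {i, j} v)) + 2 * card ?F = 2 * card K"
    by (simp only: sum.distrib)
  moreover have "card K \<le> card ?F + 1"
    unfolding K_def by (rule kempe_edges[OF E])
  ultimately show ?thesis by linarith
qed

definition kempe_swap :: "'a set \<Rightarrow> nat \<Rightarrow> nat \<Rightarrow> ('a set \<Rightarrow> nat) \<Rightarrow> 'a set \<Rightarrow> nat" where
  "kempe_swap K i j c e = (if e \<inter> K = {} then c e else Transposition.transpose i j (c e))"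

text \<open>An edge of color \<open>i\<close> or \<open>j\<close> has both ends in \<open>K\<close> or none. So for the edges at \<open>v\<close> the swap depends only
  on \<open>v\<close>.\<close>
lemma kempe_swap_at:
  fixes c i j u
  assumes "e \<in> E" "v \<in> e"
  defines "K \<equiv> kempe E c i j u"
  shows "kempe_swap K i j c e = (if v \<in> K then Transposition.transpose i j (c e) else c e)"
proof (cases "v \<in> K \<or> e \<inter> K = {}")
  case True
  then show ?thesis using assms(2) by (auto simp: kempe_swap_def)
next
  case False
  then have "c e \<notin> {i, j}"
    using kempe_closed[OF assms(1)] assms(2) unfolding K_def by blast
  then show ?thesis using False by (auto simp: kempe_swap_def Transposition.transpose_def)
qed

lemma kempe_swap_colored:
  assumes c: "edge_colored E c C" and "i \<in> C" "j \<in> C"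
  shows "edge_colored E (kempe_swap (kempe E c i j u) i j c) C"
proof -
  let ?K = "kempe E c i j u"
  have "kempe_swap ?K i j c e \<in> C" if "e \<in> E" for e
    using edge_colored_in[OF c that] assms(2,3)
    by (auto simp: kempe_swap_def Transposition.transpose_def)
  moreover have "kempe_swap ?K i j c e \<noteq> kempe_swap ?K i j c f"
    if "e \<in> E" "f \<in> E" "e \<noteq> f" "v \<in> e" "v \<in> f" for e f v
    using edge_colored_neq[OF c that] kempe_swap_at[OF that(1,4)] kempe_swap_at[OF that(2,5)]
    by (auto dest: injD[OF inj_swap] simp: Transposition.transpose_def split: if_splits)
  ultimately show ?thesis unfolding edge_colored_def by blast
qed

lemma kempe_swap_missing:
  fixes u
  assumes "i \<in> C" "j \<in> C" "k \<in> missing E c C v"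
  defines "K \<equiv> kempe E c i j u"
  shows "(if v \<in> K then Transposition.transpose i j k else k) \<in> missing E (kempe_swap K i j c) C v"
proof -
  have "kempe_swap K i j c e \<noteq> (if v \<in> K then Transposition.transpose i j k else k)"
    if "e \<in> E" "v \<in> e" for e
    using kempe_swap_at[OF that, of c i j u] assms(3) that unfolding K_def missing_def
    by (auto simp: Transposition.transpose_def split: if_splits)
  then show ?thesis
    using assms(1-3) unfolding missing_def by (auto simp: Transposition.transpose_def)
qed

section \<open>Extending an edge coloring to a new vertex\<close>

definition star :: "'a \<Rightarrow> 'a set \<Rightarrow> 'a set set" where
  "star v N = (\<lambda>u. {v, u}) ` N"

lemma card_filter_le_2:
  fixes S :: "'a set"
  assumes "finite S" "(\<Sum>v\<in>S. f v) \<le> (2::nat)" "T \<subseteq> S" "\<And>v. v \<in> T \<Longrightarrow> 1 \<le> f v"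
  shows "card T \<le> 2"
proof -
  have "card T = (\<Sum>v\<in>T. 1)" by simp
  also have "\<dots> \<le> (\<Sum>v\<in>T. f v)" using assms(4) by (intro sum_mono) auto
  also have "\<dots> \<le> (\<Sum>v\<in>S. f v)" using assms(1,3) by (intro sum_mono2) auto
  finally show ?thesis using assms(2) by simp
qed

text \<open>The components of distinct elements of \<open>A - B\<close> that each reach \<open>B - A\<close> do not overlap, since a
  component has at most two ends. As \<open>A - B\<close> is the larger set, some component meets it but not
  \<open>B - A\<close>. Nor does it meet \<open>A \<inter> B\<close>, whose elements miss both colors and would count twice.\<close>
lemma kempe_component_avoiding:
  assumes E: "simple_edges E" and c: "edge_colored E c C" and ij: "i \<in> C" "j \<in> C" "i \<noteq> j"
    and fin: "finite A" "finite B"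
    and A: "\<And>v. v \<in> A \<Longrightarrow> i \<in> missing E c C v" and B: "\<And>v. v \<in> B \<Longrightarrow> j \<in> missing E c C v"
    and less: "card B < card A"
  obtains u where "u \<in> A" "kempe E c i j u \<inter> B = {}" "card (kempe E c i j u \<inter> A) \<le> 2"
proof -
  let ?m = "\<lambda>v. card (missing E c {i, j} v)"
  have fm: "finite (missing E c {i, j} v)" for v
    by (rule finite_subset[OF missing_subset]) simp
  have mX: "i \<in> missing E c {i, j} v" if "v \<in> A" for v using A[OF that] by (auto simp: missing_def)
  have mY: "j \<in> missing E c {i, j} v" if "v \<in> B" for v using B[OF that] by (auto simp: missing_def)
  have m1: "1 \<le> ?m v" if "v \<in> A \<union> B" for v
    using mX[of v] mY[of v] that fm[of v] by (auto simp: Suc_le_eq card_gt_0_iff)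
  have m2: "2 \<le> ?m v" if "v \<in> A" "v \<in> B" for v
  proof -
    have "card {i, j} \<le> ?m v" using mX[OF that(1)] mY[OF that(2)] fm by (intro card_mono) auto
    then show ?thesis using ij(3) by simp
  qed
  have K: "finite (kempe E c i j u)" "sum ?m (kempe E c i j u) \<le> 2" for u
    using kempe_finite[OF E] kempe_missing[OF E c ij(3)] by auto
  have "\<exists>u\<in>A - B. kempe E c i j u \<inter> (B - A) = {}"
  proof (rule ccontr)
    assume "\<not> ?thesis"
    then have "\<forall>u\<in>A - B. \<exists>w. w \<in> kempe E c i j u \<inter> (B - A)" by blast
    then obtain g where g: "\<And>u. u \<in> A - B \<Longrightarrow> g u \<in> kempe E c i j u \<inter> (B - A)"
      by metis
    have sym: "u' \<in> kempe E c i j u" if "w \<in> kempe E c i j u" "w \<in> kempe E c i j u'" for u u' w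
    proof -
      let ?r = "{(p, q). \<exists>e\<in>E. c e \<in> {i, j} \<and> p \<in> e \<and> q \<in> e}"
      have "sym ?r" unfolding sym_def by blast
      then have "sym (?r\<^sup>*)" by (rule sym_rtrancl)
      then have "(w, u') \<in> ?r\<^sup>*" using that(2) unfolding kempe_def by (auto dest: symD)
      then have "(u, u') \<in> ?r\<^sup>*" using that(1) unfolding kempe_def by (auto dest: rtrancl_trans)
      then show ?thesis unfolding kempe_def by auto
    qed
    have "inj_on g (A - B)"
    proof (rule inj_onI, rule ccontr)
      fix u u' assume u: "u \<in> A - B" "u' \<in> A - B" "g u = g u'" "u \<noteq> u'"
      let ?T = "{u, u', g u}"
      have "u' \<in> kempe E c i j u" using sym g[OF u(1)] g[OF u(2)] u(3) by auto
      then have "?T \<subseteq> kempe E c i j u" using g[OF u(1)] kempe_self by auto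
      then have "card ?T \<le> 2"
        using m1 g[OF u(1)] u(1,2) by (intro card_filter_le_2[OF K]) auto
      moreover have "card ?T = 3" using u g[OF u(1)] by (auto simp: card_insert_if)
      ultimately show False by simp
    qed
    then have "card (A - B) \<le> card (B - A)"
      using g fin by (intro card_inj_on_le[of g]) auto
    moreover have "card A = card (A - B) + card (A \<inter> B)" "card B = card (B - A) + card (A \<inter> B)"
      using fin card_Int_Diff[of A B] card_Int_Diff[of B A] by (auto simp: Int_commute)
    ultimately show False using less by simp
  qed
  then obtain u where u: "u \<in> A - B" "kempe E c i j u \<inter> (B - A) = {}" by blast
  have "kempe E c i j u \<inter> (A \<inter> B) = {}"
  proof (rule ccontr)
    assume "\<not> ?thesis"
    then obtain w where w: "w \<in> kempe E c i j u" "w \<in> A" "w \<in> B" by blast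
    have "?m u + ?m w = sum ?m {u, w}" using u w by (subst sum.insert) auto
    also have "\<dots> \<le> sum ?m (kempe E c i j u)" using w K kempe_self by (intro sum_mono2) auto
    finally show False using m1[of u] m2[OF w(2,3)] u(1) K(2)[of u] by auto
  qed
  then have "kempe E c i j u \<inter> B = {}" using u(2) by blast
  moreover have "card (kempe E c i j u \<inter> A) \<le> 2"
    using m1 by (intro card_filter_le_2[OF K]) auto
  ultimately show ?thesis using that u(1) by blast
qed

text \<open>If no size is 1, then some size is 0, as the sum is less than twice the number of classes. All sizes
  are then 0 or 2, and the sum is even.\<close>
lemma exists_class_of_size_one:
  fixes x :: "nat \<Rightarrow> nat"
  assumes "finite C" and total: "(\<Sum>i\<in>C. x i) = 2 * n - 1" and n: "0 < n" "n \<le> card C"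
    and balanced: "\<And>i j. i \<in> C \<Longrightarrow> j \<in> C \<Longrightarrow> x i \<le> x j + 2"
  shows "\<exists>i\<in>C. x i = 1"
proof (rule ccontr)
  assume none: "\<not> ?thesis"
  have "\<exists>i\<in>C. x i = 0"
  proof (rule ccontr)
    assume nz: "\<not> ?thesis"
    have "2 \<le> x i" if "i \<in> C" for i
      using none nz that by (cases "x i" rule: nat.exhaust) (auto simp: Suc_le_eq neq0_conv)
    then have "(\<Sum>i\<in>C. 2) \<le> (\<Sum>i\<in>C. x i)" by (intro sum_mono) auto
    then have "2 * card C \<le> 2 * n - 1" using total by simp
    then show False using n by linarith
  qed
  then obtain j where j: "j \<in> C" "x j = 0" by blast
  have "even (x i)" if "i \<in> C" for i
  proof -
    have "x i \<le> 2" "x i \<noteq> 1" using balanced[OF that j(1)] j(2) none that by auto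
    then have "x i = 0 \<or> x i = 2" by linarith
    then show ?thesis by auto
  qed
  then have "even (\<Sum>i\<in>C. x i)" by (intro dvd_sum) auto
  moreover have "odd (2 * n - 1)" using n(1) by simp
  ultimately show False using total by simp
qed

lemma sum_square_less:
  fixes a b t :: nat
  assumes "b + 3 \<le> a" "1 \<le> t" "t \<le> 2"
  shows "(a - t)\<^sup>2 + (b + t)\<^sup>2 < a\<^sup>2 + b\<^sup>2"
proof -
  obtain d where d: "a = b + 3 + d" using assms(1) le_Suc_ex by blast
  from assms consider "t = 1" | "t = 2" by linarith
  then show ?thesis
    by cases (auto simp: d power2_eq_square algebra_simps)
qed

text \<open>Choose for each neighbor of the new vertex two missing colors, for one of them a single one,
  and let \<open>A i\<close> be the set of those that chose \<open>i\<close>. Kempe swaps make the sizes of these sets differ by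
  at most 2. They add up to an odd number below twice the number of colors, so one of them is 1.\<close>
lemma balanced_choice:
  assumes E: "simple_edges E" and C: "finite C" and c: "edge_colored E c C"
    and N: "finite N" "card N \<le> card C" "u0 \<in> N"
    and one: "1 \<le> card (missing E c C u0)"
    and two: "\<And>u. u \<in> N \<Longrightarrow> u \<noteq> u0 \<Longrightarrow> 2 \<le> card (missing E c C u)"
  obtains c' M i where "edge_colored E c' C" "i \<in> C" "card {u \<in> N. i \<in> M u} = 1"
    "\<And>u. u \<in> N \<Longrightarrow> M u \<subseteq> missing E c' C u"
    "\<And>u. u \<in> N \<Longrightarrow> card (M u) = (if u = u0 then 1 else 2)"
proof -
  \<comment> \<open>A coloring with a choice \<open>M\<close>; the one with the least \<open>w\<close> is the most balanced.\<close>
  define Q where "Q p \<longleftrightarrow> edge_colored E (fst p) C \<and>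
    (\<forall>u\<in>N. snd p u \<subseteq> missing E (fst p) C u \<and> card (snd p u) = (if u = u0 then 1 else 2))" for p
  define w where "w p = (\<Sum>i\<in>C. (card {u \<in> N. i \<in> snd p u})\<^sup>2)" for p :: "('a set \<Rightarrow> nat) \<times> ('a \<Rightarrow> nat set)"
  have "\<exists>M. Q (c, M)"
  proof -
    have "\<exists>S. S \<subseteq> missing E c C u \<and> card S = (if u = u0 then 1 else 2)" if "u \<in> N" for u
    proof -
      have "(if u = u0 then 1 else 2) \<le> card (missing E c C u)" using one two[OF that] by auto
      then show ?thesis by (rule obtain_subset_with_card_n) blast
    qed
    then have "\<exists>M. \<forall>u\<in>N. M u \<subseteq> missing E c C u \<and> card (M u) = (if u = u0 then 1 else 2)"
      by (intro bchoice) blast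
    then obtain M where "\<And>u. u \<in> N \<Longrightarrow> M u \<subseteq> missing E c C u \<and> card (M u) = (if u = u0 then 1 else 2)"
      by blast
    then have "Q (c, M)" using c by (simp add: Q_def)
    then show ?thesis by blast
  qed
  then obtain M1 where M1: "Q (c, M1)" by blast
  obtain p where p: "Q p" and least: "\<And>p'. Q p' \<Longrightarrow> w p \<le> w p'"
    using ex_has_least_nat[of Q "(c, M1)" w, OF M1] by blast
  define c' M where "c' = fst p" and "M = snd p"
  have c': "edge_colored E c' C" and M: "\<And>u. u \<in> N \<Longrightarrow> M u \<subseteq> missing E c' C u"
    and cM: "\<And>u. u \<in> N \<Longrightarrow> card (M u) = (if u = u0 then 1 else 2)"
    using p by (auto simp: Q_def c'_def M_def)
  define A where "A i = {u \<in> N. i \<in> M u}" for i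
  have finA: "finite (A i)" for i using N(1) by (simp add: A_def)
  have MC: "M u \<subseteq> C" if "u \<in> N" for u
    using order.trans[OF M[OF that] missing_subset] .
  have bal: "card (A i) \<le> card (A j) + 2" if ij: "i \<in> C" "j \<in> C" for i j
  proof (rule ccontr)
    assume big: "\<not> ?thesis"
    then have neq: "i \<noteq> j" by auto
    have mi: "i \<in> missing E c' C v" if "v \<in> A i" for v using M[of v] that unfolding A_def by auto
    have mj: "j \<in> missing E c' C v" if "v \<in> A j" for v using M[of v] that unfolding A_def by auto
    have less: "card (A j) < card (A i)" using big by linarith
    obtain u where u: "u \<in> A i" "kempe E c' i j u \<inter> A j = {}" "card (kempe E c' i j u \<inter> A i) \<le> 2"
      by (rule kempe_component_avoiding[OF E c' ij neq finA finA mi mj less])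
    define K where "K = kempe E c' i j u"
    define t where "t = card (K \<inter> A i)"
    have t: "1 \<le> t" "t \<le> 2"
    proof -
      have "u \<in> K \<inter> A i" using u kempe_self by (auto simp: K_def)
      then show "1 \<le> t" using finA[of i] by (auto simp: t_def Suc_le_eq card_gt_0_iff)
    qed (use u in \<open>auto simp: t_def K_def\<close>)
    define c2 where "c2 = kempe_swap K i j c'"
    define M2 where "M2 v = (if v \<in> K then Transposition.transpose i j ` M v else M v)" for v
    have M2: "k \<in> M2 v \<longleftrightarrow> (if v \<in> K then Transposition.transpose i j k else k) \<in> M v" for k v
      unfolding M2_def by (auto intro: image_eqI[of _ _ "Transposition.transpose i j k"])
    have out: "v \<notin> A j" if "v \<in> K" for v using u(2) that by (auto simp: K_def)
    have "Q (c2, M2)"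
    proof -
      have "edge_colored E c2 C"
        unfolding c2_def K_def by (rule kempe_swap_colored[OF c' ij])
      moreover have "M2 v \<subseteq> missing E c2 C v" if "v \<in> N" for v
        using kempe_swap_missing[OF ij, of _ E c' v u] M[OF that]
        unfolding M2_def c2_def K_def by (auto split: if_splits)
      moreover have "card (M2 v) = card (M v)" for v
        unfolding M2_def by (simp add: card_image inj_on_subset[OF inj_transpose])
      ultimately show ?thesis using cM by (simp add: Q_def)
    qed
    then have le: "w (c', M) \<le> w (c2, M2)" using least by (simp add: c'_def M_def)
    let ?x = "\<lambda>k. card {v \<in> N. k \<in> M2 v}"
    have "{v \<in> N. i \<in> M2 v} = A i - K"
      using out by (auto simp: M2 A_def split: if_splits)
    then have xi: "?x i = card (A i) - t"
      using card_Diff_subset_Int[of "A i" K] finA by (simp add: t_def Int_commute)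
    have "{v \<in> N. j \<in> M2 v} = A j \<union> (K \<inter> A i)"
      using out by (auto simp: M2 A_def split: if_splits)
    moreover have "A j \<inter> (K \<inter> A i) = {}" using out by blast
    ultimately have xj: "?x j = card (A j) + t"
      using finA by (simp add: card_Un_disjoint t_def)
    have "{v \<in> N. k \<in> M2 v} = A k" if "k \<noteq> i" "k \<noteq> j" for k
      using that by (auto simp: M2 A_def)
    then have rest: "(\<Sum>k\<in>C - {i} - {j}. (?x k)\<^sup>2) = (\<Sum>k\<in>C - {i} - {j}. (card (A k))\<^sup>2)"
      by (intro sum.cong) auto
    have split: "sum f C = f i + f j + sum f (C - {i} - {j})" for f :: "nat \<Rightarrow> nat"
      using C ij neq by (simp add: sum.remove[of C i] sum.remove[of "C - {i}" j])
    have "w (c2, M2) = (?x i)\<^sup>2 + (?x j)\<^sup>2 + (\<Sum>k\<in>C - {i} - {j}. (?x k)\<^sup>2)"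
      unfolding w_def by (subst split) simp
    moreover have "w (c', M) = (card (A i))\<^sup>2 + (card (A j))\<^sup>2 + (\<Sum>k\<in>C - {i} - {j}. (card (A k))\<^sup>2)"
      unfolding w_def A_def by (subst split) simp
    moreover have "(card (A i) - t)\<^sup>2 + (card (A j) + t)\<^sup>2 < (card (A i))\<^sup>2 + (card (A j))\<^sup>2"
      using big t by (intro sum_square_less) auto
    ultimately show False using le rest xi xj by simp
  qed
  have "(\<Sum>i\<in>C. card (A i)) = (\<Sum>u\<in>N. card (M u))"
  proof -
    have "\<forall>u\<in>N. card {i \<in> C. i \<in> M u} = card (M u)"
      using MC by (metis Collect_mem_eq Int_absorb1 Int_def)
    from sum_multicount_gen[OF C N(1) this] show ?thesis unfolding A_def by simp
  qed
  also have "\<dots> = 2 * card N - 1"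
  proof -
    have "(\<Sum>u\<in>N. card (M u)) = card (M u0) + (\<Sum>u\<in>N - {u0}. card (M u))"
      using N by (simp add: sum.remove)
    also have "(\<Sum>u\<in>N - {u0}. card (M u)) = 2 * (card N - 1)"
      using cM N by simp
    finally have "(\<Sum>u\<in>N. card (M u)) = 1 + 2 * (card N - 1)" using cM N(3) by simp
    moreover have "0 < card N" using N by (auto simp: card_gt_0_iff)
    ultimately show ?thesis by linarith
  qed
  finally have "\<exists>i\<in>C. card (A i) = 1"
    using N C bal by (intro exists_class_of_size_one) (auto simp: card_gt_0_iff)
  then obtain i where "i \<in> C" "card {u \<in> N. i \<in> M u} = 1" unfolding A_def by blast
  then show ?thesis using M cM by (rule that[OF c'])
qed


lemma star_iff: "e \<in> star v N \<longleftrightarrow> (\<exists>u\<in>N. e = {v, u})"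
  by (auto simp: star_def)

text \<open>Give color \<open>i\<close> to the edge from the new vertex to the only neighbor that chose \<open>i\<close>, and delete all
  edges of color \<open>i\<close>. The other neighbors still miss the colors that they chose, so induction on the
  number of colors applies.\<close>
theorem edge_color_new_vertex:
  assumes "simple_edges E" "finite C" "edge_colored E c C" "v \<notin> \<Union>E"
    and "finite N" "v \<notin> N" "card N \<le> card C"
    and "\<And>u. u \<in> N \<Longrightarrow> 1 \<le> card (missing E c C u)"
    and "\<And>u. u \<in> N \<Longrightarrow> u \<noteq> u0 \<Longrightarrow> 2 \<le> card (missing E c C u)"
  shows "\<exists>c'. edge_colored (E \<union> star v N) c' C"
  using assms
proof (induction "card C" arbitrary: C E c N u0)
  case 0
  then show ?case by (auto simp: star_def)
next
  case (Suc k)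
  note E = Suc.prems(1) and C = Suc.prems(2) and c = Suc.prems(3) and v = Suc.prems(4,6)
    and N = Suc.prems(5,7) and miss = Suc.prems(8,9)
  show ?case
  proof (cases "N = {}")
    case True
    then show ?thesis using c by (auto simp: star_def)
  next
    case False
    then obtain u1 where u1: "u1 \<in> N" "u0 \<in> N \<Longrightarrow> u1 = u0" by blast
    have two: "2 \<le> card (missing E c C u)" if "u \<in> N" "u \<noteq> u1" for u
      using miss(2)[OF that(1)] that u1 by blast
    obtain c1 M i where c1: "edge_colored E c1 C" and i: "i \<in> C" "card {u \<in> N. i \<in> M u} = 1"
      and M: "\<And>u. u \<in> N \<Longrightarrow> M u \<subseteq> missing E c1 C u"
      and cM: "\<And>u. u \<in> N \<Longrightarrow> card (M u) = (if u = u1 then 1 else 2)"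
      by (rule balanced_choice[OF E C c N u1(1) miss(1)[OF u1(1)] two]) blast+
    obtain w where w: "{u \<in> N. i \<in> M u} = {w}" using i(2) card_1_singletonE by blast
    have wN: "w \<in> N" and wi: "i \<in> missing E c1 C w" using w M by blast+
    let ?C = "C - {i}" and ?E = "{e \<in> E. c1 e \<noteq> i}" and ?N = "N - {w}"
    have sub: "M u \<subseteq> missing ?E c1 ?C u" if "u \<in> ?N" for u
    proof -
      have "u \<in> N" "i \<notin> M u" using that w by blast+
      then show ?thesis using M[of u] unfolding missing_def by blast
    qed
    have fin: "finite (missing ?E c1 ?C u)" for u
      by (rule finite_subset[OF missing_subset]) (simp add: C)
    have le: "card (M u) \<le> card (missing ?E c1 ?C u)" if "u \<in> ?N" for u
      using card_mono[OF fin sub[OF that]] .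
    have "\<exists>c'. edge_colored (?E \<union> star v ?N) c' ?C"
    proof (rule Suc.hyps(1))
      show "simple_edges ?E" using E by (rule simple_edges_subset) blast
      show "edge_colored ?E c1 ?C" using c1 unfolding edge_colored_def by blast
      show "k = card ?C" using Suc.hyps(2) C i(1) by simp
      show "card ?N \<le> card ?C" using N C i(1) wN by simp
      show "1 \<le> card (missing ?E c1 ?C u)" if "u \<in> ?N" for u
        using le[OF that] cM[of u] that by (auto split: if_splits)
      show "2 \<le> card (missing ?E c1 ?C u)" if "u \<in> ?N" "u \<noteq> u1" for u
        using le[OF that(1)] cM[of u] that by auto
    qed (use C v N in auto)
    then obtain c2 where c2: "edge_colored (?E \<union> star v ?N) c2 ?C" by blast
    let ?F = "insert {v, w} {e \<in> E. c1 e = i}"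
    define c3 where "c3 e = (if e \<in> ?F then i else c2 e)" for e
    have vE: "{v, w} \<notin> E" "{v, w} \<notin> star v ?N" "E \<inter> star v ?N = {}"
      using v wN by (auto simp: star_def doubleton_eq_iff)
    have E3: "E \<union> star v N = (?E \<union> star v ?N) \<union> ?F"
      using wN by (auto simp: star_def)
    have c3_old: "c3 e = c2 e" if "e \<in> ?E \<union> star v ?N" for e
      using that vE by (auto simp: c3_def)
    have c3_new: "c3 e = i" if "e \<in> ?F" for e
      using that by (simp add: c3_def)
    have "e \<inter> f = {}" if "e \<in> ?F" "f \<in> ?F" "e \<noteq> f" for e f
    proof -
      have "{v, w} \<inter> e = {}" if "e \<in> E" "c1 e = i" for e
        using that wi v(1) by (auto simp: missing_def)
      moreover have "e \<inter> f = {}" if "e \<in> E" "c1 e = i" "f \<in> E" "c1 f = i" "e \<noteq> f"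
        using c1 that unfolding edge_colored_def by blast
      ultimately show ?thesis using that by blast
    qed
    then have same: "c3 e \<noteq> c3 f" if "e \<in> ?F" "f \<in> ?F" "e \<noteq> f" "e \<inter> f \<noteq> {}" for e f
      using that by blast
    have old_in: "c3 e \<in> C - {i}" if "e \<in> ?E \<union> star v ?N" for e
      using edge_colored_in[OF c2 that] c3_old[OF that] by simp
    have old: "c3 e \<noteq> c3 f" if "e \<in> ?E \<union> star v ?N" "f \<in> ?E \<union> star v ?N" "e \<noteq> f" "e \<inter> f \<noteq> {}" for e f
    proof -
      have "c2 e \<noteq> c2 f" using c2 that unfolding edge_colored_def by blast
      then show ?thesis unfolding c3_old[OF that(1)] c3_old[OF that(2)] .
    qed
    have mixed: "c3 e \<noteq> c3 f" "c3 f \<noteq> c3 e" if "e \<in> ?E \<union> star v ?N" "f \<in> ?F" for e f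
      using old_in[OF that(1)] c3_new[OF that(2)] by auto
    have "\<forall>e\<in>(?E \<union> star v ?N) \<union> ?F. \<forall>f\<in>(?E \<union> star v ?N) \<union> ?F.
        e \<noteq> f \<and> e \<inter> f \<noteq> {} \<longrightarrow> c3 e \<noteq> c3 f"
      by (intro ballI impI, elim UnE[of _ "?E \<union> star v ?N" ?F] conjE) (assumption | rule old mixed same)+
    moreover have "c3 ` ((?E \<union> star v ?N) \<union> ?F) \<subseteq> C"
      using DiffD1[OF old_in] c3_new i(1) by (intro image_subsetI) (elim UnE[of _ "?E \<union> star v ?N" ?F], simp_all)
    ultimately have "edge_colored (E \<union> star v N) c3 C"
      unfolding E3 edge_colored_def by blast
    then show ?thesis by blast
  qed
qed

text \<open>Delete a vertex \<open>v\<close> and color the rest by induction. Each neighbor of \<open>v\<close> has lost an edge, so it misses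
  two colors.\<close>
theorem vizing:
  assumes "simple_edges E" "finite C" "\<And>v. edge_degree E v < card C"
  shows "\<exists>c. edge_colored E c C"
  using assms
proof (induction "card E" arbitrary: E rule: less_induct)
  case less
  note E = less.prems(1) and C = less.prems(2)
  have finE: "finite E" using E by (simp add: simple_edges_def)
  show ?case
  proof (cases "E = {}")
    case True
    then show ?thesis by (auto simp: edge_colored_def)
  next
    case False
    then obtain e v where e: "e \<in> E" "v \<in> e"
      using E by (metis card.empty equals0I ex_in_conv simple_edges_def zero_neq_numeral)
    let ?E = "{e \<in> E. v \<notin> e}" and ?N = "{u. {v, u} \<in> E}"
    have vN: "v \<notin> ?N" using E by (auto simp: simple_edges_def)
    have starN: "star v ?N = {e \<in> E. v \<in> e}"
    proof
      show "{e \<in> E. v \<in> e} \<subseteq> star v ?N"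
      proof
        fix f assume f: "f \<in> {e \<in> E. v \<in> e}"
        then obtain a b where "f = {a, b}" using E by (auto simp: simple_edges_def card_2_iff)
        then show "f \<in> star v ?N" using f by (auto simp: star_iff insert_commute)
      qed
    qed (auto simp: star_def)
    have inj: "inj_on (\<lambda>u. {v, u}) ?N" by (auto simp: inj_on_def doubleton_eq_iff)
    then have finN: "finite ?N" using finite_imageD[of "\<lambda>u. {v, u}" ?N] starN finE
      by (simp add: star_def)
    have cardN: "card ?N = edge_degree E v"
      using card_image[OF inj] starN by (simp add: star_def edge_degree_def)
    have "card ?E < card E" using e finE by (intro psubset_card_mono) auto
    moreover have "edge_degree ?E u \<le> edge_degree E u" for u
      unfolding edge_degree_def using finE by (intro card_mono) auto
    ultimately have "\<exists>c. edge_colored ?E c C"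
      using less.prems(3) E by (intro less.hyps C) (auto intro: simple_edges_subset le_less_trans)
    then obtain c where c: "edge_colored ?E c C" by blast
    have two: "2 \<le> card (missing ?E c C u)" if "u \<in> ?N" for u
    proof -
      have "Suc (edge_degree ?E u) \<le> edge_degree E u"
      proof -
        have "insert {v, u} {e \<in> ?E. u \<in> e} \<subseteq> {e \<in> E. u \<in> e}" using that by auto
        then have "card (insert {v, u} {e \<in> ?E. u \<in> e}) \<le> card {e \<in> E. u \<in> e}"
          using finE by (intro card_mono) simp_all
        then show ?thesis using finE by (simp add: edge_degree_def)
      qed
      then show ?thesis
        using card_missing[OF _ C c, of u] less.prems(3)[of u] finE by simp
    qed
    have "simple_edges ?E" by (rule simple_edges_subset[OF E]) blast
    moreover have "1 \<le> card (missing ?E c C u)" if "u \<in> ?N" for u using two[OF that] by linarith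
    ultimately have "\<exists>c'. edge_colored (?E \<union> star v ?N) c' C"
      using less.prems(3)[of v] cardN two
      by (intro edge_color_new_vertex[where c = c and ?u0.0 = v] C c finN vN) auto
    moreover have "?E \<union> star v ?N = E" using starN by blast
    ultimately show ?thesis by simp
  qed
qed

text \<open>The degree of \<open>z\<close> may exceed all others by far. This gives total colorings in which the vertices of
  \<open>N\<close> have pairwise different colors, namely those of their edges to \<open>z\<close>.\<close>
corollary vizing_cone:
  assumes E: "simple_edges E" and C: "finite C" and d: "\<And>v. edge_degree E v + 2 \<le> card C"
    and "z \<notin> \<Union>E" and N: "finite N" "z \<notin> N" "card N \<le> card C"
  shows "\<exists>c. edge_colored (E \<union> star z N) c C"
proof -
  have "edge_degree E v < card C" for v using d[of v] by linarith
  then obtain c where c: "edge_colored E c C" using vizing[OF E C] by blast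
  have two: "2 \<le> card (missing E c C u)" for u
    using card_missing[OF _ C c, of u] d[of u] E by (simp add: simple_edges_def)
  have "1 \<le> card (missing E c C u)" for u using two[of u] by linarith
  then show ?thesis
    using two by (intro edge_color_new_vertex[where c = c and ?u0.0 = z] assms c)
qed

section \<open>Completing a coloring by complete bipartite blocks\<close>

definition bipartite :: "'a set \<Rightarrow> 'a set \<Rightarrow> 'a set set" where
  "bipartite L D = {{x, y} | x y. x \<in> L \<and> y \<in> D}"

text \<open>An injection with the fewest conflicts has none: if \<open>f y\<close> is forbidden at \<open>y\<close>, then at most \<open>2 r\<close>
  positions are unsuitable for exchanging values with \<open>y\<close>.\<close>
lemma injection_avoiding:
  fixes f0 :: "'a \<Rightarrow> nat"
  assumes D: "finite D" and f0: "inj_on f0 D" "f0 ` D \<subseteq> S"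
    and row: "\<And>y. y \<in> D \<Longrightarrow> finite (U y) \<and> card (U y) \<le> r"
    and col: "\<And>t. card {y \<in> D. t \<in> U y} \<le> r"
    and r: "2 * r < card D"
  shows "\<exists>f. inj_on f D \<and> f ` D \<subseteq> S \<and> (\<forall>y\<in>D. f y \<notin> U y)"
proof -
  define Q where "Q f \<longleftrightarrow> inj_on f D \<and> f ` D \<subseteq> S" for f :: "'a \<Rightarrow> nat"
  define w where "w f = card {y \<in> D. f y \<in> U y}" for f :: "'a \<Rightarrow> nat"
  have "Q f0" using f0 by (simp add: Q_def)
  then obtain f where f: "Q f" and least: "\<And>g. Q g \<Longrightarrow> w f \<le> w g"
    using ex_has_least_nat[of Q f0 w] by blast
  have inj: "inj_on f D" and fS: "f ` D \<subseteq> S" using f by (auto simp: Q_def)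
  have "f y \<notin> U y" if y: "y \<in> D" for y
  proof
    assume conflict: "f y \<in> U y"
    let ?A = "{y' \<in> D. f y' \<in> U y}" and ?B = "{y' \<in> D. f y \<in> U y'}"
    have "card ?A \<le> card (U y)"
      using row[OF y] inj by (intro card_inj_on_le[of f]) (auto simp: inj_on_def)
    then have "card (?A \<union> ?B) \<le> 2 * r"
      using card_Un_le[of ?A ?B] row[OF y] col[of "f y"] by linarith
    then have "\<not> D \<subseteq> ?A \<union> ?B" using r D card_mono[of "?A \<union> ?B" D] by auto
    then obtain y' where y': "y' \<in> D" "y' \<notin> ?A" "y' \<notin> ?B" by blast
    have neq: "y' \<noteq> y" using y' conflict y by auto
    define g where "g = f(y := f y', y' := f y)"
    have "inj_on g D" using inj y y'(1) unfolding g_def inj_on_def by auto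
    moreover have "g ` D \<subseteq> S" using fS y y'(1) unfolding g_def by auto
    ultimately have "w f \<le> w g" by (intro least) (simp add: Q_def)
    moreover have "{x \<in> D. g x \<in> U x} \<subseteq> {x \<in> D. f x \<in> U x} - {y}"
      using y' neq y by (auto simp: g_def split: if_splits)
    then have "w g \<le> card ({x \<in> D. f x \<in> U x} - {y})"
      unfolding w_def using D by (intro card_mono) auto
    moreover have "card ({x \<in> D. f x \<in> U x} - {y}) < w f"
      unfolding w_def using D y conflict by (intro card_Diff1_less) auto
    ultimately show False by linarith
  qed
  then show ?thesis using inj fS by blast
qed

text \<open>The rows \<open>f x\<close> are filled one after the other. In a new row each position excludes at most one color
  for each old row, and each color is excluded by an old row at one position at most.\<close>
lemma latin_filling:
  assumes "finite L" "finite D" "2 * card L \<le> card D + 1"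
    and "\<And>x. x \<in> L \<Longrightarrow> finite (M x) \<and> card D \<le> card (M x)"
  shows "\<exists>f :: 'b \<Rightarrow> 'a \<Rightarrow> nat. (\<forall>x\<in>L. inj_on (f x) D \<and> f x ` D \<subseteq> M x) \<and> (\<forall>y\<in>D. inj_on (\<lambda>x. f x y) L)"
  using assms
proof (induction L rule: finite_induct)
  case (insert x L)
  have "\<exists>f :: 'b \<Rightarrow> 'a \<Rightarrow> nat. (\<forall>x\<in>L. inj_on (f x) D \<and> f x ` D \<subseteq> M x) \<and> (\<forall>y\<in>D. inj_on (\<lambda>x. f x y) L)"
    using insert.prems insert.hyps by (intro insert.IH) auto
  then obtain f :: "'b \<Rightarrow> 'a \<Rightarrow> nat" where f: "\<forall>x\<in>L. inj_on (f x) D \<and> f x ` D \<subseteq> M x"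
    "\<forall>y\<in>D. inj_on (\<lambda>x. f x y) L" by (elim exE conjE)
  obtain f0 where f0: "inj_on f0 D" "f0 ` D \<subseteq> M x"
    using card_le_inj[of D "M x"] insert.prems by auto
  have "\<exists>g. inj_on g D \<and> g ` D \<subseteq> M x \<and> (\<forall>y\<in>D. g y \<notin> (\<lambda>x. f x y) ` L)"
  proof (rule injection_avoiding[OF insert.prems(1) f0])
    show "finite ((\<lambda>x. f x y) ` L) \<and> card ((\<lambda>x. f x y) ` L) \<le> card L" for y
      using insert.hyps(1) by (simp add: card_image_le)
    show "card {y \<in> D. t \<in> (\<lambda>x. f x y) ` L} \<le> card L" for t
    proof -
      have "{y \<in> D. t \<in> (\<lambda>x. f x y) ` L} = (\<Union>x\<in>L. {y \<in> D. f x y = t})" by auto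
      also have "card \<dots> \<le> (\<Sum>x\<in>L. card {y \<in> D. f x y = t})"
        by (rule card_UN_le[OF insert.hyps(1)])
      also have "\<dots> \<le> (\<Sum>x\<in>L. 1)"
      proof (rule sum_mono)
        fix x assume "x \<in> L"
        then have "\<forall>a\<in>{y \<in> D. f x y = t}. \<forall>b\<in>{y \<in> D. f x y = t}. a = b"
          using f(1) by (auto simp: inj_on_def)
        then show "card {y \<in> D. f x y = t} \<le> 1"
          using insert.prems(1) by (simp add: card_le_Suc0_iff_eq)
      qed
      finally show ?thesis by simp
    qed
    show "2 * card L < card D" using insert.prems(2) insert.hyps by simp
  qed
  then obtain g where g: "inj_on g D" "g ` D \<subseteq> M x" "\<And>y. y \<in> D \<Longrightarrow> g y \<notin> (\<lambda>x. f x y) ` L"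
    by blast
  have "inj_on (\<lambda>z. (f(x := g)) z y) (insert x L)" if "y \<in> D" for y
  proof (rule inj_onI)
    have out: "g y \<noteq> f z y" if "z \<in> L" for z using g(3)[OF \<open>y \<in> D\<close>] that by blast
    fix a b assume ab: "a \<in> insert x L" "b \<in> insert x L" "(f(x := g)) a y = (f(x := g)) b y"
    then consider "a = x" "b = x" | "a = x" "b \<noteq> x" "b \<in> L" | "b = x" "a \<noteq> x" "a \<in> L"
      | "a \<noteq> x" "b \<noteq> x" "a \<in> L" "b \<in> L" by blast
    then show "a = b"
    proof cases
      case 4
      then show ?thesis using ab(3) inj_onD[OF bspec[OF f(2) that]] by simp
    qed (use ab(3) out in \<open>simp_all add: eq_commute[of "f _ y"]\<close>)
  qed
  then show ?case
    using f(1) g(1,2) insert.hyps(2)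
    by (intro exI[of _ "f(x := g)"] conjI ballI) (auto split: if_splits dest!: bspec)
qed simp

text \<open>The vertices of \<open>D\<close> are new, so they impose conditions only on each other; each vertex of \<open>L\<close> still
  misses at least \<open>card D\<close> colors.\<close>
lemma add_bipartite:
  assumes c: "edge_colored E c C" and fin: "finite E" "finite C" "finite L" "finite D"
    and LD: "L \<inter> D = {}" and D: "D \<inter> \<Union>E = {}"
    and d: "\<And>x. x \<in> L \<Longrightarrow> edge_degree E x + card D \<le> card C"
    and LDle: "2 * card L \<le> card D + 1"
  shows "\<exists>c'. edge_colored (E \<union> bipartite L D) c' C"
proof -
  have "finite (missing E c C x) \<and> card D \<le> card (missing E c C x)" if "x \<in> L" for x
    using card_missing[OF fin(1,2) c, of x] d[OF that] finite_subset[OF missing_subset fin(2)] by auto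
  then have "\<exists>f :: 'a \<Rightarrow> 'a \<Rightarrow> nat. (\<forall>x\<in>L. inj_on (f x) D \<and> f x ` D \<subseteq> missing E c C x) \<and>
      (\<forall>y\<in>D. inj_on (\<lambda>x. f x y) L)"
    by (intro latin_filling fin LDle)
  then obtain f where f0: "\<forall>x\<in>L. inj_on (f x) D \<and> f x ` D \<subseteq> missing E c C x"
    "\<forall>y\<in>D. inj_on (\<lambda>x. f x y) L" by (elim exE conjE)
  have f: "inj_on (f x) D" "f x ` D \<subseteq> missing E c C x" if "x \<in> L" for x using f0(1) that by auto
  have f3: "inj_on (\<lambda>x. f x y) L" if "y \<in> D" for y using f0(2) that by auto
  define c' where "c' e = (if e \<in> E then c e else f (THE x. x \<in> e \<inter> L) (THE y. y \<in> e \<inter> D))" for e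
  have old: "c' e = c e" if "e \<in> E" for e using that by (simp add: c'_def)
  have new: "c' {x, y} = f x y" if "x \<in> L" "y \<in> D" for x y
  proof -
    have "{x, y} \<notin> E" using D that(2) by blast
    moreover have "(THE z. z \<in> {x, y} \<inter> L) = x" "(THE z. z \<in> {x, y} \<inter> D) = y"
      using that LD by (auto intro!: the_equality)
    ultimately show ?thesis by (simp add: c'_def)
  qed
  have fm: "f x y \<in> missing E c C x" if "x \<in> L" "y \<in> D" for x y
    using f(2) that by blast
  have "c' e \<noteq> c' {x, y}" if e: "e \<in> E" and xy: "x \<in> L" "y \<in> D" and meet: "e \<inter> {x, y} \<noteq> {}" for e x y
  proof -
    have "x \<in> e" using meet D e xy(2) by blast
    then show ?thesis using fm[OF xy] e unfolding old[OF e] new[OF xy] missing_def by auto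
  qed
  note mixed = this this[symmetric]
  have fresh: "c' {x, y} \<noteq> c' {x', y'}"
    if "x \<in> L" "y \<in> D" "x' \<in> L" "y' \<in> D" "{x, y} \<noteq> {x', y'}" "{x, y} \<inter> {x', y'} \<noteq> {}" for x y x' y'
  proof -
    have "x = x' \<and> y \<noteq> y' \<or> x \<noteq> x' \<and> y = y'" using that LD by blast
    then show ?thesis
      using f(1)[OF that(1)] f3[OF that(2)] that unfolding new[OF that(1,2)] new[OF that(3,4)]
      by (auto simp: inj_on_def)
  qed
  have "c' e \<noteq> c' e'" if in_E: "e \<in> E \<union> bipartite L D" "e' \<in> E \<union> bipartite L D" and ne: "e \<noteq> e'" "e \<inter> e' \<noteq> {}" for e e'
  proof -
    consider "e \<in> E" "e' \<in> E" | x y where "e \<in> E" "x \<in> L" "y \<in> D" "e' = {x, y}"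
      | x y where "e' \<in> E" "x \<in> L" "y \<in> D" "e = {x, y}"
      | x y x' y' where "x \<in> L" "y \<in> D" "e = {x, y}" "x' \<in> L" "y' \<in> D" "e' = {x', y'}"
      using in_E unfolding bipartite_def by (elim UnE CollectE exE conjE) simp_all
    then show ?thesis
    proof cases
      case 1
      then show ?thesis using c ne unfolding edge_colored_def by (auto simp: old)
    next
      case 2
      then show ?thesis using mixed(1) ne by auto
    next
      case 3
      then show ?thesis using mixed(2)[of e' x y] ne by auto
    next
      case 4
      then show ?thesis using fresh ne by auto
    qed
  qed
  moreover have "c' ` (E \<union> bipartite L D) \<subseteq> C"
  proof (rule image_subsetI)
    fix e assume "e \<in> E \<union> bipartite L D"
    then show "c' e \<in> C"
    proof
      assume "e \<in> E" then show ?thesis using edge_colored_in[OF c] by (simp add: old)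
    next
      assume "e \<in> bipartite L D"
      then obtain x y where "x \<in> L" "y \<in> D" "e = {x, y}" unfolding bipartite_def by blast
      then show ?thesis using fm[of x y] new[of x y] by (simp add: missing_def)
    qed
  qed
  ultimately have "edge_colored (E \<union> bipartite L D) c' C" unfolding edge_colored_def by blast
  then show ?thesis by blast
qed

lemma finite_bipartite: "finite L \<Longrightarrow> finite D \<Longrightarrow> finite (bipartite L D)"
  unfolding bipartite_def by (rule finite_image_set2) simp_all

text \<open>A block does not change the degrees in the other blocks, so they can be added one by one.\<close>
lemma add_bipartites:
  assumes "finite J" and c: "edge_colored E c C" and fin: "finite E" "finite C"
    and finLD: "\<And>i. i \<in> J \<Longrightarrow> finite (L i) \<and> finite (D i)"
    and LD: "\<And>i. i \<in> J \<Longrightarrow> L i \<inter> D i = {}" and D: "\<And>i. i \<in> J \<Longrightarrow> D i \<inter> \<Union>E = {}"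
    and disj: "\<And>i k. i \<in> J \<Longrightarrow> k \<in> J \<Longrightarrow> i \<noteq> k \<Longrightarrow> (L i \<union> D i) \<inter> (L k \<union> D k) = {}"
    and d: "\<And>i x. i \<in> J \<Longrightarrow> x \<in> L i \<Longrightarrow> edge_degree E x + card (D i) \<le> card C"
    and LDle: "\<And>i. i \<in> J \<Longrightarrow> 2 * card (L i) \<le> card (D i) + 1"
  shows "\<exists>c'. edge_colored (E \<union> (\<Union>i\<in>J. bipartite (L i) (D i))) c' C"
  using assms(1,5-)
proof (induction J rule: finite_induct)
  case empty
  then show ?case using c by auto
next
  case (insert i J)
  let ?E = "E \<union> (\<Union>k\<in>J. bipartite (L k) (D k))"
  have "\<exists>c'. edge_colored ?E c' C" 
    by (intro insert.IH) (simp_all add: insert.prems(1-5) insert.prems(6)[unfolded Suc_eq_plus1[symmetric]])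
  then obtain c1 where c1: "edge_colored ?E c1 C" by blast
  have away: "v \<notin> e" if "v \<in> L i \<union> D i" "k \<in> J" "e \<in> bipartite (L k) (D k)" for v k e
  proof -
    have "(L i \<union> D i) \<inter> (L k \<union> D k) = {}" using insert.prems(4)[of i k] insert.hyps(2) that(2) by auto
    moreover have "e \<subseteq> L k \<union> D k" using that(3) by (auto simp: bipartite_def)
    ultimately show ?thesis using that(1) by blast
  qed
  have finE: "finite ?E" using fin insert.hyps(1) insert.prems(1) by (auto intro!: finite_bipartite)
  have "\<exists>c'. edge_colored (?E \<union> bipartite (L i) (D i)) c' C"
  proof (rule add_bipartite[OF c1 finE fin(2)])
    show "D i \<inter> \<Union>?E = {}" 
    proof -
      have "y \<notin> e" if "y \<in> D i" "e \<in> ?E" for y e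
        using that insert.prems(3)[of i] away[of y _ e] by auto
      then show ?thesis by blast
    qed
    show "edge_degree ?E x + card (D i) \<le> card C" if "x \<in> L i" for x
    proof -
      have "x \<notin> e" if "k \<in> J" "e \<in> bipartite (L k) (D k)" for k e
        using away[OF _ that] \<open>x \<in> L i\<close> by simp
      then have "{e \<in> ?E. x \<in> e} = {e \<in> E. x \<in> e}" by auto
      then show ?thesis using insert.prems(5)[of i x] that by (simp add: edge_degree_def)
    qed
  qed (use insert.prems in auto)
  moreover have "?E \<union> bipartite (L i) (D i) = E \<union> (\<Union>k\<in>insert i J. bipartite (L k) (D k))" by auto
  ultimately show ?case by simp
qed

section \<open>Chromatic numbers from colorings\<close>

definition simple_graph :: "'a graph \<Rightarrow> bool" where
  "simple_graph G \<longleftrightarrow> finite (vertices G) \<and> simple_edges (edges G) \<and> \<Union>(edges G) \<subseteq> vertices G"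

definition total_colorable :: "'a graph \<Rightarrow> nat \<Rightarrow> bool" where
  "total_colorable G k \<longleftrightarrow> (\<exists>cv ce. proper_total_coloring G cv ce \<and>
     cv ` vertices G \<subseteq> {..<k} \<and> ce ` edges G \<subseteq> {..<k})"

lemma total_chromatic_number_Least: "total_chromatic_number G = (LEAST k. total_colorable G k)"
  by (simp add: total_chromatic_number_def total_colorable_def)

lemma vertex_degree_eq: "vertex_degree G v = edge_degree (edges G) v"
  by (simp add: vertex_degree_def edge_degree_def)

lemma edge_colored_iff:
  "edge_colored (edges G) c C \<longleftrightarrow> proper_edge_coloring G c \<and> c ` edges G \<subseteq> C"
  by (auto simp: edge_colored_def proper_edge_coloring_def)

lemma max_degree_eqI:
  assumes "finite (vertices G)" "v \<in> vertices G" "vertex_degree G v = d"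
    and "\<And>v. v \<in> vertices G \<Longrightarrow> vertex_degree G v \<le> d"
  shows "max_degree G = d"
proof -
  have "Max (vertex_degree G ` vertices G) = d" using assms by (intro Max_eqI) auto
  then show ?thesis using assms(2) by (auto simp: max_degree_def)
qed

lemma max_degree_attained:
  assumes "finite (vertices G)" "vertices G \<noteq> {}"
  obtains v where "v \<in> vertices G" "vertex_degree G v = max_degree G"
proof -
  have "Max (vertex_degree G ` vertices G) \<in> vertex_degree G ` vertices G"
    using assms by (intro Max_in) auto
  then obtain v where "v \<in> vertices G" "Max (vertex_degree G ` vertices G) = vertex_degree G v" by blast
  then show ?thesis using that[of v] assms(2) unfolding max_degree_def by auto
qed

lemma vertex_degree_le_max_degree:
  "finite (vertices G) \<Longrightarrow> v \<in> vertices G \<Longrightarrow> vertex_degree G v \<le> max_degree G"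
  unfolding max_degree_def by auto

lemma edge_chromatic_number_eq_max_degree:
  assumes G: "simple_graph G" and c: "edge_colored (edges G) c {..<max_degree G}"
  shows "edge_chromatic_number G = max_degree G"
  unfolding edge_chromatic_number_def edge_colored_iff[symmetric]
proof (rule Least_equality)
  show "\<exists>c. edge_colored (edges G) c {..<max_degree G}" using c by blast
  fix k assume "\<exists>c. edge_colored (edges G) c {..<k}"
  then obtain c where c: "edge_colored (edges G) c {..<k}" by blast
  show "max_degree G \<le> k"
  proof (cases "vertices G = {}")
    case False
    then obtain v where "vertex_degree G v = max_degree G"
      using max_degree_attained G by (metis simple_graph_def)
    then show ?thesis
      using card_missing[OF _ _ c, of v] G
      by (simp add: vertex_degree_eq simple_graph_def simple_edges_def)
  qed (simp add: max_degree_def)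
qed

lemma max_degree_less_total:
  assumes G: "simple_graph G" and ne: "vertices G \<noteq> {}" and k: "total_colorable G k"
  shows "max_degree G < k"
proof -
  obtain v where v: "v \<in> vertices G" "vertex_degree G v = max_degree G"
    using max_degree_attained G ne by (metis simple_graph_def)
  obtain cv ce where c: "proper_total_coloring G cv ce" "cv ` vertices G \<subseteq> {..<k}" "ce ` edges G \<subseteq> {..<k}"
    using k unfolding total_colorable_def by blast
  have ce: "edge_colored (edges G) ce {..<k}"
    using c by (simp add: edge_colored_iff proper_total_coloring_def)
  have "cv v \<noteq> ce e" if "e \<in> edges G" "v \<in> e" for e
    using c(1) v(1) that unfolding proper_total_coloring_def by blast
  then have "cv v \<in> missing (edges G) ce {..<k} v"
    using c(2) v(1) by (force simp: missing_def)
  then have "0 < card (missing (edges G) ce {..<k} v)"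
    using finite_subset[OF missing_subset, of "{..<k}"] by (auto simp: card_gt_0_iff)
  then show ?thesis
    using card_missing[OF _ _ ce, of v] G v(2)
    by (simp add: vertex_degree_eq simple_graph_def simple_edges_def)
qed

lemma total_chromatic_number_eqI:
  assumes "total_colorable G k" "\<And>j. total_colorable G j \<Longrightarrow> k \<le> j"
  shows "total_chromatic_number G = k"
  unfolding total_chromatic_number_Least using assms by (rule Least_equality)

lemma satisfies_TCC_I:
  assumes G: "simple_graph G" and k: "total_colorable G k" "k \<le> max_degree G + 2"
  shows "satisfies_TCC G"
proof (cases "vertices G = {}")
  case False
  have "total_colorable G (total_chromatic_number G)" "total_chromatic_number G \<le> k"
    unfolding total_chromatic_number_Least using k(1) by (auto intro: LeastI Least_le)
  then have "max_degree G < total_chromatic_number G" "total_chromatic_number G \<le> max_degree G + 2"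
    using max_degree_less_total[OF G False] k(2) by auto
  then have "total_chromatic_number G = max_degree G + 1 \<or> total_chromatic_number G = max_degree G + 2"
    by linarith
  then show ?thesis by (simp add: satisfies_TCC_def)
qed (simp add: satisfies_TCC_def)

lemma type_I_I:
  assumes G: "simple_graph G" "vertices G \<noteq> {}" and k: "total_colorable G (max_degree G + 1)"
  shows "satisfies_TCC G" "\<not> type_II G"
proof -
  have "total_chromatic_number G = max_degree G + 1"
    using max_degree_less_total[OF G] k by (intro total_chromatic_number_eqI) (auto simp: Suc_le_eq)
  then show "satisfies_TCC G" "\<not> type_II G" by (auto simp: satisfies_TCC_def type_II_def)
qed

text \<open>A vertex of small degree can be colored last: its edges and its neighbors use at most twice its
  degree many colors.\<close>
lemma color_vertices_greedily:
  assumes G: "simple_graph G" and ce: "edge_colored (edges G) ce {..<k}" and S: "S \<subseteq> vertices G"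
    and S_in: "\<And>x. x \<in> S \<Longrightarrow> cv x < k"
    and S_inc: "\<And>x e. x \<in> S \<Longrightarrow> e \<in> edges G \<Longrightarrow> x \<in> e \<Longrightarrow> cv x \<noteq> ce e"
    and S_adj: "\<And>x y. x \<in> S \<Longrightarrow> y \<in> S \<Longrightarrow> x \<noteq> y \<Longrightarrow> {x, y} \<in> edges G \<Longrightarrow> cv x \<noteq> cv y"
    and small: "\<And>v. v \<in> vertices G - S \<Longrightarrow> 2 * edge_degree (edges G) v < k"
  shows "total_colorable G k"
proof -
  have finE: "finite (edges G)" and finV: "finite (vertices G)"
    using G by (auto simp: simple_graph_def simple_edges_def)
  define good where "good cv A \<longleftrightarrow> (\<forall>x\<in>A. cv x < k) \<and> (\<forall>x\<in>A. \<forall>e\<in>edges G. x \<in> e \<longrightarrow> cv x \<noteq> ce e) \<and>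
      (\<forall>x\<in>A. \<forall>y\<in>A. x \<noteq> y \<longrightarrow> {x, y} \<in> edges G \<longrightarrow> cv x \<noteq> cv y)" for cv A
  have step: "\<exists>cv. good cv (S \<union> T)"
    if "finite T" "T \<subseteq> vertices G - S" for T
    using that
  proof (induction T rule: finite_induct)
    case empty
    then show ?case using S_in S_inc S_adj unfolding good_def by (intro exI[of _ cv]) auto
  next
    case (insert v T)
    have "\<exists>cv. good cv (S \<union> T)" using insert.prems by (intro insert.IH) blast
    then obtain cv where cv: "good cv (S \<union> T)" by blast
    let ?A = "{e \<in> edges G. v \<in> e}" and ?N = "{w. {v, w} \<in> edges G}"
    have inj: "inj_on (\<lambda>w. {v, w}) ?N" by (auto simp: inj_on_def doubleton_eq_iff)
    have sub: "(\<lambda>w. {v, w}) ` ?N \<subseteq> ?A" by auto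
    have finN: "finite ?N" using finite_imageD[OF finite_subset[OF sub] inj] finE by simp
    have "card ?N \<le> card ?A" using card_inj_on_le[OF inj sub] finE by simp
    then have "card (ce ` ?A \<union> cv ` ?N) \<le> 2 * edge_degree (edges G) v"
      using card_Un_le[of "ce ` ?A" "cv ` ?N"] card_image_le[of ?A ce] card_image_le[of ?N cv] finE finN
      by (simp add: edge_degree_def)
    then have "card (ce ` ?A \<union> cv ` ?N) < card {..<k}"
      using small[of v] insert.prems by simp
    then have "\<not> {..<k} \<subseteq> ce ` ?A \<union> cv ` ?N"
      using card_mono[of "ce ` ?A \<union> cv ` ?N" "{..<k}"] finE finN by auto
    then obtain t where t: "t < k" "t \<notin> ce ` ?A" "t \<notin> cv ` ?N" by blast
    have vT: "v \<notin> S \<union> T" using insert by auto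
    have new_inc: "t \<noteq> ce e" if "e \<in> edges G" "v \<in> e" for e using t(2) that by blast
    have new_adj: "t \<noteq> cv w" if "{v, w} \<in> edges G \<or> {w, v} \<in> edges G" for w
      using t(3) that by (auto simp: insert_commute)
    have "good (cv(v := t)) (insert v (S \<union> T))"
      unfolding good_def
    proof (intro conjI ballI impI)
      fix x y assume xy: "x \<in> insert v (S \<union> T)" "y \<in> insert v (S \<union> T)" "x \<noteq> y" "{x, y} \<in> edges G"
      then consider "x = v" "y \<noteq> v" | "x \<noteq> v" "y = v" | "x \<in> S \<union> T" "y \<in> S \<union> T" "x \<noteq> v" "y \<noteq> v" by blast
      then show "(cv(v := t)) x \<noteq> (cv(v := t)) y"
        using new_adj xy cv unfolding good_def by cases (auto simp: eq_commute[of _ t])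
    qed (use cv new_inc t(1) in \<open>auto simp: good_def\<close>)
    then show ?case by auto
  qed
  have "S \<union> (vertices G - S) = vertices G" using S by blast
  then obtain cv' where cv': "good cv' (vertices G)" using step[of "vertices G - S"] finV by auto
  have "x \<in> vertices G" "y \<in> vertices G" if "{x, y} \<in> edges G" for x y
    using G that unfolding simple_graph_def by auto
  then have "proper_vertex_coloring G cv'"
    using cv' unfolding good_def proper_vertex_coloring_def by blast
  then have "proper_total_coloring G cv' ce"
    using cv' ce by (auto simp: good_def proper_total_coloring_def edge_colored_iff)
  then show ?thesis
    using cv' ce unfolding total_colorable_def
    by (intro exI[of _ cv'] exI[of _ ce]) (auto simp: good_def edge_colored_iff)
qed

section \<open>The disjointness graph of supports\<close>

lemma edge_degree_neighbors:
  assumes "simple_edges E"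
  shows "edge_degree E x = card {y. {x, y} \<in> E}" "finite {y. {x, y} \<in> E}"
proof -
  have inj: "inj_on (\<lambda>y. {x, y}) {y. {x, y} \<in> E}" by (auto simp: inj_on_def doubleton_eq_iff)
  have im: "(\<lambda>y. {x, y}) ` {y. {x, y} \<in> E} = {e \<in> E. x \<in> e}"
  proof
    show "{e \<in> E. x \<in> e} \<subseteq> (\<lambda>y. {x, y}) ` {y. {x, y} \<in> E}"
    proof
      fix e assume e: "e \<in> {e \<in> E. x \<in> e}"
      then obtain u v where "e = {u, v}" using assms by (auto simp: simple_edges_def card_2_iff)
      then show "e \<in> (\<lambda>y. {x, y}) ` {y. {x, y} \<in> E}" using e by (auto simp: insert_commute)
    qed
  qed auto
  show "edge_degree E x = card {y. {x, y} \<in> E}"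
    using card_image[OF inj] im by (simp add: edge_degree_def)
  show "finite {y. {x, y} \<in> E}"
    using finite_imageD[OF _ inj] im assms by (simp add: simple_edges_def)
qed

text \<open>Three coordinates leave two besides any given one. The estimates for products below use only two of
  the factors.\<close>
lemma prod_ge_two_factors:
  fixes f :: "'i \<Rightarrow> nat"
  assumes "finite S" "j \<in> S" "k \<in> S" "j \<noteq> k" "\<And>i. i \<in> S \<Longrightarrow> 1 \<le> f i"
  shows "f j * f k \<le> prod f S"
proof -
  have "prod f S = f j * (f k * prod f (S - {j} - {k}))"
    using assms by (simp add: prod.remove[of S j] prod.remove[of "S - {j}" k])
  moreover have "1 \<le> prod f (S - {j} - {k})" using assms by (intro prod_ge_1) auto
  ultimately show ?thesis by (simp add: mult.assoc[symmetric])
qed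

lemma one_plus_sum_le_prod:
  fixes f :: "'i \<Rightarrow> nat"
  assumes "finite S"
  shows "1 + sum f S \<le> (\<Prod>i\<in>S. 1 + f i)"
  using assms
proof (induction S rule: finite_induct)
  case (insert x S)
  have "1 + sum f (insert x S) \<le> (1 + f x) * (1 + sum f S)" using insert.hyps by simp
  also have "\<dots> \<le> (1 + f x) * (\<Prod>i\<in>S. 1 + f i)" using insert.IH by (rule mult_left_mono) simp
  finally show ?case using insert.hyps by simp
qed simp

lemma one_plus_sum_plus_product_le_prod:
  fixes f :: "'i \<Rightarrow> nat"
  assumes S: "finite S" "j \<in> S" "k \<in> S" "j \<noteq> k"
  shows "1 + sum f S + f j * f k \<le> (\<Prod>i\<in>S. 1 + f i)"
proof -
  let ?T = "S - {j} - {k}"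
  have "1 + sum f S + f j * f k = (1 + f j) * (1 + f k) + sum f ?T"
    using S by (simp add: sum.remove[of S j] sum.remove[of "S - {j}" k] algebra_simps)
  also have "\<dots> \<le> (1 + f j) * (1 + f k) * (1 + sum f ?T)" by simp
  also have "\<dots> \<le> (1 + f j) * (1 + f k) * (\<Prod>i\<in>?T. 1 + f i)"
    using one_plus_sum_le_prod[of ?T f] S by (intro mult_left_mono) auto
  also have "\<dots> = (\<Prod>i\<in>S. 1 + f i)"
    using S by (simp add: prod.remove[of S j] prod.remove[of "S - {j}" k] algebra_simps)
  finally show ?thesis .
qed

text \<open>The number \<open>a i\<close> is that of the nonzero elements of the \<open>i\<close>-th factor of a product of fields. Only
  supports and their numbers enter, so both the maximal ideals of a ring and the factors of a given product
  can serve as coordinates, while the vertices remain elements of the ring.\<close>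
locale support_graph =
  fixes A :: "'a set" and supp :: "'a \<Rightarrow> 'i set" and I :: "'i set" and a :: "'i \<Rightarrow> nat"
  assumes finite_A: "finite A" and finite_I: "finite I"
    and supp_subset: "x \<in> A \<Longrightarrow> supp x \<subseteq> I"
    and card_supp: "S \<subseteq> I \<Longrightarrow> card {x \<in> A. supp x = S} = (\<Prod>i\<in>S. a i)"
    and pos: "i \<in> I \<Longrightarrow> 0 < a i"
begin

definition V :: "'a set" where
  "V = {x \<in> A. supp x \<noteq> {} \<and> supp x \<noteq> I}"

definition G :: "'a graph" where
  "G = \<lparr>vertices = V, edges = {{x, y} | x y. x \<in> V \<and> y \<in> V \<and> x \<noteq> y \<and> supp x \<inter> supp y = {}}\<rparr>"

definition L :: "'i \<Rightarrow> 'a set" where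
  "L i = {x \<in> A. supp x = {i}}"

definition D :: "'i \<Rightarrow> 'a set" where
  "D i = {x \<in> A. supp x = I - {i}}"

lemma vertices_G [simp]: "vertices G = V"
  by (simp add: G_def)

lemma finite_V: "finite V"
  using finite_A by (simp add: V_def)

lemma edge_iff: "{x, y} \<in> edges G \<longleftrightarrow> x \<in> V \<and> y \<in> V \<and> supp x \<inter> supp y = {}"
  unfolding G_def V_def by (auto simp: doubleton_eq_iff)

lemma edgeE:
  assumes "e \<in> edges G"
  obtains x y where "e = {x, y}" "x \<in> V" "y \<in> V" "x \<noteq> y" "supp x \<inter> supp y = {}"
  using assms unfolding G_def by auto

lemma simple_graph_G: "simple_graph G"
proof -
  have "edges G \<subseteq> Pow V" by (auto elim: edgeE)
  then have "finite (edges G)" using finite_V by (meson finite_Pow_iff finite_subset)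
  then show ?thesis
    using finite_V by (auto simp: simple_graph_def simple_edges_def elim!: edgeE)
qed

lemma card_supp_subset:
  assumes "S \<subseteq> I"
  shows "card {x \<in> A. supp x \<subseteq> S} = (\<Prod>i\<in>S. 1 + a i)"
proof -
  have fin: "finite S" using assms finite_I finite_subset by blast
  have "{x \<in> A. supp x \<subseteq> S} = (\<Union>T\<in>Pow S. {x \<in> A. supp x = T})" by auto
  also have "card \<dots> = (\<Sum>T\<in>Pow S. card {x \<in> A. supp x = T})"
    using fin finite_A by (intro card_UN_disjoint) auto
  also have "\<dots> = (\<Sum>T\<in>Pow S. \<Prod>i\<in>T. a i)"
    using assms by (intro sum.cong card_supp) auto
  also have "\<dots> = (\<Prod>i\<in>S. a i + 1)"
    using prod_add[OF fin, of a "\<lambda>_. 1"] by simp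
  finally show ?thesis by (simp add: add.commute)
qed

lemma zero_ex: obtains z where "z \<in> A" "supp z = {}"
proof -
  have "card {x \<in> A. supp x = {}} = 1" using card_supp[of "{}"] by simp
  then show ?thesis using that by (auto simp: card_1_singleton_iff)
qed

lemma degree_G:
  assumes x: "x \<in> V"
  shows "edge_degree (edges G) x + 1 = (\<Prod>i\<in>I - supp x. 1 + a i)"
proof -
  let ?S = "{y \<in> A. supp y \<subseteq> I - supp x}" and ?Z = "{y \<in> A. supp y = {}}"
  have "{y. {x, y} \<in> edges G} = ?S - ?Z"
    using x supp_subset unfolding edge_iff V_def by blast
  moreover have "?Z \<subseteq> ?S" by auto
  moreover have "card ?Z = 1" using card_supp[of "{}"] by simp
  moreover have "1 \<le> card ?S" using card_mono[OF _ \<open>?Z \<subseteq> ?S\<close>] finite_A \<open>card ?Z = 1\<close> by simp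
  ultimately have "card {y. {x, y} \<in> edges G} + 1 = card ?S"
    using finite_A by (simp add: card_Diff_subset)
  then show ?thesis
    using edge_degree_neighbors(1)[of "edges G" x] simple_graph_G card_supp_subset[of "I - supp x"]
    by (simp add: simple_graph_def)
qed

lemma degree_outside: "x \<notin> V \<Longrightarrow> edge_degree (edges G) x = 0"
proof -
  assume "x \<notin> V"
  then have "{e \<in> edges G. x \<in> e} = {}" by (auto elim!: edgeE)
  then show ?thesis by (simp only: edge_degree_def card.empty)
qed

lemma card_L: "i \<in> I \<Longrightarrow> card (L i) = a i"
  using card_supp[of "{i}"] by (simp add: L_def)

lemma card_D: "i \<in> I \<Longrightarrow> card (D i) = (\<Prod>j\<in>I - {i}. a j)"
  using card_supp[of "I - {i}"] by (simp add: D_def)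

lemma card_D_pos: "i \<in> I \<Longrightarrow> 0 < card (D i)"
  unfolding card_D by (rule prod_pos) (use pos in blast)

lemma finite_LD: "finite (L i)" "finite (D i)"
  using finite_A by (simp_all add: L_def D_def)

lemma nonempty_supp:
  assumes "S \<subseteq> I" obtains x where "x \<in> A" "supp x = S"
proof -
  have "0 < (\<Prod>i\<in>S. a i)" using assms pos by (intro prod_pos) auto
  then have "{x \<in> A. supp x = S} \<noteq> {}" using card_supp[OF assms] by (metis card.empty less_irrefl)
  then show ?thesis using that by blast
qed

end

section \<open>Three or more coordinates: the graph itself\<close>

locale support_graph_3 = support_graph A supp I a
  for A :: "'a set" and supp :: "'a \<Rightarrow> 'i set" and I a +
  fixes m :: 'i
  assumes three: "3 \<le> card I" and m: "m \<in> I" and m_min: "i \<in> I \<Longrightarrow> a m \<le> a i"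
begin

lemma other_two:
  assumes "i \<in> I"
  obtains j k where "j \<in> I - {i}" "k \<in> I - {i}" "j \<noteq> k"
proof -
  have "2 \<le> card (I - {i})" using three assms finite_I by simp
  then obtain T where "T \<subseteq> I - {i}" "card T = 2" by (rule obtain_subset_with_card_n) blast
  then show ?thesis using that by (auto simp: card_2_iff)
qed

text \<open>The degree of a vertex with support \<open>{m}\<close>: the neighbors are the nonzero elements that vanish at \<open>m\<close>.\<close>
definition Delta :: nat where
  "Delta = (\<Prod>i\<in>I - {m}. 1 + a i) - 1"

lemma Suc_Delta: "Delta + 1 = (\<Prod>i\<in>I - {m}. 1 + a i)"
proof -
  have "1 \<le> (\<Prod>i\<in>I - {m}. 1 + a i)" by (intro prod_ge_1) auto
  then show ?thesis by (simp add: Delta_def)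
qed

text \<open>Both sides are the number of all elements, by \<open>degree_G\<close>. So a degree is the larger the smaller the product
  over the support is.\<close>
lemma degree_product:
  assumes x: "x \<in> V"
  shows "(edge_degree (edges G) x + 1) * (\<Prod>i\<in>supp x. 1 + a i) = (Delta + 1) * (1 + a m)"
proof -
  have "supp x \<subseteq> I" using x supp_subset by (simp add: V_def)
  then have "(edge_degree (edges G) x + 1) * (\<Prod>i\<in>supp x. 1 + a i) = (\<Prod>i\<in>I. 1 + a i)"
    using prod.subset_diff[OF _ finite_I, of "supp x" "\<lambda>i. 1 + a i"] degree_G[OF x] by simp
  also have "\<dots> = (Delta + 1) * (1 + a m)"
    unfolding Suc_Delta using prod.remove[OF finite_I m, of "\<lambda>i. 1 + a i"] by (simp add: mult.commute)
  finally show ?thesis .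
qed

definition J :: "'i set" where
  "J = {i \<in> I. a i = a m}"

lemma degree_core:
  assumes "i \<in> J" "x \<in> L i"
  shows "edge_degree (edges G) x = Delta"
proof -
  have "I \<noteq> {i}" using three by auto
  then have "x \<in> V" "supp x = {i}" using assms by (auto simp: V_def L_def)
  then have "(edge_degree (edges G) x + 1) * (1 + a m) = (Delta + 1) * (1 + a m)"
    using degree_product[of x] assms(1) by (simp add: J_def)
  then have "edge_degree (edges G) x + 1 = Delta + 1"
    by (rule mult_right_cancel[THEN iffD1, rotated]) simp
  then show ?thesis by simp
qed

text \<open>The product over the support is at least \<open>(1 + a m) * 2\<close>. The factor 2 is what a greedy coloring
  of these vertices needs.\<close>
lemma degree_heavy:
  assumes x: "x \<in> V" and two: "i \<in> supp x" "j \<in> supp x" "i \<noteq> j"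
  shows "2 * (edge_degree (edges G) x + 1) \<le> Delta + 1"
proof -
  have sub: "supp x \<subseteq> I" using x supp_subset by (simp add: V_def)
  have "2 * (1 + a m) \<le> (1 + a j) * (1 + a i)"
    using pos[of j] m_min[of i] sub two by (intro mult_mono) auto
  also have "\<dots> \<le> (\<Prod>i\<in>supp x. 1 + a i)"
    using two sub finite_subset[OF sub finite_I] by (intro prod_ge_two_factors) auto
  finally have "(edge_degree (edges G) x + 1) * (2 * (1 + a m)) \<le> (Delta + 1) * (1 + a m)"
    unfolding degree_product[OF x, symmetric] by (rule mult_left_mono) simp
  then have "(2 * (edge_degree (edges G) x + 1)) * (1 + a m) \<le> (Delta + 1) * (1 + a m)"
    by (simp add: algebra_simps)
  then show ?thesis by (rule mult_right_le_imp_le) simp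
qed

lemma supp_cases:
  assumes "x \<in> V"
  obtains i where "i \<in> I" "x \<in> L i" | i j where "i \<in> supp x" "j \<in> supp x" "i \<noteq> j"
proof -
  obtain i where i: "i \<in> supp x" using assms by (auto simp: V_def)
  show ?thesis
  proof (cases "supp x = {i}")
    case True
    then show ?thesis using that(1)[of i] assms supp_subset[of x] i by (auto simp: L_def V_def)
  next
    case False
    then show ?thesis using that(2)[of i] i by blast
  qed
qed

lemma degree_less:
  assumes x: "x \<in> V" and "\<And>i. i \<in> J \<Longrightarrow> x \<notin> L i"
  shows "edge_degree (edges G) x < Delta"
  using x
proof (cases rule: supp_cases)
  case (1 i)
  then have "a m < a i" using assms(2)[of i] m_min[of i] by (auto simp: J_def order.order_iff_strict)
  moreover have "(edge_degree (edges G) x + 1) * (1 + a i) = (Delta + 1) * (1 + a m)"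
    using degree_product[OF x] 1 by (simp add: L_def)
  ultimately have "(edge_degree (edges G) x + 1) * (1 + a m) < (Delta + 1) * (1 + a m)"
    by (metis add_gr_0 add_less_cancel_left mult_less_mono2 zero_less_one)
  then have "edge_degree (edges G) x + 1 < Delta + 1" by (rule mult_right_less_imp_less) simp
  then show ?thesis by simp
next
  case (2 i j)
  then show ?thesis using degree_heavy[OF x 2] by simp
qed

lemma L_V: "i \<in> I \<Longrightarrow> L i \<subseteq> V"
  using three by (auto simp: L_def V_def)

lemma D_V:
  assumes "i \<in> I" shows "D i \<subseteq> V"
proof -
  obtain j k where "j \<in> I - {i}" "k \<in> I - {i}" "j \<noteq> k" by (rule other_two[OF assms])
  then show ?thesis using assms by (auto simp: D_def V_def)
qed

lemma max_degree_G: "max_degree G = Delta"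
proof -
  obtain x where x: "x \<in> L m" using nonempty_supp[of "{m}"] m by (auto simp: L_def)
  have mJ: "m \<in> J" using m by (simp add: J_def)
  show ?thesis
  proof (rule max_degree_eqI[of G x])
    fix v assume "v \<in> vertices G"
    then show "vertex_degree G v \<le> Delta"
      using degree_less[of v] degree_core[of _ v] by (cases "\<exists>i\<in>J. v \<in> L i") (auto simp: vertex_degree_eq)
  qed (use x L_V[OF m] finite_V degree_core[OF mJ x] in \<open>auto simp: vertex_degree_eq\<close>)
qed

definition E1 :: "'a set set" where
  "E1 = edges G - (\<Union>i\<in>J. bipartite (L i) (D i))"

lemma JI: "i \<in> J \<Longrightarrow> i \<in> I"
  by (simp add: J_def)

lemma edges_G: "edges G = E1 \<union> (\<Union>i\<in>J. bipartite (L i) (D i))"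
proof -
  have "{x, y} \<in> edges G" if "i \<in> J" "x \<in> L i" "y \<in> D i" for i x y
    using that L_V[of i] D_V[of i] JI[of i] unfolding edge_iff by (auto simp: L_def D_def)
  then have "(\<Union>i\<in>J. bipartite (L i) (D i)) \<subseteq> edges G" by (auto simp: bipartite_def)
  then show ?thesis unfolding E1_def by blast
qed

lemma D_L:
  assumes "i \<in> I" shows "D i \<inter> L k = {}"
proof -
  obtain j l where "j \<in> I - {i}" "l \<in> I - {i}" "j \<noteq> l" by (rule other_two[OF assms])
  then have "I - {i} \<noteq> {k}" by (metis singletonD)
  then show ?thesis by (auto simp: D_def L_def)
qed

lemma L_L: "i \<noteq> k \<Longrightarrow> L i \<inter> L k = {}"
  by (auto simp: L_def)

lemma D_D:
  assumes "i \<in> I" "k \<in> I" "i \<noteq> k" shows "D i \<inter> D k = {}"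
proof -
  have "k \<in> I - {i}" "k \<notin> I - {k}" using assms by auto
  then have "I - {i} \<noteq> I - {k}" by metis
  then show ?thesis by (auto simp: D_def)
qed

text \<open>A neighbor of a vertex of \<open>D i\<close> has support \<open>{i}\<close>, so all edges at \<open>D i\<close> have been deleted.\<close>
lemma D_E1:
  assumes "i \<in> J" shows "D i \<inter> \<Union>E1 = {}"
proof -
  have False if y: "y \<in> D i" and e: "e \<in> E1" "y \<in> e" for y e
  proof -
    obtain x where x: "e = {x, y}" "x \<in> V" "supp x \<inter> supp y = {}"
      using e unfolding E1_def by (auto elim!: edgeE simp: insert_commute Int_commute)
    have "supp x = {i}" using x y supp_subset[of x] by (auto simp: V_def D_def)
    then have "x \<in> L i" using x(2) by (simp add: L_def V_def)
    then show False using e(1) x(1) y assms by (auto simp: E1_def bipartite_def)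
  qed
  then show ?thesis by blast
qed

lemma simple_edges_E1: "simple_edges E1"
  by (rule simple_edges_subset[of "edges G"]) (use simple_graph_G in \<open>auto simp: simple_graph_def E1_def\<close>)

lemma degree_E1_core:
  assumes i: "i \<in> J" and x: "x \<in> L i"
  shows "edge_degree E1 x + card (D i) = Delta"
proof -
  have se: "simple_edges (edges G)" using simple_graph_G by (simp add: simple_graph_def)
  have D: "D i \<subseteq> {y. {x, y} \<in> edges G}"
    using assms edges_G by (auto simp: bipartite_def)
  have "{x, y} \<in> E1 \<longleftrightarrow> {x, y} \<in> edges G \<and> y \<notin> D i" for y
  proof -
    have "y \<in> D i" if k: "k \<in> J" and xy: "{x, y} \<in> bipartite (L k) (D k)" for k
    proof -
      obtain u w where uw: "{x, y} = {u, w}" "u \<in> L k" "w \<in> D k" using xy by (auto simp: bipartite_def)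
      have "x \<noteq> w" using uw(3) D_L[OF JI[OF k]] x by blast
      then have "x = u" "y = w" using uw(1) by (auto simp: doubleton_eq_iff)
      moreover have "k = i" using uw(2) x \<open>x = u\<close> by (simp add: L_def)
      ultimately show ?thesis using uw(3) by simp
    qed
    moreover have "{x, y} \<in> bipartite (L i) (D i)" if "y \<in> D i" using that x by (auto simp: bipartite_def)
    ultimately show ?thesis using i unfolding E1_def by blast
  qed
  then have "{y. {x, y} \<in> E1} = {y. {x, y} \<in> edges G} - D i" by blast
  then have "edge_degree E1 x = edge_degree (edges G) x - card (D i)"
    using edge_degree_neighbors(1)[OF se] edge_degree_neighbors(1)[OF simple_edges_E1] D finite_LD
    by (simp add: card_Diff_subset)
  moreover have "card (D i) \<le> edge_degree (edges G) x"
    using card_mono[OF edge_degree_neighbors(2)[OF se] D] edge_degree_neighbors(1)[OF se] by simp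
  ultimately show ?thesis using degree_core[OF assms] by simp
qed

lemma degree_E1: "edge_degree E1 x < Delta"
proof (cases "\<exists>i\<in>J. x \<in> L i")
  case True
  then obtain i where i: "i \<in> J" "x \<in> L i" by blast
  show ?thesis using degree_E1_core[OF i] card_D_pos[OF JI[OF i(1)]] by linarith
next
  case False
  have le: "edge_degree E1 x \<le> edge_degree (edges G) x"
    using simple_graph_G unfolding edge_degree_def E1_def simple_graph_def simple_edges_def
    by (intro card_mono) auto
  show ?thesis
  proof (cases "x \<in> V")
    case True
    then show ?thesis using degree_less[of x] False le by (meson le_less_trans)
  next
    case out: False
    obtain y where "y \<in> L m" using nonempty_supp[of "{m}"] m by (auto simp: L_def)
    then have "0 < Delta"
      using degree_E1_core[of m y] m card_D_pos[OF m] by (simp add: J_def)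
    then show ?thesis using le degree_outside[OF out] by simp
  qed
qed

lemma card_L_le_D:
  assumes "i \<in> J"
  shows "2 * card (L i) \<le> card (D i) + 1"
proof -
  have iI: "i \<in> I" and ai: "a i = a m" using assms by (auto simp: J_def)
  obtain j k where jk: "j \<in> I - {i}" "k \<in> I - {i}" "j \<noteq> k" using other_two[OF iI] by blast
  have "2 * a m \<le> a m * a m + 1"
  proof -
    have "0 < a m" using pos m by blast
    then obtain b where "a m = Suc b" using gr0_implies_Suc by blast
    then show ?thesis by simp
  qed
  also have "a m * a m \<le> a j * a k" using m_min jk by (intro mult_mono) auto
  also have "a j * a k \<le> card (D i)"
    using jk pos finite_I card_D[OF iI] by (auto simp: Suc_le_eq intro!: prod_ge_two_factors)
  finally show ?thesis using card_L[OF iI] ai by simp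
qed

text \<open>Without the edges between \<open>L i\<close> and \<open>D i\<close> for the minimal \<open>a i\<close>, all degrees drop below the maximum
  degree, so Vizing's theorem colors the rest. Each vertex of \<open>D i\<close> has no other edges.\<close>
lemma edge_coloring_G: "\<exists>c. edge_colored (edges G) c {..<Delta}"
proof -
  obtain c where c: "edge_colored E1 c {..<Delta}"
    using vizing[OF simple_edges_E1, of "{..<Delta}"] degree_E1 by auto
  have "\<exists>c'. edge_colored (E1 \<union> (\<Union>i\<in>J. bipartite (L i) (D i))) c' {..<Delta}"
  proof (rule add_bipartites[OF _ c])
    show "finite J" using finite_I by (simp add: J_def)
    show "(L i \<union> D i) \<inter> (L k \<union> D k) = {}" if "i \<in> J" "k \<in> J" "i \<noteq> k" for i k
      using L_L[OF that(3)] D_D[OF JI[OF that(1)] JI[OF that(2)] that(3)]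
        D_L[OF JI[OF that(1)]] D_L[OF JI[OF that(2)]] by blast
    show "L i \<inter> D i = {}" if "i \<in> J" for i using D_L[OF JI[OF that]] by blast
  qed (use simple_edges_E1 finite_LD D_E1 degree_E1_core card_L_le_D in \<open>auto simp: simple_edges_def\<close>)
  then show ?thesis by (simp add: edges_G[symmetric])
qed

text \<open>The left side is the number of elements with a support of size 1. A new vertex joined to all of them
  can thus be colored with \<open>Delta + 1\<close> colors.\<close>
lemma sum_le: "(\<Sum>i\<in>I. a i) \<le> Delta + 1"
proof -
  obtain j k where jk: "j \<in> I - {m}" "k \<in> I - {m}" "j \<noteq> k" using other_two[OF m] by blast
  have "(\<Sum>i\<in>I. a i) = a m + (\<Sum>i\<in>I - {m}. a i)" using finite_I m by (simp add: sum.remove)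
  also have "a m \<le> a j * a k"
    using m_min[of j] pos[of k] jk mult_le_mono[of "a m" "a j" 1 "a k"] by (simp add: Suc_le_eq)
  also have "a j * a k + (\<Sum>i\<in>I - {m}. a i) \<le> Delta + 1"
    using one_plus_sum_plus_product_le_prod[of "I - {m}" j k a] jk finite_I unfolding Suc_Delta by simp
  finally show ?thesis by simp
qed

text \<open>The scheme of \<open>edge_coloring_G\<close> with one more color, which pays for the edges from \<open>z\<close> to all
  elements with a support of size 1. Any element outside \<open>V\<close> can serve as \<open>z\<close>; the one with
  empty support is at hand.\<close>
lemma total_coloring_G: "total_colorable G (Delta + 1)"
proof -
  let ?L = "\<Union>i\<in>I. L i" and ?C = "{..<Delta + 1}"
  obtain z where z: "z \<in> A" "supp z = {}" by (rule zero_ex)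
  have zV: "z \<notin> V" using z by (simp add: V_def)
  have zL: "z \<notin> ?L" using z by (auto simp: L_def)
  have finL: "finite ?L" using finite_I finite_LD by auto
  have LV: "?L \<subseteq> V" using L_V by blast
  have cardL: "card ?L \<le> card ?C"
  proof -
    have "card ?L \<le> (\<Sum>i\<in>I. card (L i))" using finite_I by (rule card_UN_le)
    then show ?thesis using sum_le card_L by simp
  qed
  have E1V: "\<Union>E1 \<subseteq> V" unfolding E1_def by (auto elim: edgeE)
  have d2: "edge_degree E1 v + 2 \<le> card ?C" for v using degree_E1[of v] by simp
  obtain c where c: "edge_colored (E1 \<union> star z ?L) c ?C"
    using vizing_cone[OF simple_edges_E1 _ d2 _ finL zL cardL] zV E1V by auto
  let ?E = "E1 \<union> star z ?L"
  have finE: "finite ?E" using simple_edges_E1 finL by (simp add: simple_edges_def star_def)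
  have dL: "edge_degree ?E x + card (D i) \<le> card ?C" if "i \<in> J" "x \<in> L i" for i x
  proof -
    have "{e \<in> ?E. x \<in> e} \<subseteq> insert {z, x} {e \<in> E1. x \<in> e}"
      using zL that JI[OF that(1)] by (auto simp: star_def)
    then have "edge_degree ?E x \<le> edge_degree E1 x + 1"
      using card_mono[of "insert {z, x} {e \<in> E1. x \<in> e}" "{e \<in> ?E. x \<in> e}"] finE
        card_insert_le_m1 unfolding edge_degree_def by (simp add: card_insert_if split: if_splits)
    then show ?thesis using degree_E1_core[OF that] by simp
  qed
  have DE: "D i \<inter> \<Union>?E = {}" if "i \<in> J" for i
  proof -
    have "D i \<inter> ?L = {}" using D_L[OF JI[OF that]] by blast
    moreover have "z \<notin> D i" using D_V[OF JI[OF that]] zV by blast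
    ultimately show ?thesis using D_E1[OF that] by (auto simp: star_def)
  qed
  have "\<exists>c'. edge_colored (?E \<union> (\<Union>i\<in>J. bipartite (L i) (D i))) c' ?C"
  proof (rule add_bipartites[OF _ c finE])
    show "finite J" using finite_I by (simp add: J_def)
    show "(L i \<union> D i) \<inter> (L k \<union> D k) = {}" if "i \<in> J" "k \<in> J" "i \<noteq> k" for i k
      using L_L[OF that(3)] D_D[OF JI[OF that(1)] JI[OF that(2)] that(3)]
        D_L[OF JI[OF that(1)]] D_L[OF JI[OF that(2)]] by blast
    show "L i \<inter> D i = {}" if "i \<in> J" for i using D_L[OF JI[OF that]] by blast
  qed (use finite_LD DE dL card_L_le_D in auto)
  moreover have "?E \<union> (\<Union>i\<in>J. bipartite (L i) (D i)) = edges G \<union> star z ?L"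
    using edges_G by blast
  ultimately obtain ce where ce: "edge_colored (edges G \<union> star z ?L) ce ?C" by auto
  have zstar: "{z, x} \<in> edges G \<union> star z ?L" if "x \<in> ?L" for x using that by (auto simp: star_def)
  show ?thesis
  proof (rule color_vertices_greedily[OF simple_graph_G])
    show "edge_colored (edges G) ce ?C" by (rule edge_colored_subset[OF ce]) simp
    show "?L \<subseteq> vertices G" using LV by simp
    show "ce {z, x} < Delta + 1" if "x \<in> ?L" for x
      using edge_colored_in[OF ce zstar[OF that]] by simp
    show "ce {z, x} \<noteq> ce e" if "x \<in> ?L" "e \<in> edges G" "x \<in> e" for x e
    proof (rule edge_colored_neq[OF ce zstar[OF that(1)], of _ x])
      have "z \<notin> e" using that(2) zV by (auto elim: edgeE)
      then show "{z, x} \<noteq> e" by blast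
    qed (use that in auto)
    show "ce {z, x} \<noteq> ce {z, y}" if "x \<in> ?L" "y \<in> ?L" "x \<noteq> y" for x y
      by (rule edge_colored_neq[OF ce zstar[OF that(1)] zstar[OF that(2)], of z])
        (use that(3) in \<open>auto simp: doubleton_eq_iff\<close>)
    show "2 * edge_degree (edges G) v < Delta + 1" if v: "v \<in> vertices G - ?L" for v
    proof -
      have "v \<in> V" using v by simp
      then show ?thesis
      proof (cases rule: supp_cases)
        case (2 i j)
        then show ?thesis using degree_heavy[OF \<open>v \<in> V\<close> 2] by simp
      qed (use v in auto)
    qed
  qed
qed

lemma V_nonempty: "V \<noteq> {}"
  using nonempty_supp[of "{m}"] m L_V[OF m] by (auto simp: L_def)

end

section \<open>Round-robin factors of a clique\<close>

lemma add_mod_cancel: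
  fixes b k l M :: nat
  assumes "(b + k) mod M = (b + l) mod M" "k < M" "l < M"
  shows "k = l"
proof -
  obtain q1 q2 where "b + k + M * q1 = b + l + M * q2"
    using assms(1) nat_mod_eq_iff by blast
  then have "(k + M * q1) mod M = (l + M * q2) mod M" by simp
  then show ?thesis using assms(2,3) by simp
qed

lemma double_mod_cancel:
  fixes k l M :: nat
  assumes M: "odd M" and eq: "(2 * k) mod M = (2 * l) mod M" "k < M" "l < M"
  shows "k = l"
proof -
  have le: "k = l" if "k \<le> l" "(2 * l) mod M = (2 * k) mod M" "l < M" for k l
  proof -
    have "M dvd 2 * l - 2 * k" using mod_eq_dvd_iff_nat[of "2 * k" "2 * l" M] that by simp
    then have "M dvd 2 * (l - k)" by (simp add: diff_mult_distrib2)
    moreover have "coprime M 2" using M by simp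
    ultimately have "M dvd l - k" using coprime_dvd_mult_right_iff by blast
    then show ?thesis using that(1,3) by (meson dvd_imp_le le_antisym less_imp_diff_less not_le zero_less_diff)
  qed
  show ?thesis using le[of k l] le[of l k] eq by (cases "k \<le> l") auto
qed

text \<open>The pairs of players in \<open>W\<close>, and for each player a partner \<open>p x\<close> for the round in which it is free.\<close>
definition round_robin :: "'a set \<Rightarrow> ('a \<Rightarrow> 'a) \<Rightarrow> 'a set set" where
  "round_robin W p = {{x, y} | x y. x \<in> W \<and> y \<in> W \<and> x \<noteq> y} \<union> {{x, p x} | x. x \<in> W}"

lemma round_robin_iff:
  assumes "\<And>x. x \<in> W \<Longrightarrow> p x \<notin> W" "x \<in> W"
  shows "{x, y} \<in> round_robin W p \<longleftrightarrow> y \<in> W \<and> y \<noteq> x \<or> y = p x"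
proof
  assume "{x, y} \<in> round_robin W p"
  then consider u v where "{x, y} = {u, v}" "u \<in> W" "v \<in> W" "u \<noteq> v"
    | u where "{x, y} = {u, p u}" "u \<in> W"
    unfolding round_robin_def by blast
  then show "y \<in> W \<and> y \<noteq> x \<or> y = p x"
  proof cases
    case 1 then show ?thesis by (auto simp: doubleton_eq_iff)
  next
    case 2 then show ?thesis using assms by (auto simp: doubleton_eq_iff)
  qed
qed (use assms(2) in \<open>auto simp: round_robin_def\<close>)

lemma simple_edges_round_robin:
  assumes "finite W" "\<And>x. x \<in> W \<Longrightarrow> p x \<notin> W"
  shows "simple_edges (round_robin W p)"
proof -
  have "round_robin W p \<subseteq> Pow (W \<union> p ` W)" by (auto simp: round_robin_def)
  then have "finite (round_robin W p)" using assms(1) by (meson finite_Pow_iff finite_UnI finite_imageI finite_subset)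
  moreover have "card e = 2" if "e \<in> round_robin W p" for e
  proof -
    from that consider x y where "e = {x, y}" "x \<noteq> y" | x where "e = {x, p x}" "x \<in> W"
      unfolding round_robin_def by blast
    then show ?thesis
    proof cases
      case 2
      then have "p x \<noteq> x" using assms(2)[of x] by auto
      then show ?thesis using 2 by auto
    qed simp
  qed
  ultimately show ?thesis by (simp add: simple_edges_def)
qed

lemma degree_round_robin:
  assumes "finite W" "\<And>x. x \<in> W \<Longrightarrow> p x \<notin> W" "x \<in> W"
  shows "edge_degree (round_robin W p) x = card W"
proof -
  have "{y. {x, y} \<in> round_robin W p} = insert (p x) (W - {x})"
    using round_robin_iff[of W p x] assms(2,3) by auto
  moreover have "card (insert (p x) (W - {x})) = card W"
  proof -
    have "card (insert (p x) (W - {x})) = Suc (card (W - {x}))"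
      using assms by (intro card_insert_disjoint) auto
    also have "\<dots> = card W" using assms(1,3) by (rule card_Suc_Diff1)
    finally show ?thesis .
  qed
  ultimately show ?thesis
    using edge_degree_neighbors(1)[OF simple_edges_round_robin[OF assms(1,2)]] by simp
qed

text \<open>The schedule of a tournament: for a numbering \<open>h\<close> of the players, \<open>x\<close> and \<open>y\<close> meet in round
  \<open>h x + h y\<close>; the player with \<open>2 h x\<close> equal to the number of the round is free and meets \<open>p x\<close>.\<close>
lemma round_robin_coloring:
  assumes W: "finite W" "odd (card W)" and p: "\<And>x. x \<in> W \<Longrightarrow> p x \<notin> W"
  shows "\<exists>c. edge_colored (round_robin W p) c {..<card W}"
proof -
  let ?M = "card W"
  obtain h where h: "bij_betw h W {0..<?M}" using ex_bij_betw_finite_nat[OF W(1)] by blast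
  have inj: "inj_on h W" and less: "\<And>x. x \<in> W \<Longrightarrow> h x < ?M"
    using h by (auto simp: bij_betw_def)
  have M: "0 < ?M" using W(2) by (rule odd_pos)
  define g where "g x y = (if y \<in> W then h y else h x)" for x y
  define c where "c e = (if e \<subseteq> W then sum h e else 2 * h (THE x. x \<in> e \<inter> W)) mod ?M" for e
  have c: "c {x, y} = (h x + g x y) mod ?M" if x: "x \<in> W" and xy: "{x, y} \<in> round_robin W p" for x y
  proof (cases "y \<in> W")
    case True
    then have "y \<noteq> x" using xy round_robin_iff[OF p x] p[OF x] by auto
    then show ?thesis using True x by (simp add: c_def g_def)
  next
    case False
    then have "(THE u. u \<in> {x, y} \<inter> W) = x" using x by (auto intro!: the_equality)
    then show ?thesis using False by (simp add: c_def g_def mult_2)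
  qed
  have at_W: "c {x, y} \<noteq> c {x, y'}"
    if x: "x \<in> W" and xy: "{x, y} \<in> round_robin W p" "{x, y'} \<in> round_robin W p" "y \<noteq> y'" for x y y'
  proof
    assume "c {x, y} = c {x, y'}"
    then have "g x y = g x y'"
      using c[OF x xy(1)] c[OF x xy(2)] add_mod_cancel[of "h x" "g x y" ?M "g x y'"] less x
      by (auto simp: g_def)
    moreover have "y \<in> W \<and> y \<noteq> x \<or> y = p x" "y' \<in> W \<and> y' \<noteq> x \<or> y' = p x"
      using round_robin_iff[OF p x] xy by auto
    ultimately show False
      using inj_onD[OF inj] p[OF x] x xy(3) by (auto simp: g_def split: if_splits)
  qed
  have "c e \<noteq> c f" if e: "e \<in> round_robin W p" and f: "f \<in> round_robin W p" and ef: "e \<noteq> f"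
    and v: "v \<in> e" "v \<in> f" for e f v
  proof (cases "v \<in> W")
    case True
    obtain y where y: "e = {v, y}" using e v(1) by (auto simp: round_robin_def)
    obtain y' where y': "f = {v, y'}" using f v(2) by (auto simp: round_robin_def)
    show ?thesis using at_W[OF True] e f ef unfolding y y' by auto
  next
    case False
    obtain x where x: "x \<in> W" "e = {x, v}" using e v(1) False by (auto simp: round_robin_def)
    obtain y where y: "y \<in> W" "f = {y, v}" using f v(2) False by (auto simp: round_robin_def)
    have "c e = (2 * h x) mod ?M" "c f = (2 * h y) mod ?M"
      using c[OF x(1), of v] c[OF y(1), of v] e f x y False by (auto simp: g_def mult_2)
    moreover have "h x \<noteq> h y" using inj_onD[OF inj _ x(1) y(1)] x y ef by auto
    ultimately show ?thesis
      using double_mod_cancel[OF W(2) _ less[OF x(1)] less[OF y(1)]] by metis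
  qed
  moreover have "c e < ?M" for e using M by (simp add: c_def)
  ultimately have "edge_colored (round_robin W p) c {..<?M}"
    unfolding edge_colored_def by blast
  then show ?thesis by blast
qed

text \<open>The color classes are matchings, and all of them cover all of \<open>W\<close>. For odd \<open>card W\<close> the free player
  meets its partner outside of \<open>W\<close>; for even \<open>card W\<close> one element of \<open>W\<close> is the partner of all others.\<close>
lemma clique_factors:
  assumes W: "finite W" "W \<noteq> {}" and clique: "\<And>x y. x \<in> W \<Longrightarrow> y \<in> W \<Longrightarrow> x \<noteq> y \<Longrightarrow> {x, y} \<in> E"
    and q: "\<And>x. x \<in> W \<Longrightarrow> q x \<in> P \<and> {x, q x} \<in> E" and P: "P \<inter> W = {}"
  obtains B c M where "B \<subseteq> E" "simple_edges B" "edge_colored B c {..<M}" "card W \<le> M + 1"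
    "\<And>x. x \<in> W \<Longrightarrow> edge_degree B x = M" "\<And>e. e \<in> B \<Longrightarrow> e \<subseteq> W \<union> P"
proof (cases "odd (card W)")
  case True
  have qW: "q x \<notin> W" if "x \<in> W" for x using q[OF that] P by blast
  obtain c where c: "edge_colored (round_robin W q) c {..<card W}"
    using round_robin_coloring[of W q] W(1) True qW by blast
  show ?thesis
  proof (rule that[OF _ simple_edges_round_robin[OF W(1) qW] c])
    show "round_robin W q \<subseteq> E" using clique q by (auto simp: round_robin_def)
    show "edge_degree (round_robin W q) x = card W" if "x \<in> W" for x
      by (rule degree_round_robin[OF W(1) qW that])
    show "e \<subseteq> W \<union> P" if "e \<in> round_robin W q" for e using that q by (auto simp: round_robin_def)
  qed auto
next
  case False
  obtain u where u: "u \<in> W" using W(2) by blast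
  let ?W = "W - {u}" and ?p = "\<lambda>_. u"
  have cW: "card W = card ?W + 1" using card_Suc_Diff1[OF W(1) u] by simp
  then have odd: "odd (card ?W)" using False by simp
  have fW: "finite ?W" and pW: "\<And>x. x \<in> ?W \<Longrightarrow> ?p x \<notin> ?W" using W(1) by auto
  obtain c where c: "edge_colored (round_robin ?W ?p) c {..<card ?W}"
    using round_robin_coloring[of ?W ?p] fW odd pW by blast
  note se = simple_edges_round_robin[OF fW pW]
  show ?thesis
  proof (rule that[OF _ se c])
    show "round_robin ?W ?p \<subseteq> E" using clique u by (auto simp: round_robin_def)
    show "edge_degree (round_robin ?W ?p) x = card ?W" if "x \<in> W" for x
    proof (cases "x = u")
      case True
      have "{y. {u, y} \<in> round_robin ?W ?p} = ?W"
        by (auto simp: round_robin_def doubleton_eq_iff)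
      then show ?thesis using edge_degree_neighbors(1)[OF se] True by simp
    next
      case False
      then show ?thesis using that by (intro degree_round_robin[OF fW pW]) auto
    qed
    show "e \<subseteq> W \<union> P" if "e \<in> round_robin ?W ?p" for e using that u by (auto simp: round_robin_def)
  qed (use cW in auto)
qed

section \<open>Three or more coordinates: the complement graph\<close>

lemma edge_degree_Diff:
  assumes "finite E" "F \<subseteq> E"
  shows "edge_degree (E - F) v + edge_degree F v = edge_degree E v"
proof -
  have "{e \<in> E - F. v \<in> e} = {e \<in> E. v \<in> e} - {e \<in> F. v \<in> e}" by auto
  moreover have sub: "{e \<in> F. v \<in> e} \<subseteq> {e \<in> E. v \<in> e}" using assms(2) by auto
  moreover have "card {e \<in> F. v \<in> e} \<le> card {e \<in> E. v \<in> e}" using sub assms(1) by (intro card_mono) auto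
  moreover have "finite {e \<in> F. v \<in> e}" using finite_subset[OF assms(2,1)] by simp
  ultimately show ?thesis unfolding edge_degree_def by (simp add: card_Diff_subset)
qed

lemma complement_edge_iff:
  assumes "simple_graph G"
  shows "{x, y} \<in> edges (complement_graph G) \<longleftrightarrow>
    x \<in> vertices G \<and> y \<in> vertices G \<and> x \<noteq> y \<and> {x, y} \<notin> edges G"
proof -
  have "{x} \<notin> edges G" for x using assms by (auto simp: simple_graph_def simple_edges_def)
  then show ?thesis by (auto simp: complement_graph_def doubleton_eq_iff insert_commute)
qed

lemma vertices_complement [simp]: "vertices (complement_graph G) = vertices G"
  by (simp add: complement_graph_def)

lemma simple_graph_complement:
  assumes "simple_graph G" shows "simple_graph (complement_graph G)"
proof -
  let ?E = "edges (complement_graph G)"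
  have "?E \<subseteq> Pow (vertices G)" by (auto simp: complement_graph_def)
  moreover have "finite (vertices G)" using assms by (simp add: simple_graph_def)
  ultimately have "finite ?E" by (meson finite_Pow_iff finite_subset)
  moreover have "card e = 2" if "e \<in> ?E" for e using that by (auto simp: complement_graph_def)
  ultimately show ?thesis
    using assms \<open>?E \<subseteq> Pow (vertices G)\<close> by (auto simp: simple_graph_def simple_edges_def)
qed

lemma degree_complement:
  assumes G: "simple_graph G" and v: "v \<in> vertices G"
  shows "edge_degree (edges (complement_graph G)) v + (edge_degree (edges G) v + 1) = card (vertices G)"
proof -
  let ?N = "{y. {v, y} \<in> edges G}"
  have sub: "insert v ?N \<subseteq> vertices G" using G v by (auto simp: simple_graph_def)
  have fin: "finite (vertices G)" using G by (simp add: simple_graph_def)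
  have se: "simple_edges (edges G)" "simple_edges (edges (complement_graph G))"
    using G simple_graph_complement[OF G] by (auto simp: simple_graph_def)
  have vN: "v \<notin> ?N" using se(1) by (auto simp: simple_edges_def)
  have "{y. {v, y} \<in> edges (complement_graph G)} = vertices G - insert v ?N"
    using complement_edge_iff[OF G] v by auto
  then have "edge_degree (edges (complement_graph G)) v = card (vertices G) - card (insert v ?N)"
    using edge_degree_neighbors(1)[OF se(2), of v] card_Diff_subset[OF finite_subset[OF sub fin] sub] by simp
  moreover have "card (insert v ?N) = edge_degree (edges G) v + 1"
    using edge_degree_neighbors[OF se(1), of v] vN by simp
  moreover have "card (insert v ?N) \<le> card (vertices G)" using sub fin by (rule card_mono[rotated])
  ultimately show ?thesis by linarith
qed

context support_graph_3
begin

abbreviation Gc :: "'a graph" where "Gc \<equiv> complement_graph G"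

text \<open>All vertices of maximum degree in the complement vanish at one coordinate only.\<close>
definition W :: "'a set" where "W = (\<Union>i\<in>I. D i)"

lemma complement_iff:
  "{x, y} \<in> edges Gc \<longleftrightarrow> x \<in> V \<and> y \<in> V \<and> x \<noteq> y \<and> supp x \<inter> supp y \<noteq> {}"
  using complement_edge_iff[OF simple_graph_G] by (auto simp: edge_iff)

lemma W_V: "W \<subseteq> V"
  using D_V by (auto simp: W_def)

lemma W_clique:
  assumes "x \<in> W" "y \<in> W" "x \<noteq> y"
  shows "{x, y} \<in> edges Gc"
proof -
  obtain i k where ik: "i \<in> I" "k \<in> I" "supp x = I - {i}" "supp y = I - {k}"
    using assms by (auto simp: W_def D_def)
  obtain j l where jl: "j \<in> I - {i}" "l \<in> I - {i}" "j \<noteq> l" by (rule other_two[OF ik(1)])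
  then have "j \<in> supp x \<inter> supp y \<or> l \<in> supp x \<inter> supp y" using ik by auto
  then have "supp x \<inter> supp y \<noteq> {}" by blast
  then show ?thesis using assms W_V complement_iff by blast
qed

lemma degree_W:
  assumes "i \<in> I" "x \<in> D i"
  shows "edge_degree (edges Gc) x + (a i + 1) = card V"
proof -
  have "x \<in> V" "I - supp x = {i}" using assms D_V by (auto simp: D_def)
  then show ?thesis
    using degree_G[of x] degree_complement[OF simple_graph_G, of x] by simp
qed

text \<open>With \<open>b = a m\<close>, the maximum degree of the complement is \<open>card V - 1 - b\<close>, so \<open>card V + 1 - b\<close> colors are
  available. Joining a new vertex to all of \<open>V\<close> except \<open>b - 1\<close> disjoint pairs needs \<open>b - 1\<close> colors fewer,
  and so do the degrees after the removal of \<open>b - 1\<close> matchings that cover all vertices of large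
  degree and avoid the pairs. Each pair is colored like one of these matchings.\<close>
lemma total_coloring_complement: "total_colorable Gc (card V + 1 - a m)"
proof -
  define b where "b = a m"
  define j where "j = b - 1"
  have b: "1 \<le> b" using pos[OF m] by (simp add: b_def Suc_le_eq)
  obtain i1 i2 where i12: "i1 \<in> I - {m}" "i2 \<in> I - {m}" "i1 \<noteq> i2" by (rule other_two[OF m])
  have jL: "j < card (L i)" if "i \<in> I" for i
    using card_L[OF that] m_min[OF that] b by (simp add: j_def b_def)
  obtain A1 where A1: "A1 \<subseteq> L i1" "card A1 = j"
    using obtain_subset_with_card_n[of j "L i1"] jL[of i1] i12 by auto
  obtain A2 where A2: "A2 \<subseteq> L i2" "card A2 = j"
    using obtain_subset_with_card_n[of j "L i2"] jL[of i2] i12 by auto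
  have fA: "finite A1" "finite A2" using A1 A2 finite_LD finite_subset by blast+
  \<comment> \<open>As \<open>L i1\<close> and \<open>L i2\<close> have at least \<open>b = j + 1\<close> elements, each has one to spare as a partner.\<close>
  obtain u1 where u1: "u1 \<in> L i1" "u1 \<notin> A1"
    using jL[of i1] i12 A1 card_mono[OF fA(1), of "L i1"] by (metis DiffD1 leD subsetI)
  obtain u2 where u2: "u2 \<in> L i2" "u2 \<notin> A2"
    using jL[of i2] i12 A2 card_mono[OF fA(2), of "L i2"] by (metis DiffD1 leD subsetI)
  have LV: "L i1 \<subseteq> V" "L i2 \<subseteq> V" using L_V i12 by auto
  have LL: "L i1 \<inter> L i2 = {}" using L_L[OF i12(3)] .
  have WL: "W \<inter> L k = {}" for k using D_L by (auto simp: W_def)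
  obtain d where d: "d \<in> D m" using card_D_pos[OF m] by (metis card.empty ex_in_conv less_irrefl)
  have dW: "D m \<subseteq> W" using m by (auto simp: W_def)
  have finW: "finite W" using W_V finite_V finite_subset by blast

  \<comment> \<open>The support of an element of \<open>W\<close> lacks one coordinate only, so it contains \<open>i1\<close> or \<open>i2\<close>.\<close>
  have q: "\<exists>u\<in>{u1, u2}. {x, u} \<in> edges Gc" if x: "x \<in> W" for x
  proof -
    obtain i where i: "supp x = I - {i}" using x by (auto simp: W_def D_def)
    have "i1 \<in> supp x \<or> i2 \<in> supp x" using i i12 by auto
    moreover have "x \<noteq> u1" "x \<noteq> u2" using WL x u1 u2 by auto
    moreover have "supp u1 = {i1}" "supp u2 = {i2}" using u1 u2 by (auto simp: L_def)
    ultimately show ?thesis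
      using x W_V u1(1) u2(1) LV complement_iff[of x u1] complement_iff[of x u2] by auto
  qed
  then obtain q where q: "\<And>x. x \<in> W \<Longrightarrow> q x \<in> {u1, u2} \<and> {x, q x} \<in> edges Gc" by metis
  have PW: "{u1, u2} \<inter> W = {}" using WL u1 u2 by auto
  have W0: "W \<noteq> {}" using d dW by auto
  obtain B c M where B: "B \<subseteq> edges Gc" "simple_edges B" "edge_colored B c {..<M}" "card W \<le> M + 1"
    and degB: "\<And>x. x \<in> W \<Longrightarrow> edge_degree B x = M" and BWP: "\<And>e. e \<in> B \<Longrightarrow> e \<subseteq> W \<union> {u1, u2}"
    by (rule clique_factors[OF finW W0 W_clique q PW]) (assumption | blast)+
  have "card (L m) \<le> card (D m)" using card_L_le_D[of m] m card_L[OF m] pos[OF m] by (simp add: J_def)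
  then have jM: "j \<le> M" using B(4) card_mono[OF finW dW] card_L[OF m] by (simp add: j_def b_def)

  \<comment> \<open>The first \<open>j\<close> matchings; \<open>E'\<close> is left for the other colors.\<close>
  define F where "F = {e \<in> B. c e < j}"
  define E' where "E' = edges Gc - F"
  have seG: "simple_edges (edges Gc)"
    using simple_graph_complement[OF simple_graph_G] by (simp add: simple_graph_def)
  have finG: "finite (edges Gc)" using seG by (simp add: simple_edges_def)
  have FE: "F \<subseteq> edges Gc" using B(1) by (auto simp: F_def)
  have finF: "finite F" using FE finG finite_subset by blast
  have degF: "edge_degree F x = j" if x: "x \<in> W" for x
  proof -
    have "missing B c {..<M} x = {}"
    proof -
      have "card (missing B c {..<M} x) = 0"
        using card_missing[OF _ _ B(3), of x] B(2) degB[OF x] by (simp add: simple_edges_def)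
      moreover have "finite (missing B c {..<M} x)" by (rule finite_subset[OF missing_subset]) simp
      ultimately show ?thesis by simp
    qed
    then have seen: "\<exists>e\<in>B. x \<in> e \<and> c e = i" if "i < M" for i
      using that by (auto simp: missing_def)
    have "i \<notin> missing F c {..<j} x" for i
    proof (cases "i < j")
      case True
      then obtain e where "e \<in> B" "x \<in> e" "c e = i" using seen[of i] jM by auto
      then have "e \<in> F" "x \<in> e" "c e = i" using True by (auto simp: F_def)
      then show ?thesis unfolding missing_def by blast
    qed (simp add: missing_def)
    then have "missing F c {..<j} x = {}" by blast
    moreover have "edge_colored F c {..<j}" using B(3) unfolding edge_colored_def F_def by blast
    ultimately show ?thesis using card_missing[OF finF, of "{..<j}" c x] by simp
  qed
  have degE: "edge_degree E' v + edge_degree F v = edge_degree (edges Gc) v" for v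
    unfolding E'_def by (rule edge_degree_Diff[OF finG FE])
  have VD: "edge_degree (edges Gc) d + (b + 1) = card V" using degree_W[OF m d] by (simp add: b_def)
  have degle: "edge_degree E' v + 2 * b \<le> card V" if v: "v \<in> V" for v
  proof (cases "v \<in> W")
    case True
    then obtain i where i: "i \<in> I" "v \<in> D i" by (auto simp: W_def)
    show ?thesis using degree_W[OF i] degE[of v] degF[OF True] m_min[OF i(1)] b by (simp add: j_def b_def)
  next
    case False
    have sub: "supp v \<subseteq> I" "supp v \<noteq> I" using v supp_subset by (auto simp: V_def)
    then obtain i where i: "i \<in> I" "i \<notin> supp v" by blast
    have "supp v \<noteq> I - {i}" using False v i(1) by (auto simp: W_def D_def V_def)
    then obtain k where k: "k \<in> I" "k \<notin> supp v" "k \<noteq> i" using sub(1) i by blast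
    have "1 + 2 * b \<le> (1 + b) * (1 + b)" by simp
    also have "\<dots> \<le> (1 + a i) * (1 + a k)" using m_min i k by (intro mult_mono) (auto simp: b_def)
    also have "\<dots> \<le> (\<Prod>i\<in>I - supp v. 1 + a i)"
      using i k finite_I by (intro prod_ge_two_factors) auto
    also have "\<dots> = edge_degree (edges G) v + 1" using degree_G[OF v] by simp
    finally show ?thesis
      using degree_complement[OF simple_graph_G, of v] v degE[of v] by simp
  qed
  have bV: "2 * b \<le> card V" using degle[of d] D_V[OF m] d by auto
  have degE2: "edge_degree E' v + 2 * b \<le> card V" for v
  proof (cases "v \<in> V")
    case False
    then have "{e \<in> E'. v \<in> e} = {}" by (auto simp: E'_def complement_graph_def)
    then have "edge_degree E' v = 0" by (simp only: edge_degree_def card.empty)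
    then show ?thesis using bV by simp
  qed (rule degle)

  let ?K = "card V + 1 - a m"
  let ?N = "V - (A1 \<union> A2)"
  have K: "?K - j = card V + 2 - 2 * b" "j \<le> ?K" using b bV by (auto simp: j_def b_def)
  have cC: "card {j..<?K} = card V + 2 - 2 * b" using K by simp
  have AV: "A1 \<union> A2 \<subseteq> V" using A1 A2 LV by blast
  have "card (A1 \<union> A2) = 2 * j" using A1 A2 fA LL by (subst card_Un_disjoint) auto
  then have cN: "card ?N \<le> card {j..<?K}"
    unfolding cC using AV fA b by (simp add: card_Diff_subset j_def)
  obtain z where z: "z \<in> A" "supp z = {}" by (rule zero_ex)
  have zV: "z \<notin> V" using z by (simp add: V_def)
  have zE: "z \<notin> \<Union>E'" using zV by (auto simp: E'_def complement_graph_def)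
  have sE: "simple_edges E'" by (rule simple_edges_subset[OF seG]) (auto simp: E'_def)
  have degC: "edge_degree E' v + 2 \<le> card {j..<?K}" for v unfolding cC using degE2[of v] by simp
  have finN: "finite ?N" using finite_V by simp
  have "\<exists>c2. edge_colored (E' \<union> star z ?N) c2 {j..<?K}"
    by (rule vizing_cone[OF sE _ degC zE finN _ cN]) (use zV in auto)
  then obtain c2 where c2: "edge_colored (E' \<union> star z ?N) c2 {j..<?K}" by blast
  obtain h1 where h1: "bij_betw h1 A1 {0..<j}" using ex_bij_betw_finite_nat[OF fA(1)] A1(2) by auto
  obtain h2 where h2: "bij_betw h2 A2 {0..<j}" using ex_bij_betw_finite_nat[OF fA(2)] A2(2) by auto
  \<comment> \<open>The bijections \<open>h1\<close> and \<open>h2\<close> pair an element of \<open>A1\<close> with one of \<open>A2\<close>; their supports are disjoint.\<close>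
  define cv where "cv v = (if v \<in> A1 then h1 v else if v \<in> A2 then h2 v else c2 {z, v})" for v
  define ce where "ce e = (if e \<in> F then c e else c2 e)" for e
  have cvA: "cv v < j" if "v \<in> A1 \<union> A2" for v
    using that bij_betwE[OF h1] bij_betwE[OF h2] by (auto simp: cv_def)
  have zN: "{z, v} \<in> E' \<union> star z ?N" if "v \<in> ?N" for v using that by (auto simp: star_def)
  have cvN: "cv v = c2 {z, v}" "j \<le> cv v" "cv v < ?K" if "v \<in> ?N" for v
    using that edge_colored_in[OF c2 zN[OF that]] by (auto simp: cv_def)
  have ceF: "ce e = c e" "ce e < j" if "e \<in> F" for e
    using that by (auto simp: ce_def F_def)
  have ceE: "ce e = c2 e" "j \<le> ce e" "ce e < ?K" if "e \<in> E'" for e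
  proof -
    have "c2 e \<in> {j..<?K}" using edge_colored_in[OF c2] that by blast
    moreover show "ce e = c2 e" using that by (simp add: ce_def E'_def)
    ultimately show "j \<le> ce e" "ce e < ?K" by auto
  qed
  have A_F: "v \<notin> e" if "v \<in> A1 \<union> A2" "e \<in> F" for v e
  proof -
    have "v \<notin> W" "v \<noteq> u1" "v \<noteq> u2" using that(1) WL A1(1) A2(1) u1 u2 LL by auto
    then show ?thesis using BWP[of e] that(2) by (auto simp: F_def)
  qed
  have EF: "e \<in> E' \<or> e \<in> F" if "e \<in> edges Gc" for e using that by (simp add: E'_def)
  have "proper_vertex_coloring Gc cv"
    unfolding proper_vertex_coloring_def
  proof (intro allI impI, elim conjE)
    fix x y assume xy: "{x, y} \<in> edges Gc" "x \<noteq> y"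
    then have V: "x \<in> V" "y \<in> V" "supp x \<inter> supp y \<noteq> {}" using complement_iff by auto
    have A12: "\<not> (u \<in> A1 \<and> v \<in> A2)" if "supp u \<inter> supp v \<noteq> {}" for u v
    proof
      assume "u \<in> A1 \<and> v \<in> A2"
      then have "supp u = {i1}" "supp v = {i2}" using A1(1) A2(1) by (auto simp: L_def)
      then show False using that i12(3) by simp
    qed
    consider "x \<in> ?N" "y \<in> ?N" | "x \<in> ?N" "y \<in> A1 \<union> A2" | "x \<in> A1 \<union> A2" "y \<in> ?N"
      | "x \<in> A1" "y \<in> A1" | "x \<in> A2" "y \<in> A2"
      using V A12[of x y] A12[of y x] by blast
    then show "cv x \<noteq> cv y"
    proof cases
      case 1
      have "{z, x} \<noteq> {z, y}" using xy(2) by (auto simp: doubleton_eq_iff)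
      then have "c2 {z, x} \<noteq> c2 {z, y}" by (rule edge_colored_neq[OF c2 zN[OF 1(1)] zN[OF 1(2)], of z]) auto
      then show ?thesis using cvN 1 by simp
    next
      case 2 then show ?thesis using cvN(2)[of x] cvA[of y] by simp
    next
      case 3 then show ?thesis using cvN(2)[of y] cvA[of x] by simp
    next
      case 4 then show ?thesis using bij_betw_imp_inj_on[OF h1] xy(2) by (auto simp: cv_def inj_on_def)
    next
      case 5
      then have "x \<notin> A1" "y \<notin> A1" using A1(1) A2(1) LL by auto
      then show ?thesis using 5 bij_betw_imp_inj_on[OF h2] xy(2) by (auto simp: cv_def inj_on_def)
    qed
  qed
  moreover have "proper_edge_coloring Gc ce"
    unfolding proper_edge_coloring_def
  proof (intro ballI impI, elim conjE)
    fix e f assume ef: "e \<in> edges Gc" "f \<in> edges Gc" "e \<noteq> f" "e \<inter> f \<noteq> {}"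
    then obtain v where v: "v \<in> e" "v \<in> f" by blast
    consider "e \<in> E'" "f \<in> E'" | "e \<in> E'" "f \<in> F" | "e \<in> F" "f \<in> E'" | "e \<in> F" "f \<in> F"
      using EF[OF ef(1)] EF[OF ef(2)] by argo
    then show "ce e \<noteq> ce f"
    proof cases
      case 1
      then show ?thesis using edge_colored_neq[OF c2 UnI1 UnI1 ef(3) v] ceE(1) by simp
    next
      case 2 then show ?thesis using ceE(2)[of e] ceF(2)[of f] by simp
    next
      case 3 then show ?thesis using ceE(2)[of f] ceF(2)[of e] by simp
    next
      case 4
      then show ?thesis using edge_colored_neq[OF B(3) _ _ ef(3) v] ceF(1) by (simp add: F_def)
    qed
  qed
  moreover have "cv v \<noteq> ce e" if v: "v \<in> V" and e: "e \<in> edges Gc" "v \<in> e" for v e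
  proof (cases "v \<in> ?N")
    case True
    from EF[OF e(1)] show ?thesis
    proof
      assume eE: "e \<in> E'"
      have "z \<notin> e" using eE zE by blast
      then have "{z, v} \<noteq> e" by blast
      then have "c2 {z, v} \<noteq> c2 e" by (rule edge_colored_neq[OF c2 zN[OF True] UnI1[OF eE], of v]) (use e in auto)
      then show ?thesis using cvN(1)[OF True] ceE(1)[OF eE] by simp
    next
      assume "e \<in> F" then show ?thesis using cvN(2)[OF True] ceF(2) by fastforce
    qed
  next
    case False
    then have vA: "v \<in> A1 \<union> A2" using v by blast
    then have "e \<notin> F" using A_F e(2) by blast
    then have "e \<in> E'" using EF[OF e(1)] by blast
    then show ?thesis using cvA[OF vA] ceE(2) by fastforce
  qed
  moreover have "cv v < ?K" if "v \<in> V" for v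
  proof (cases "v \<in> ?N")
    case False
    then have "v \<in> A1 \<union> A2" using that by blast
    then show ?thesis using cvA K(2) by (meson less_le_trans)
  qed (rule cvN(3))
  moreover have "ce e < ?K" if "e \<in> edges Gc" for e
    using EF[OF that] ceE(3)[of e] ceF(2)[of e] K(2) by linarith
  ultimately show ?thesis
    unfolding total_colorable_def proper_total_coloring_def
    by (intro exI[of _ cv] exI[of _ ce]) auto
qed

lemma TCC_complement: "satisfies_TCC Gc"
proof (rule satisfies_TCC_I[OF simple_graph_complement[OF simple_graph_G] total_coloring_complement])
  obtain d where d: "d \<in> D m" using card_D_pos[OF m] by (metis card.empty ex_in_conv less_irrefl)
  have "edge_degree (edges Gc) d + (a m + 1) = card V" by (rule degree_W[OF m d])
  moreover have "edge_degree (edges Gc) d \<le> max_degree Gc"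
    using vertex_degree_le_max_degree[of Gc d] d D_V[OF m] finite_V by (auto simp: vertex_degree_eq)
  ultimately show "card V + 1 - a m \<le> max_degree Gc + 2" by simp
qed

end

section \<open>Complete bipartite graphs and pairs of cliques\<close>

locale complete_bipartite =
  fixes H :: "'a graph" and U W :: "'a set"
  assumes H: "vertices H = U \<union> W" "edges H = bipartite U W"
    and fin: "finite U" "finite W" and disj: "U \<inter> W = {}" and ne: "U \<noteq> {}"
    and le: "card U \<le> card W"
begin

lemma W_ne: "W \<noteq> {}"
  using le ne fin by auto

lemma edge_iff: "{x, y} \<in> edges H \<longleftrightarrow> x \<in> U \<and> y \<in> W \<or> x \<in> W \<and> y \<in> U"
  unfolding H bipartite_def by (auto simp: doubleton_eq_iff)

lemma edgeE:
  assumes "e \<in> edges H" obtains x y where "e = {x, y}" "x \<in> U" "y \<in> W" "x \<noteq> y"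
  using assms disj unfolding H bipartite_def by blast

lemma simple_graph_H: "simple_graph H"
proof -
  have "card e = 2" if "e \<in> edges H" for e using that by (auto elim: edgeE)
  moreover have "\<Union>(edges H) \<subseteq> U \<union> W" by (auto elim: edgeE)
  ultimately show ?thesis
    using fin by (simp add: simple_graph_def simple_edges_def H finite_bipartite)
qed

lemma simple_edges_H: "simple_edges (edges H)"
  using simple_graph_H by (simp add: simple_graph_def)

lemma degree_U:
  assumes "x \<in> U" shows "edge_degree (edges H) x = card W"
proof -
  have "{y. {x, y} \<in> edges H} = W" using assms disj unfolding edge_iff by auto
  then show ?thesis using edge_degree_neighbors(1)[OF simple_edges_H, of x] by simp
qed

lemma degree_W:
  assumes "x \<in> W" shows "edge_degree (edges H) x = card U"
proof -
  have "{y. {x, y} \<in> edges H} = U" using assms disj unfolding edge_iff by auto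
  then show ?thesis using edge_degree_neighbors(1)[OF simple_edges_H, of x] by simp
qed

lemma max_degree_H: "max_degree H = card W"
proof -
  obtain x where "x \<in> U" using ne by blast
  then show ?thesis
    by (intro max_degree_eqI[of H x]) (use fin le in \<open>auto simp: H(1) vertex_degree_eq degree_U degree_W\<close>)
qed

lemma numbering:
  obtains h :: "'a \<Rightarrow> nat" where "inj_on h U" "inj_on h W"
    "\<And>x. x \<in> U \<Longrightarrow> h x < card U" "\<And>x. x \<in> W \<Longrightarrow> h x < card W"
proof -
  obtain f where f: "bij_betw f U {0..<card U}" using ex_bij_betw_finite_nat[OF fin(1)] by blast
  obtain g where g: "bij_betw g W {0..<card W}" using ex_bij_betw_finite_nat[OF fin(2)] by blast
  define h where "h x = (if x \<in> U then f x else g x)" for x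
  have hU: "h x = f x" if "x \<in> U" for x using that by (simp add: h_def)
  have hW: "h x = g x" if "x \<in> W" for x using that disj by (auto simp: h_def)
  show ?thesis
  proof (rule that)
    show "inj_on h U" using bij_betw_imp_inj_on[OF f] hU by (simp cong: inj_on_cong)
    show "inj_on h W" using bij_betw_imp_inj_on[OF g] hW by (simp cong: inj_on_cong)
    show "h x < card U" if "x \<in> U" for x using bij_betwE[OF f] hU that by simp
    show "h x < card W" if "x \<in> W" for x using bij_betwE[OF g] hW that by simp
  qed
qed

text \<open>The edge \<open>{x, y}\<close> gets the color \<open>h x + h y\<close> modulo the size of the larger side.\<close>
lemma cyclic_coloring:
  obtains h :: "'a \<Rightarrow> nat" and ce where "inj_on h U" "inj_on h W"
    "\<And>x. x \<in> U \<Longrightarrow> h x < card U" "\<And>x. x \<in> W \<Longrightarrow> h x < card W"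
    "\<And>x y. x \<in> U \<Longrightarrow> y \<in> W \<Longrightarrow> ce {x, y} = (h x + h y) mod card W"
    "edge_colored (edges H) ce {..<card W}"
proof -
  obtain h where h: "inj_on h U" "inj_on h W" and hU: "\<And>x. x \<in> U \<Longrightarrow> h x < card U"
    and hW: "\<And>x. x \<in> W \<Longrightarrow> h x < card W" by (rule numbering) blast
  define ce where "ce e = sum h e mod card W" for e
  have ce: "ce {x, y} = (h x + h y) mod card W" if "x \<in> U" "y \<in> W" for x y
    using that disj by (subst ce_def, subst sum.insert) auto
  have pos: "0 < card W" using W_ne fin by (simp add: card_gt_0_iff)
  have "ce e \<noteq> ce f" if ef: "e \<in> edges H" "f \<in> edges H" "e \<noteq> f" "e \<inter> f \<noteq> {}" for e f
  proof -
    obtain x y where e: "e = {x, y}" "x \<in> U" "y \<in> W" using ef(1) by (rule edgeE)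
    obtain x' y' where f: "f = {x', y'}" "x' \<in> U" "y' \<in> W" using ef(2) by (rule edgeE)
    from ef e f disj consider "x = x'" "y \<noteq> y'" | "x \<noteq> x'" "y = y'" by blast
    then show ?thesis
    proof cases
      case 1
      then have "h y \<noteq> h y'" using inj_onD[OF h(2)] e f by blast
      then show ?thesis
        using add_mod_cancel[OF _ hW[OF e(3)] hW[OF f(3)], of "h x"] ce[OF e(2,3)] ce[OF f(2,3)] 1 e(1) f(1)
        by metis
    next
      case 2
      then have "h x \<noteq> h x'" using inj_onD[OF h(1)] e f by blast
      moreover have "h x < card W" "h x' < card W" using hU[OF e(2)] hU[OF f(2)] le by auto
      ultimately show ?thesis
        using add_mod_cancel[of "h y" "h x" "card W" "h x'"] ce[OF e(2,3)] ce[OF f(2,3)] 2 e(1) f(1)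
        by (metis add.commute)
    qed
  qed
  moreover have "ce e < card W" for e using pos by (simp add: ce_def)
  ultimately have "edge_colored (edges H) ce {..<card W}" unfolding edge_colored_def by blast
  then show ?thesis using that h hU hW ce by blast
qed

lemma edge_chromatic_number_H: "edge_chromatic_number H = max_degree H"
proof -
  obtain h ce where "edge_colored (edges H) ce {..<card W}" by (rule cyclic_coloring)
  then show ?thesis
    using edge_chromatic_number_eq_max_degree[OF simple_graph_H] by (simp add: max_degree_H)
qed

lemma total_colorableI:
  assumes ce: "edge_colored (edges H) ce {..<k}"
    and in_k: "\<And>x. x \<in> U \<union> W \<Longrightarrow> cv x < k"
    and cross: "\<And>x y. x \<in> U \<Longrightarrow> y \<in> W \<Longrightarrow> cv x \<noteq> cv y \<and> cv x \<noteq> ce {x, y} \<and> cv y \<noteq> ce {x, y}"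
  shows "total_colorable H k"
proof -
  have "proper_vertex_coloring H cv"
    unfolding proper_vertex_coloring_def edge_iff using cross by metis
  moreover have "proper_edge_coloring H ce" "ce ` edges H \<subseteq> {..<k}"
    using ce by (simp_all add: edge_colored_iff)
  moreover have "\<forall>v\<in>vertices H. \<forall>e\<in>edges H. v \<in> e \<longrightarrow> cv v \<noteq> ce e"
    using cross by (auto elim!: edgeE)
  ultimately show ?thesis
    using in_k unfolding total_colorable_def proper_total_coloring_def H(1) by blast
qed

text \<open>One new color for each side.\<close>
lemma total_colorable_plus_2: "total_colorable H (card W + 2)"
proof -
  obtain h ce where ce: "edge_colored (edges H) ce {..<card W}" by (rule cyclic_coloring)
  have less: "ce {x, y} < card W" if "x \<in> U" "y \<in> W" for x y
    using edge_colored_in[OF ce, of "{x, y}"] that edge_iff by auto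
  show ?thesis
  proof (rule total_colorableI[where ce = ce and cv = "\<lambda>x. if x \<in> U then card W else card W + 1"])
    show "edge_colored (edges H) ce {..<card W + 2}"
      using ce unfolding edge_colored_def by auto
    fix x y assume xy: "x \<in> U" "y \<in> W"
    then have "y \<notin> U" using disj by blast
    then show "(if x \<in> U then card W else card W + 1) \<noteq> (if y \<in> U then card W else card W + 1) \<and>
        (if x \<in> U then card W else card W + 1) \<noteq> ce {x, y} \<and>
        (if y \<in> U then card W else card W + 1) \<noteq> ce {x, y}"
      using less[OF xy] xy by simp
  qed auto
qed

text \<open>Modulo \<open>card W\<close>, the edges at \<open>y\<close> use the colors \<open>h y + i\<close> for \<open>i < card U\<close>, so \<open>h y + card U\<close> is free at \<open>y\<close>.\<close>
lemma total_colorable_plus_1: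
  assumes less: "card U < card W"
  shows "total_colorable H (card W + 1)"
proof -
  obtain h ce where h: "\<And>x. x \<in> U \<Longrightarrow> h x < card U"
    and ce_eq: "\<And>x y. x \<in> U \<Longrightarrow> y \<in> W \<Longrightarrow> ce {x, y} = (h x + h y) mod card W"
    and ce: "edge_colored (edges H) ce {..<card W}" by (rule cyclic_coloring) blast
  define cv where "cv x = (if x \<in> U then card W else (h x + card U) mod card W)" for x
  have pos: "0 < card W" using less by simp
  have cvW: "cv y = (h y + card U) mod card W" if "y \<in> W" for y using that disj by (auto simp: cv_def)
  show ?thesis
  proof (rule total_colorableI[where ce = ce and cv = cv])
    show "edge_colored (edges H) ce {..<card W + 1}"
      using ce unfolding edge_colored_def by auto
    show "cv x < card W + 1" for x using pos by (simp add: cv_def less_SucI)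
    fix x y assume xy: "x \<in> U" "y \<in> W"
    have "cv x = card W" using xy by (simp add: cv_def)
    moreover have "cv y < card W" using cvW[OF xy(2)] pos by simp
    moreover have "ce {x, y} < card W" using ce_eq[OF xy] pos by simp
    moreover have "cv y \<noteq> ce {x, y}"
    proof
      assume "cv y = ce {x, y}"
      then have "(h y + card U) mod card W = (h y + h x) mod card W"
        using cvW[OF xy(2)] ce_eq[OF xy] by (simp add: add.commute)
      then have "card U = h x" using add_mod_cancel h[OF xy(1)] less by (meson less_trans)
      then show False using h[OF xy(1)] by simp
    qed
    ultimately show "cv x \<noteq> cv y \<and> cv x \<noteq> ce {x, y} \<and> cv y \<noteq> ce {x, y}" by auto
  qed
qed

text \<open>Every vertex would see every color. The color of some \<open>x0 \<in> U\<close> reaches all of \<open>W\<close> by edges, but only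
  the other vertices of \<open>U\<close> can be the ends of these.\<close>
lemma not_total_colorable_plus_1:
  assumes eq: "card U = card W"
  shows "\<not> total_colorable H (card W + 1)"
proof
  assume "total_colorable H (card W + 1)"
  then obtain cv ce where c: "proper_total_coloring H cv ce" "cv ` vertices H \<subseteq> {..<card W + 1}"
    "ce ` edges H \<subseteq> {..<card W + 1}" unfolding total_colorable_def by blast
  have ce: "edge_colored (edges H) ce {..<card W + 1}"
    using c by (simp add: edge_colored_iff proper_total_coloring_def)
  have inc: "cv v \<noteq> ce e" if "v \<in> vertices H" "e \<in> edges H" "v \<in> e" for v e
    using c(1) that unfolding proper_total_coloring_def by blast
  obtain x0 where x0: "x0 \<in> U" using ne by blast
  have x0k: "cv x0 < card W + 1" using c(2) x0 H(1) by auto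
  have "\<exists>x\<in>U - {x0}. ce {x, y} = cv x0" if y: "y \<in> W" for y
  proof (rule ccontr)
    assume none: "\<not> ?thesis"
    have adj: "cv x0 \<noteq> cv y"
    proof -
      have "{x0, y} \<in> edges H" "x0 \<noteq> y" using x0 y disj edge_iff by auto
      then show ?thesis
        using c(1) unfolding proper_total_coloring_def proper_vertex_coloring_def by blast
    qed
    have "ce e \<noteq> cv x0" if "e \<in> edges H" "y \<in> e" for e
    proof -
      obtain x y' where e: "e = {x, y'}" "x \<in> U" "y' \<in> W" using \<open>e \<in> edges H\<close> by (rule edgeE)
      then have "y' = y" using that(2) y disj by auto
      then show ?thesis using none e inc[of x0 e] that(1) x0 H(1) by (cases "x = x0") auto
    qed
    moreover have "ce e \<noteq> cv y" if "e \<in> edges H" "y \<in> e" for e using inc[of y e] that y H(1) by auto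
    moreover have "cv y < card W + 1" using c(2) y H(1) by auto
    ultimately have "{cv x0, cv y} \<subseteq> missing (edges H) ce {..<card W + 1} y"
      using x0k unfolding missing_def by auto
    moreover have "finite (missing (edges H) ce {..<card W + 1} y)"
      by (rule finite_subset[OF missing_subset]) simp
    ultimately have "card {cv x0, cv y} \<le> card (missing (edges H) ce {..<card W + 1} y)"
      by (intro card_mono)
    then show False
      using card_missing[OF _ _ ce, of y] simple_edges_H degree_W[OF y] eq adj by (simp add: simple_edges_def)
  qed
  then obtain g where g: "\<And>y. y \<in> W \<Longrightarrow> g y \<in> U - {x0}" "\<And>y. y \<in> W \<Longrightarrow> ce {g y, y} = cv x0" by metis
  have "inj_on g W"
  proof (rule inj_onI, rule ccontr)
    fix y y' assume y: "y \<in> W" "y' \<in> W" "g y = g y'" "y \<noteq> y'"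
    have "ce {g y, y} \<noteq> ce {g y, y'}"
      by (rule edge_colored_neq[OF ce, of _ _ "g y"])
        (use y g(1)[OF y(1)] g(1)[OF y(2)] in \<open>auto simp: edge_iff doubleton_eq_iff\<close>)
    then show False using g(2)[OF y(1)] g(2)[OF y(2)] y(3) by simp
  qed
  then have "card W \<le> card (U - {x0})" using g(1) fin by (intro card_inj_on_le[of g]) auto
  moreover have "card (U - {x0}) < card U" using fin x0 by (intro card_Diff1_less) auto
  ultimately show False using eq by simp
qed

lemma TCC_H: "satisfies_TCC H"
  using satisfies_TCC_I[OF simple_graph_H total_colorable_plus_2] max_degree_H by simp

lemma type_II_H: "type_II H \<longleftrightarrow> card U = card W"
proof
  show "card U = card W" if "type_II H"
  proof (rule ccontr)
    assume "card U \<noteq> card W"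
    then have "total_colorable H (max_degree H + 1)"
      using total_colorable_plus_1 le by (simp add: max_degree_H)
    moreover have "vertices H \<noteq> {}" using ne H(1) by simp
    ultimately show False using type_I_I(2)[OF simple_graph_H] that by simp
  qed
  assume eq: "card U = card W"
  have V: "vertices H \<noteq> {}" using ne H(1) by simp
  have "total_chromatic_number H = card W + 2"
  proof (rule total_chromatic_number_eqI[OF total_colorable_plus_2])
    fix j assume j: "total_colorable H j"
    have "card W < j" using max_degree_less_total[OF simple_graph_H V j] max_degree_H by simp
    moreover have "j \<noteq> card W + 1" using not_total_colorable_plus_1[OF eq] j by blast
    ultimately show "card W + 2 \<le> j" by linarith
  qed
  then show "type_II H" using V by (simp add: type_II_def max_degree_H)
qed

text \<open>The complement consists of two disjoint cliques. Modulo an odd number \<open>M\<close> give \<open>{x, y}\<close> the color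
  \<open>h x + h y\<close> and \<open>x\<close> the color \<open>2 h x\<close>.\<close>
lemma TCC_complement_H: "satisfies_TCC (complement_graph H)"
proof (rule satisfies_TCC_I[OF simple_graph_complement[OF simple_graph_H]])
  let ?C = "complement_graph H"
  obtain h where h: "inj_on h U" "inj_on h W" and hU: "\<And>x. x \<in> U \<Longrightarrow> h x < card U"
    and hW: "\<And>x. x \<in> W \<Longrightarrow> h x < card W" by (rule numbering) blast
  define M where "M = (if odd (card W) then card W else card W + 1)"
  have M: "odd M" "card W \<le> M" "M \<le> card W + 1" by (auto simp: M_def)
  have pos: "0 < M" using M(1) by (rule odd_pos)
  have less: "h x < M" if "x \<in> U \<union> W" for x using that hU[of x] hW[of x] le M(2) by auto
  define ce where "ce e = sum h e mod M" for e
  define cv where "cv x = (2 * h x) mod M" for x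
  have adj: "x \<noteq> y" "h x \<noteq> h y" "x \<in> U \<union> W" "y \<in> U \<union> W" "x \<in> U \<longleftrightarrow> y \<in> U" if "{x, y} \<in> edges ?C" for x y
  proof -
    have "x \<in> U \<union> W" "y \<in> U \<union> W" "x \<noteq> y" "\<not> (x \<in> U \<and> y \<in> W \<or> x \<in> W \<and> y \<in> U)"
      using that unfolding complement_edge_iff[OF simple_graph_H] H(1) edge_iff by auto
    then show "x \<noteq> y" "x \<in> U \<union> W" "y \<in> U \<union> W" "x \<in> U \<longleftrightarrow> y \<in> U" using disj by auto
    then show "h x \<noteq> h y" using inj_onD[OF h(1), of x y] inj_onD[OF h(2), of x y] by auto
  qed
  have ce: "ce {x, y} = (h x + h y) mod M" if "{x, y} \<in> edges ?C" for x y
    using adj(1)[OF that] by (simp add: ce_def)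
  have same: "h y \<noteq> h y'" if "{x, y} \<in> edges ?C" "{x, y'} \<in> edges ?C" "y \<noteq> y'" for x y y'
  proof -
    have "y \<in> U \<and> y' \<in> U \<or> y \<in> W \<and> y' \<in> W" using adj(3-5)[OF that(1)] adj(3-5)[OF that(2)] disj by auto
    then show ?thesis using inj_onD[OF h(1), of y y'] inj_onD[OF h(2), of y y'] that(3) by auto
  qed
  have split: "\<exists>y. e = {v, y}" if "e \<in> edges ?C" "v \<in> e" for e v
    using that by (auto simp: complement_graph_def)
  have "proper_vertex_coloring ?C cv"
    unfolding proper_vertex_coloring_def cv_def
  proof (intro allI impI notI, elim conjE)
    fix x y assume xy: "{x, y} \<in> edges ?C" "2 * h x mod M = 2 * h y mod M"
    then show False using double_mod_cancel[OF M(1) xy(2)] less adj[OF xy(1)] by blast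
  qed
  moreover have "proper_edge_coloring ?C ce"
    unfolding proper_edge_coloring_def
  proof (intro ballI impI, elim conjE)
    fix e f assume ef: "e \<in> edges ?C" "f \<in> edges ?C" "e \<noteq> f" "e \<inter> f \<noteq> {}"
    then obtain v where v: "v \<in> e" "v \<in> f" by blast
    obtain y where y: "e = {v, y}" using split[OF ef(1) v(1)] by blast
    obtain y' where y': "f = {v, y'}" using split[OF ef(2) v(2)] by blast
    have e: "{v, y} \<in> edges ?C" and f: "{v, y'} \<in> edges ?C" using ef y y' by auto
    have "h y \<noteq> h y'" using same[OF e f] ef(3) y y' by auto
    then have "(h v + h y) mod M \<noteq> (h v + h y') mod M"
      using add_mod_cancel[of "h v" "h y" M "h y'"] less adj(4)[OF e] adj(4)[OF f] by blast
    then show "ce e \<noteq> ce f" using ce[OF e] ce[OF f] y y' by simp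
  qed
  moreover have "cv v \<noteq> ce e" if v: "v \<in> e" and e: "e \<in> edges ?C" for v e
  proof -
    obtain y where y: "e = {v, y}" using split[OF e v] by blast
    have vy: "{v, y} \<in> edges ?C" using e y by simp
    have "(h v + h v) mod M \<noteq> (h v + h y) mod M"
      using add_mod_cancel[of "h v" "h v" M "h y"] less adj[OF vy] by blast
    then show ?thesis using ce[OF vy] y by (simp add: cv_def mult_2)
  qed
  moreover have "cv x < card W + 1" "ce e < card W + 1" for x e
    using pos M(3) by (auto simp: cv_def ce_def intro: less_le_trans[of _ M])
  ultimately show "total_colorable ?C (card W + 1)"
    unfolding total_colorable_def proper_total_coloring_def
    by (intro exI[of _ cv] exI[of _ ce]) auto
  obtain y where y: "y \<in> W" using W_ne by blast
  have "edge_degree (edges ?C) y + (card U + 1) = card U + card W"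
    using degree_complement[OF simple_graph_H, of y] y degree_W[OF y] fin disj
    by (simp add: H(1) card_Un_disjoint)
  moreover have "edge_degree (edges ?C) y \<le> max_degree ?C"
    using vertex_degree_le_max_degree[of ?C y] y fin by (simp add: H(1) vertex_degree_eq)
  ultimately show "card W + 1 \<le> max_degree ?C + 2" by simp
qed

end

section \<open>The disjointness graph for any number of coordinates\<close>

context support_graph
begin

lemma null_case:
  assumes I: "card I = 1"
  shows "V = {}"
  using I supp_subset by (auto simp: V_def card_1_singleton_iff subset_singleton_iff)

lemma bipartite_case:
  assumes I: "I = {i, k}" "i \<noteq> k" and le: "a i \<le> a k"
  shows "complete_bipartite G (L i) (L k)"
proof
  have V: "V = L i \<union> L k"
  proof -
    have "supp x = {} \<or> supp x = {i} \<or> supp x = {k} \<or> supp x = I" if "x \<in> A" for x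
      using supp_subset[OF that] I(1) by auto
    then show ?thesis unfolding V_def L_def using I by auto
  qed
  then show "vertices G = L i \<union> L k" by simp
  have "e \<in> bipartite (L i) (L k)" if "e \<in> edges G" for e
    using that
  proof (rule edgeE)
    fix x y assume xy: "e = {x, y}" "x \<in> V" "y \<in> V" "x \<noteq> y" "supp x \<inter> supp y = {}"
    have "x \<in> L i \<and> y \<in> L k \<or> x \<in> L k \<and> y \<in> L i" using xy(2,3,5) unfolding V by (auto simp: L_def)
    then show ?thesis using xy(1) by (auto simp: bipartite_def insert_commute)
  qed
  moreover have "e \<in> edges G" if e: "e \<in> bipartite (L i) (L k)" for e
  proof -
    obtain x y where "e = {x, y}" "x \<in> L i" "y \<in> L k" using e by (auto simp: bipartite_def)
    then show ?thesis using edge_iff[of x y] V I(2) by (auto simp: L_def)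
  qed
  ultimately show "edges G = bipartite (L i) (L k)" by blast
  show "L i \<inter> L k = {}" using I(2) by (auto simp: L_def)
  have "0 < card (L i)" using card_L[of i] pos[of i] I(1) by simp
  then show "L i \<noteq> {}" by auto
  show "card (L i) \<le> card (L k)" using card_L I(1) le by simp
qed (rule finite_LD)+

theorem support_graph_coloring:
  assumes I: "I \<noteq> {}"
  shows "edge_chromatic_number G = max_degree G" "satisfies_TCC G" "satisfies_TCC (complement_graph G)"
    "type_II G \<longleftrightarrow> card I = 2 \<and> (\<forall>i\<in>I. \<forall>k\<in>I. a i = a k)"
proof -
  have "0 < card I" using I finite_I by (simp add: card_gt_0_iff)
  then consider "card I = 1" | "card I = 2" | "3 \<le> card I" by linarith
  then have "edge_chromatic_number G = max_degree G \<and> satisfies_TCC G \<and> satisfies_TCC (complement_graph G) \<and>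
    (type_II G \<longleftrightarrow> card I = 2 \<and> (\<forall>i\<in>I. \<forall>k\<in>I. a i = a k))"
  proof cases
    case 1
    note V = null_case[OF 1]
    have "edges G = {}" using V by (auto elim: edgeE)
    then have "edge_colored (edges G) (\<lambda>_. 0) {..<max_degree G}" by (simp add: edge_colored_def)
    then show ?thesis
      using edge_chromatic_number_eq_max_degree[OF simple_graph_G] V 1
      by (simp add: satisfies_TCC_def type_II_def)
  next
    case 2
    then obtain i k where "I = {i, k}" "i \<noteq> k" by (auto simp: card_2_iff)
    then obtain i k where ik: "I = {i, k}" "i \<noteq> k" "a i \<le> a k"
      by (metis insert_commute nle_le)
    interpret complete_bipartite G "L i" "L k" by (rule bipartite_case[OF ik])
    have "card (L i) = a i" "card (L k) = a k" using card_L ik(1) by auto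
    then have "type_II G \<longleftrightarrow> card I = 2 \<and> (\<forall>i\<in>I. \<forall>k\<in>I. a i = a k)"
      using type_II_H 2 ik(1) by auto
    then show ?thesis using edge_chromatic_number_H TCC_H TCC_complement_H by blast
  next
    case 3
    obtain i where "i \<in> I" using I by blast
    then obtain m where m: "m \<in> I" "\<And>i. i \<in> I \<Longrightarrow> a m \<le> a i"
      using ex_has_least_nat[of "\<lambda>i. i \<in> I" i a] by blast
    interpret support_graph_3 A supp I a m
      by unfold_locales (use 3 m in auto)
    obtain c where "edge_colored (edges G) c {..<max_degree G}"
      using edge_coloring_G max_degree_G by auto
    then have "edge_chromatic_number G = max_degree G"
      using edge_chromatic_number_eq_max_degree[OF simple_graph_G] by blast
    moreover have "satisfies_TCC G" "\<not> type_II G"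
      using type_I_I[OF simple_graph_G] V_nonempty total_coloring_G by (simp_all add: max_degree_G)
    ultimately show ?thesis using TCC_complement 3 by simp
  qed
  then show "edge_chromatic_number G = max_degree G" "satisfies_TCC G" "satisfies_TCC (complement_graph G)"
    "type_II G \<longleftrightarrow> card I = 2 \<and> (\<forall>i\<in>I. \<forall>k\<in>I. a i = a k)" by blast+
qed

end

section \<open>Finite reduced rings\<close>

text \<open>Both sides of \<open>sub\<close> are sums over the subsets of \<open>S\<close>, so by induction the terms for proper subsets
  cancel.\<close>
lemma card_eq_supp_from_subset:
  fixes A :: "'a set" and I :: "'i set" and a :: "'i \<Rightarrow> nat"
  assumes A: "finite A" and I: "finite I"
    and sub: "\<And>S. S \<subseteq> I \<Longrightarrow> card {x \<in> A. supp x \<subseteq> S} = (\<Prod>i\<in>S. 1 + a i)"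
    and S: "S \<subseteq> I"
  shows "card {x \<in> A. supp x = S} = (\<Prod>i\<in>S. a i)"
proof -
  have "finite S" using S I by (rule finite_subset)
  then show ?thesis using S
  proof (induction S rule: finite_psubset_induct)
    case (psubset S)
    have fin: "finite (Pow S)" using psubset.hyps by simp
    have "{x \<in> A. supp x \<subseteq> S} = (\<Union>T\<in>Pow S. {x \<in> A. supp x = T})" by auto
    also have "card \<dots> = (\<Sum>T\<in>Pow S. card {x \<in> A. supp x = T})"
      using fin A by (intro card_UN_disjoint) auto
    also have "\<dots> = card {x \<in> A. supp x = S} + (\<Sum>T\<in>Pow S - {S}. card {x \<in> A. supp x = T})"
      using fin by (intro sum.remove) auto
    also have "(\<Sum>T\<in>Pow S - {S}. card {x \<in> A. supp x = T}) = (\<Sum>T\<in>Pow S - {S}. \<Prod>i\<in>T. a i)"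
      using psubset.IH psubset.prems by (intro sum.cong refl) auto
    finally have "card {x \<in> A. supp x = S} + (\<Sum>T\<in>Pow S - {S}. \<Prod>i\<in>T. a i) = (\<Prod>i\<in>S. 1 + a i)"
      using sub[OF psubset.prems] by simp
    moreover have "(\<Prod>i\<in>S. 1 + a i) = (\<Sum>T\<in>Pow S. \<Prod>i\<in>T. a i)"
      using prod_add[OF psubset.hyps, of a "\<lambda>_. 1"] by (simp add: add.commute)
    moreover have "\<dots> = (\<Prod>i\<in>S. a i) + (\<Sum>T\<in>Pow S - {S}. \<Prod>i\<in>T. a i)"
      using fin by (intro sum.remove) auto
    ultimately show ?case by linarith
  qed
qed

text \<open>The hypothesis \<open>zero\<close> for \<open>y = 1\<close> and \<open>y = x\<close> shows that only zero has an empty support, and the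
  element whose support is complementary to that of \<open>x\<close> shows that \<open>x\<close> is a zero-divisor.\<close>
lemma (in cring) zero_divisor_graph_eq_support_graph:
  assumes "support_graph (carrier R) supp I a"
    and zero: "\<And>x y. x \<in> carrier R \<Longrightarrow> y \<in> carrier R \<Longrightarrow> x \<otimes> y = \<zero> \<longleftrightarrow> supp x \<inter> supp y = {}"
  shows "zero_divisor_graph R = support_graph.G (carrier R) supp I"
proof -
  interpret support_graph "carrier R" supp I a by fact
  have zero_iff: "x = \<zero> \<longleftrightarrow> supp x = {}" if x: "x \<in> carrier R" for x
  proof
    assume "x = \<zero>" then show "supp x = {}" using zero[OF x x] by simp
  next
    assume "supp x = {}"
    then have "x \<otimes> \<one> = \<zero>" using zero[OF x one_closed] by simp
    then show "x = \<zero>" using x by simp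
  qed
  have ex: "(\<exists>y\<in>carrier R. y \<noteq> \<zero> \<and> x \<otimes> y = \<zero>) \<longleftrightarrow> supp x \<noteq> I" if x: "x \<in> carrier R" for x
  proof
    assume "\<exists>y\<in>carrier R. y \<noteq> \<zero> \<and> x \<otimes> y = \<zero>"
    then obtain y where y: "y \<in> carrier R" "supp y \<noteq> {}" "supp x \<inter> supp y = {}"
      using zero[OF x] zero_iff by auto
    then show "supp x \<noteq> I" using supp_subset[OF y(1)] by auto
  next
    assume ne: "supp x \<noteq> I"
    obtain y where y: "y \<in> carrier R" "supp y = I - supp x"
      using nonempty_supp[of "I - supp x"] by auto
    have "supp y \<noteq> {}" using ne y(2) supp_subset[OF x] by auto
    then have "y \<noteq> \<zero>" using zero_iff[OF y(1)] by simp
    moreover have "x \<otimes> y = \<zero>" using zero[OF x y(1)] y(2) by auto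
    ultimately show "\<exists>y\<in>carrier R. y \<noteq> \<zero> \<and> x \<otimes> y = \<zero>" using y(1) by blast
  qed
  have "nonzero_zero_divisors R = V"
    unfolding nonzero_zero_divisors_def V_def
  proof (intro Collect_cong conj_cong refl)
    fix x assume "x \<in> carrier R"
    then show "x \<noteq> \<zero> \<longleftrightarrow> supp x \<noteq> {}" "(\<exists>y\<in>carrier R. y \<noteq> \<zero> \<and> x \<otimes> y = \<zero>) \<longleftrightarrow> supp x \<noteq> I"
      using zero_iff ex by blast+
  qed
  moreover have "{{x, y} | x y. x \<in> V \<and> y \<in> V \<and> x \<noteq> y \<and> x \<otimes> y = \<zero>} =
      {{x, y} | x y. x \<in> V \<and> y \<in> V \<and> x \<noteq> y \<and> supp x \<inter> supp y = {}}"
  proof -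
    have "x \<in> carrier R" if "x \<in> V" for x using that by (simp add: V_def)
    then have "x \<in> V \<and> y \<in> V \<and> x \<noteq> y \<and> x \<otimes> y = \<zero> \<longleftrightarrow> x \<in> V \<and> y \<in> V \<and> x \<noteq> y \<and> supp x \<inter> supp y = {}" for x y
      using zero[of x y] by blast
    then show ?thesis by (simp only:)
  qed
  ultimately show ?thesis unfolding zero_divisor_graph_def G_def by simp
qed

lemma (in ideal) rcos_eq_iff:
  assumes "x \<in> carrier R" "y \<in> carrier R"
  shows "I +> x = I +> y \<longleftrightarrow> x \<ominus> y \<in> I"
proof
  assume "I +> x = I +> y"
  then have "x \<in> I +> y" using a_rcos_self[OF assms(1)] by simp
  then show "x \<ominus> y \<in> I" using a_rcos_module_minus[OF ring_axioms assms(2,1)] by simp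
next
  assume "x \<ominus> y \<in> I"
  then have "x \<in> I +> y" using a_rcos_module_minus[OF ring_axioms assms(2,1)] by simp
  then show "I +> x = I +> y" using a_repr_independence'[OF _ assms(2)] by simp
qed

locale finite_reduced_ring = cring R for R (structure) +
  assumes finite_carrier: "finite (carrier R)" and reduced: "reduced_ring R"
    and one_not_zero: "\<one> \<noteq> \<zero>"
begin

definition Max_Spec :: "'a set set" where
  "Max_Spec = {M. maximalideal M R}"

lemma Max_SpecD:
  assumes "M \<in> Max_Spec"
  shows "ideal M R" "primeideal M R" "maximalideal M R" "M \<subseteq> carrier R" "\<one> \<notin> M"
proof -
  show M: "maximalideal M R" using assms by (simp add: Max_Spec_def)
  then interpret maximalideal M R .
  show "ideal M R" by (rule is_ideal)
  show "primeideal M R" using M by (rule maximalideal_prime)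
  show "M \<subseteq> carrier R" by (rule a_subset)
  show "\<one> \<notin> M" using one_imp_carrier I_notcarr by auto
qed

lemma finite_Max_Spec: "finite Max_Spec"
proof -
  have "Max_Spec \<subseteq> Pow (carrier R)" using Max_SpecD(4) by blast
  then show ?thesis using finite_carrier by (meson finite_Pow_iff finite_subset)
qed

text \<open>In a finite ring a proper ideal of largest size above \<open>K\<close> is maximal.\<close>
lemma maximal_ideal_above:
  assumes K: "ideal K R" "K \<noteq> carrier R"
  obtains M where "M \<in> Max_Spec" "K \<subseteq> M"
proof -
  define P where "P M \<longleftrightarrow> ideal M R \<and> K \<subseteq> M \<and> M \<noteq> carrier R" for M
  have sub: "M \<subseteq> carrier R" if "ideal M R" for M
    using ideal.axioms(1)[OF that] additive_subgroup.a_subset by blast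
  have "P K" using K by (simp add: P_def)
  moreover have "\<forall>M. P M \<longrightarrow> card M < Suc (card (carrier R))"
    using sub card_mono[OF finite_carrier] by (simp add: P_def less_Suc_eq_le)
  ultimately have "\<exists>M. P M \<and> (\<forall>M'. P M' \<longrightarrow> card M' \<le> card M)" by (rule ex_has_greatest_nat)
  then obtain M where M: "P M" "\<forall>M'. P M' \<longrightarrow> card M' \<le> card M" by blast
  have "maximalideal M R"
  proof (rule maximalidealI)
    show "ideal M R" "carrier R \<noteq> M" using M(1) by (auto simp: P_def)
    fix M' assume M': "ideal M' R" "M \<subseteq> M'" "M' \<subseteq> carrier R"
    show "M' = M \<or> M' = carrier R"
    proof (rule disjCI)
      assume "M' \<noteq> carrier R"
      then have "card M' \<le> card M" using M M' by (auto simp: P_def)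
      moreover have "finite M'" using M'(3) finite_carrier by (rule finite_subset)
      ultimately show "M' = M" using M'(2) card_seteq by blast
    qed
  qed
  then show ?thesis using that M(1) by (auto simp: Max_Spec_def P_def)
qed

lemma square_zero:
  assumes "x \<in> carrier R" "x \<otimes> x = \<zero>"
  shows "x = \<zero>"
proof -
  have "x [^] (2::nat) = \<zero>" using assms by (simp add: numeral_2_eq_2)
  then show ?thesis using reduced assms(1) unfolding reduced_ring_def by blast
qed

text \<open>Multiplication by \<open>x\<close> is injective on \<open>xR\<close> because the ring is reduced, hence surjective. So
  \<open>x = x (x s)\<close> for some \<open>s\<close>, and a maximal ideal above the annihilator of \<open>x\<close> contains \<open>1 - x s\<close>,
  so it cannot contain \<open>x\<close>.\<close>
lemma not_in_maximal_ideal: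
  assumes x: "x \<in> carrier R" "x \<noteq> \<zero>"
  obtains M where "M \<in> Max_Spec" "x \<notin> M"
proof -
  let ?xR = "(\<lambda>r. x \<otimes> r) ` carrier R"
  have fin: "finite ?xR" using finite_carrier by simp
  have "inj_on (\<lambda>u. x \<otimes> u) ?xR"
  proof (rule inj_onI)
    fix u v assume "u \<in> ?xR" "v \<in> ?xR" and eq: "x \<otimes> u = x \<otimes> v"
    then obtain r s where rs: "r \<in> carrier R" "s \<in> carrier R" "u = x \<otimes> r" "v = x \<otimes> s" by blast
    let ?w = "x \<otimes> (r \<ominus> s)"
    have "?w \<otimes> ?w = (x \<otimes> u \<ominus> x \<otimes> v) \<otimes> (r \<ominus> s)"
      using x rs by (simp add: rs(3,4)) algebra
    also have "\<dots> = \<zero>" using eq x rs by (simp add: r_neg minus_eq)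
    finally have sq: "?w \<otimes> ?w = \<zero>" .
    have "?w \<in> carrier R" using x(1) rs(1,2) by simp
    then have "?w = \<zero>" using sq by (rule square_zero)
    moreover have "u \<ominus> v = ?w" unfolding rs(3,4) using x(1) rs(1,2) by algebra
    ultimately have "u \<ominus> v = \<zero>" by simp
    then show "u = v" using x rs by simp
  qed
  then have "(\<lambda>u. x \<otimes> u) ` ?xR = ?xR" using x by (intro endo_inj_surj fin) auto
  moreover have "x \<in> ?xR" using x by (intro image_eqI[of _ _ \<one>]) auto
  ultimately obtain s where s: "s \<in> carrier R" "x = x \<otimes> (x \<otimes> s)" by auto
  let ?K = "{r \<in> carrier R. x \<otimes> r \<in> {\<zero>}}"
  have "ideal ?K R" by (rule ideal.helper_max_prime[OF zeroideal is_cring x(1)])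
  moreover have "\<one> \<notin> ?K" using x by simp
  then have "?K \<noteq> carrier R" by blast
  ultimately obtain M where M: "M \<in> Max_Spec" "?K \<subseteq> M" by (rule maximal_ideal_above)
  have "x \<notin> M"
  proof
    assume xM: "x \<in> M"
    interpret ideal M R using Max_SpecD(1)[OF M(1)] .
    have "x \<otimes> (\<one> \<ominus> x \<otimes> s) = x \<ominus> x \<otimes> (x \<otimes> s)" using x(1) s(1) by algebra
    also have "\<dots> = \<zero>" using s(2) x(1) s(1) by (metis minus_eq r_neg)
    finally have "\<one> \<ominus> x \<otimes> s \<in> M" using M(2) x(1) s(1) by auto
    moreover have "x \<otimes> s \<in> M" using xM s(1) by (rule I_r_closed)
    ultimately have "(\<one> \<ominus> x \<otimes> s) \<oplus> x \<otimes> s \<in> M" by (rule a_closed)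
    moreover have "(\<one> \<ominus> x \<otimes> s) \<oplus> x \<otimes> s = \<one>" using x(1) s(1) by algebra
    ultimately show False using Max_SpecD(5)[OF M(1)] by simp
  qed
  then show ?thesis using that M(1) by blast
qed

text \<open>A product of elements \<open>s \<in> M' - M\<close>, one for each \<open>M' \<in> T\<close>; it is not in \<open>M\<close> because \<open>M\<close> is prime.\<close>
lemma separating_element:
  assumes T: "finite T" "T \<subseteq> Max_Spec" and M: "M \<in> Max_Spec" "M \<notin> T"
  shows "\<exists>t\<in>carrier R. (\<forall>M'\<in>T. t \<in> M') \<and> t \<notin> M"
  using T M(2)
proof (induction T rule: finite_induct)
  case empty
  then show ?case using Max_SpecD(5)[OF M(1)] by auto
next
  case (insert M' T)
  then obtain t where t: "t \<in> carrier R" "\<forall>M'\<in>T. t \<in> M'" "t \<notin> M" by auto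
  have M': "M' \<in> Max_Spec" "M' \<noteq> M" using insert.prems by auto
  have "\<not> M' \<subseteq> M"
    using maximalideal.I_maximal[OF Max_SpecD(3)[OF M'(1)] Max_SpecD(1)[OF M(1)] _ Max_SpecD(4)[OF M(1)]]
      maximalideal.I_notcarr[OF Max_SpecD(3)[OF M(1)]] M'(2) M(1) Max_SpecD(4)[OF M(1)] by blast
  then obtain s where s: "s \<in> M'" "s \<notin> M" by blast
  have sR: "s \<in> carrier R" using s(1) Max_SpecD(4)[OF M'(1)] by blast
  have "s \<otimes> t \<notin> M"
    using primeideal.I_prime[OF Max_SpecD(2)[OF M(1)] sR t(1)] s(2) t(3) by blast
  moreover have "s \<otimes> t \<in> M'" using ideal.I_r_closed[OF Max_SpecD(1)[OF M'(1)] s(1) t(1)] .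
  moreover have "s \<otimes> t \<in> M''" if "M'' \<in> T" for M''
    using ideal.I_l_closed[OF Max_SpecD(1), of M'' t s] that t(2) sR insert.prems by blast
  ultimately show ?case using sR t(1) by auto
qed

text \<open>The intersection of the ideals in \<open>T\<close>, which is the whole ring for empty \<open>T\<close>.\<close>
definition vanishing :: "'a set set \<Rightarrow> 'a set" where
  "vanishing T = {x \<in> carrier R. \<forall>M\<in>T. x \<in> M}"

lemma vanishing_closed:
  assumes "T \<subseteq> Max_Spec" "x \<in> vanishing T" "y \<in> vanishing T"
  shows "x \<oplus> y \<in> vanishing T" "x \<ominus> y \<in> vanishing T"
proof -
  have "x \<oplus> y \<in> M \<and> x \<ominus> y \<in> M" if "M \<in> T" for M
  proof -
    interpret ideal M R using Max_SpecD(1) assms(1) that by blast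
    have "x \<in> M" "y \<in> M" using assms(2,3) that by (auto simp: vanishing_def)
    then show ?thesis by (simp add: minus_eq)
  qed
  then show "x \<oplus> y \<in> vanishing T" "x \<ominus> y \<in> vanishing T" using assms(2,3) by (auto simp: vanishing_def)
qed

text \<open>An element \<open>t\<close> that separates \<open>M\<close> from \<open>T\<close> has an inverse \<open>r\<close> modulo \<open>M\<close>. Then \<open>y r t\<close> is in the class of \<open>y\<close>.\<close>
lemma vanishing_surj:
  assumes T: "T \<subseteq> Max_Spec" and M: "M \<in> Max_Spec" "M \<notin> T"
  shows "(\<lambda>x. M +> x) ` vanishing T = a_rcosets M"
proof
  interpret ideal M R using Max_SpecD(1)[OF M(1)] .
  show "(\<lambda>x. M +> x) ` vanishing T \<subseteq> a_rcosets M"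
    by (auto simp: vanishing_def intro: a_rcosetsI[OF a_subset])
  obtain t where t: "t \<in> carrier R" "\<forall>M'\<in>T. t \<in> M'" "t \<notin> M"
    using separating_element[OF finite_subset[OF T finite_Max_Spec] T M] by blast
  interpret F: field "R Quot M"
    by (rule maximalideal.quotient_is_field[OF Max_SpecD(3)[OF M(1)] is_cring])
  have carr: "carrier (R Quot M) = a_rcosets M" "\<zero>\<^bsub>R Quot M\<^esub> = M" "\<one>\<^bsub>R Quot M\<^esub> = M +> \<one>"
    by (simp_all add: FactRing_def)
  have "M +> t \<in> a_rcosets M" using t(1) by (rule a_rcosetsI[OF a_subset])
  moreover have "M +> t \<noteq> M" using a_rcos_self[OF t(1)] t(3) by blast
  ultimately have "M +> t \<in> Units (R Quot M)" by (simp add: F.field_Units carr)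
  then obtain u where u: "u \<in> a_rcosets M" "u \<otimes>\<^bsub>R Quot M\<^esub> (M +> t) = M +> \<one>"
    using F.Units_l_inv_ex[of "M +> t"] by (auto simp: carr)
  obtain r where r: "r \<in> carrier R" "u = M +> r"
    using u(1) by (auto simp: A_RCOSETS_def RCOSETS_def a_r_coset_def)
  have "M +> (r \<otimes> t) = M +> \<one>"
    using u(2) r t(1) by (simp add: FactRing_def rcoset_mult_add)
  then have rt: "r \<otimes> t \<ominus> \<one> \<in> M" using rcos_eq_iff[of "r \<otimes> t" \<one>] r(1) t(1) by simp
  show "a_rcosets M \<subseteq> (\<lambda>x. M +> x) ` vanishing T"
  proof
    fix c assume "c \<in> a_rcosets M"
    then obtain y where y: "y \<in> carrier R" "c = M +> y"
      by (auto simp: A_RCOSETS_def RCOSETS_def a_r_coset_def)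
    have "y \<otimes> r \<otimes> t \<in> M'" if "M' \<in> T" for M'
      using ideal.I_l_closed[OF Max_SpecD(1), of M' t "y \<otimes> r"] that T t(2) y(1) r(1) by blast
    then have "y \<otimes> r \<otimes> t \<in> vanishing T" using y(1) r(1) t(1) by (simp add: vanishing_def)
    moreover have "y \<otimes> r \<otimes> t \<ominus> y = y \<otimes> (r \<otimes> t \<ominus> \<one>)" using y(1) r(1) t(1) by algebra
    then have "y \<otimes> r \<otimes> t \<ominus> y \<in> M" using I_l_closed[OF rt y(1)] by simp
    then have "M +> (y \<otimes> r \<otimes> t) = c" using rcos_eq_iff[of "y \<otimes> r \<otimes> t" y] y r(1) t(1) by simp
    ultimately show "c \<in> (\<lambda>x. M +> x) ` vanishing T" by blast
  qed
qed

definition residue_card :: "'a set \<Rightarrow> nat" where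
  "residue_card M = card (a_rcosets M)"

text \<open>The classes modulo \<open>M\<close> split the intersection of \<open>T\<close> into translates of the intersection of
  \<open>insert M T\<close>, and all classes occur by \<open>vanishing_surj\<close>.\<close>
lemma card_vanishing_step:
  assumes T: "T \<subseteq> Max_Spec" and M: "M \<in> Max_Spec" "M \<notin> T"
  shows "card (vanishing T) = residue_card M * card (vanishing (insert M T))"
proof -
  interpret ideal M R using Max_SpecD(1)[OF M(1)] .
  let ?f = "\<lambda>x. M +> x"
  have fin: "finite (vanishing T)" using finite_carrier by (simp add: vanishing_def)
  have TM: "insert M T \<subseteq> Max_Spec" using T M by simp
  have carr: "vanishing T \<subseteq> carrier R" by (auto simp: vanishing_def)
  have sub: "vanishing (insert M T) \<subseteq> vanishing T" by (auto simp: vanishing_def)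
  have fiber: "card {x \<in> vanishing T. ?f x = c} = card (vanishing (insert M T))" if "c \<in> a_rcosets M" for c
  proof -
    obtain x0 where x0: "x0 \<in> vanishing T" "c = ?f x0"
      using \<open>c \<in> a_rcosets M\<close> vanishing_surj[OF T M] by blast
    have x0R: "x0 \<in> carrier R" using x0(1) carr by blast
    have "{x \<in> vanishing T. ?f x = c} = (\<lambda>u. u \<oplus> x0) ` vanishing (insert M T)"
    proof
      show "{x \<in> vanishing T. ?f x = c} \<subseteq> (\<lambda>u. u \<oplus> x0) ` vanishing (insert M T)"
      proof
        fix x assume x: "x \<in> {x \<in> vanishing T. ?f x = c}"
        then have xR: "x \<in> carrier R" using carr by blast
        have "x \<ominus> x0 \<in> M" using x x0(2) rcos_eq_iff[OF xR x0R] by simp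
        moreover have "x \<ominus> x0 \<in> vanishing T" using vanishing_closed(2)[OF T _ x0(1)] x by simp
        ultimately have "x \<ominus> x0 \<in> vanishing (insert M T)" by (simp add: vanishing_def)
        moreover have "x = (x \<ominus> x0) \<oplus> x0" using xR x0R by algebra
        ultimately show "x \<in> (\<lambda>u. u \<oplus> x0) ` vanishing (insert M T)" by blast
      qed
      show "(\<lambda>u. u \<oplus> x0) ` vanishing (insert M T) \<subseteq> {x \<in> vanishing T. ?f x = c}"
      proof
        fix x assume "x \<in> (\<lambda>u. u \<oplus> x0) ` vanishing (insert M T)"
        then obtain u where u: "u \<in> vanishing (insert M T)" "x = u \<oplus> x0" by blast
        have uR: "u \<in> carrier R" "u \<in> M" using u(1) by (auto simp: vanishing_def)
        have "x \<ominus> x0 = u" using u(2) uR x0R by algebra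
        then have "?f x = c" using rcos_eq_iff[of x x0] u(2) uR x0R x0(2) by simp
        moreover have "x \<in> vanishing T" using vanishing_closed(1)[OF T _ x0(1)] u sub by blast
        ultimately show "x \<in> {x \<in> vanishing T. ?f x = c}" by simp
      qed
    qed
    moreover have "inj_on (\<lambda>u. u \<oplus> x0) (vanishing (insert M T))"
    proof (rule inj_onI)
      fix u v assume uv: "u \<in> vanishing (insert M T)" "v \<in> vanishing (insert M T)" "u \<oplus> x0 = v \<oplus> x0"
      then have "u \<in> carrier R" "v \<in> carrier R" using sub carr by auto
      then show "u = v" using uv(3) x0R by simp
    qed
    ultimately show ?thesis by (simp add: card_image)
  qed
  have "card (vanishing T) = (\<Sum>x\<in>vanishing T. 1)" by simp
  also have "\<dots> = (\<Sum>c\<in>?f ` vanishing T. \<Sum>x\<in>{x \<in> vanishing T. ?f x = c}. 1)"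
    by (rule sum.image_gen[OF fin])
  also have "\<dots> = (\<Sum>c\<in>a_rcosets M. card (vanishing (insert M T)))"
    unfolding vanishing_surj[OF T M] using fiber by (intro sum.cong) simp_all
  finally show ?thesis by (simp add: residue_card_def)
qed

lemma vanishing_all: "vanishing Max_Spec = {\<zero>}"
proof
  show "vanishing Max_Spec \<subseteq> {\<zero>}"
  proof
    fix x assume x: "x \<in> vanishing Max_Spec"
    show "x \<in> {\<zero>}"
    proof (rule ccontr)
      assume "x \<notin> {\<zero>}"
      then have "x \<in> carrier R" "x \<noteq> \<zero>" using x by (auto simp: vanishing_def)
      then obtain M where "M \<in> Max_Spec" "x \<notin> M" by (rule not_in_maximal_ideal)
      then show False using x by (simp add: vanishing_def)
    qed
  qed
  have "\<zero> \<in> M" if "M \<in> Max_Spec" for M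
    using Max_SpecD(1)[OF that] additive_subgroup.zero_closed ideal.axioms(1) by blast
  then show "{\<zero>} \<subseteq> vanishing Max_Spec" by (simp add: vanishing_def)
qed

lemma card_vanishing:
  assumes "S \<subseteq> Max_Spec"
  shows "card (vanishing (Max_Spec - S)) = (\<Prod>M\<in>S. residue_card M)"
proof -
  have "finite S" using assms finite_Max_Spec by (rule finite_subset)
  then show ?thesis using assms
  proof (induction S rule: finite_induct)
    case empty
    then show ?case by (simp add: vanishing_all)
  next
    case (insert M S)
    have "insert M (Max_Spec - insert M S) = Max_Spec - S" using insert by auto
    then show ?case
      using card_vanishing_step[of "Max_Spec - insert M S" M] insert by simp
  qed
qed

definition ring_supp :: "'a \<Rightarrow> 'a set set" where
  "ring_supp x = {M \<in> Max_Spec. x \<notin> M}"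

lemma residue_card_ge_2:
  assumes M: "M \<in> Max_Spec"
  shows "2 \<le> residue_card M"
proof -
  interpret ideal M R using Max_SpecD(1)[OF M] .
  have "finite (a_rcosets M)" using finite_carrier by (simp add: A_RCOSETS_def RCOSETS_def)
  moreover have "{M +> \<zero>, M +> \<one>} \<subseteq> a_rcosets M" by (auto intro: a_rcosetsI[OF a_subset])
  moreover have "M +> \<one> \<noteq> M +> \<zero>"
    using rcos_eq_iff[of \<one> \<zero>] Max_SpecD(5)[OF M] by (simp add: minus_eq)
  then have "card {M +> \<zero>, M +> \<one>} = 2" by auto
  ultimately show ?thesis unfolding residue_card_def by (metis card_mono)
qed

lemma support_graph_ring: "support_graph (carrier R) ring_supp Max_Spec (\<lambda>M. residue_card M - 1)"
proof
  show "finite (carrier R)" "finite Max_Spec" by (rule finite_carrier finite_Max_Spec)+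
  show "ring_supp x \<subseteq> Max_Spec" for x by (auto simp: ring_supp_def)
  show "0 < residue_card M - 1" if "M \<in> Max_Spec" for M using residue_card_ge_2[OF that] by simp
  have "card {x \<in> carrier R. ring_supp x \<subseteq> S} = (\<Prod>M\<in>S. 1 + (residue_card M - 1))"
    if S: "S \<subseteq> Max_Spec" for S
  proof -
    have "{x \<in> carrier R. ring_supp x \<subseteq> S} = vanishing (Max_Spec - S)"
      by (auto simp: ring_supp_def vanishing_def)
    moreover have "(\<Prod>M\<in>S. 1 + (residue_card M - 1)) = (\<Prod>M\<in>S. residue_card M)"
    proof (rule prod.cong)
      fix M assume "M \<in> S"
      then show "1 + (residue_card M - 1) = residue_card M" using residue_card_ge_2[of M] S by auto
    qed simp
    ultimately show ?thesis using card_vanishing[OF S] by simp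
  qed
  then show "card {x \<in> carrier R. ring_supp x = S} = (\<Prod>M\<in>S. residue_card M - 1)"
    if "S \<subseteq> Max_Spec" for S
    by (intro card_eq_supp_from_subset[OF finite_carrier finite_Max_Spec _ that])
qed

lemma zero_iff_ring_supp:
  assumes "x \<in> carrier R" "y \<in> carrier R"
  shows "x \<otimes> y = \<zero> \<longleftrightarrow> ring_supp x \<inter> ring_supp y = {}"
proof -
  have "x \<otimes> y \<in> M \<longleftrightarrow> x \<in> M \<or> y \<in> M" if "M \<in> Max_Spec" for M
    using primeideal.I_prime[OF Max_SpecD(2)[OF that] assms]
      ideal.I_r_closed[OF Max_SpecD(1)[OF that] _ assms(2)] ideal.I_l_closed[OF Max_SpecD(1)[OF that] _ assms(1)]
    by blast
  moreover have "x \<otimes> y = \<zero> \<longleftrightarrow> x \<otimes> y \<in> vanishing Max_Spec" by (simp add: vanishing_all)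
  moreover have "x \<otimes> y \<in> vanishing Max_Spec \<longleftrightarrow> (\<forall>M\<in>Max_Spec. x \<otimes> y \<in> M)"
    using assms by (simp add: vanishing_def)
  ultimately show ?thesis unfolding ring_supp_def by blast
qed

lemma Max_Spec_nonempty: "Max_Spec \<noteq> {}"
  using not_in_maximal_ideal[OF one_closed one_not_zero] by blast

text \<open>With two maximal ideals the residue maps form an injection into the product of the residue
  fields, and both sides have the same number of elements.\<close>
lemma product_of_residue_fields:
  assumes Spec: "Max_Spec = {M, N}" "M \<noteq> N" and eq: "residue_card M = residue_card N"
  shows "product_of_two_equicardinal_fields R"
proof -
  have MN: "M \<in> Max_Spec" "N \<in> Max_Spec" using Spec by auto
  interpret M: ideal M R using Max_SpecD(1)[OF MN(1)] .
  interpret N: ideal N R using Max_SpecD(1)[OF MN(2)] .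
  let ?P = "RDirProd (R Quot M) (R Quot N)"
  let ?f = "\<lambda>x. (M +> x, N +> x)"
  have carr: "carrier (R Quot M) = a_rcosets M" "carrier (R Quot N) = a_rcosets N"
    by (simp_all add: FactRing_def)
  have inj: "inj_on ?f (carrier R)"
  proof (rule inj_onI)
    fix x y assume xy: "x \<in> carrier R" "y \<in> carrier R" "?f x = ?f y"
    then have "x \<ominus> y \<in> vanishing Max_Spec"
      using M.rcos_eq_iff[OF xy(1,2)] N.rcos_eq_iff[OF xy(1,2)] by (simp add: vanishing_def Spec(1))
    then have "x \<ominus> y = \<zero>" by (simp add: vanishing_all)
    then show "x = y" using xy(1,2) by simp
  qed
  have sub: "?f ` carrier R \<subseteq> carrier ?P"
    using a_rcosetsI[OF M.a_subset] a_rcosetsI[OF N.a_subset] by (auto simp: RDirProd_carrier carr)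
  have "vanishing {} = carrier R" by (simp add: vanishing_def)
  then have "card (carrier R) = residue_card M * residue_card N"
    using card_vanishing[of Max_Spec] Spec by simp
  moreover have "card (carrier ?P) = residue_card M * residue_card N"
    by (simp add: RDirProd_carrier carr card_cartesian_product residue_card_def)
  moreover have "finite (carrier ?P)"
    using finite_carrier by (simp add: RDirProd_carrier carr A_RCOSETS_def RCOSETS_def)
  ultimately have "?f ` carrier R = carrier ?P"
    using sub card_image[OF inj] by (intro card_subset_eq) auto
  then have bij: "bij_betw ?f (carrier R) (carrier ?P)" using inj by (simp add: bij_betw_def)
  have "?f \<in> ring_iso R ?P"
  proof (rule ring_iso_memI)
    show "?f x \<in> carrier ?P" if "x \<in> carrier R" for x using sub that by blast
  qed (use bij in \<open>auto simp: RDirProd_def DirProd_def monoid.defs FactRing_def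
      M.rcoset_mult_add N.rcoset_mult_add M.a_rcos_sum N.a_rcos_sum\<close>)
  then have "R \<simeq> ?P" by (auto simp: is_ring_iso_def)
  moreover have "field (R Quot M)" "field (R Quot N)"
    using maximalideal.quotient_is_field[OF Max_SpecD(3)[OF MN(1)] is_cring]
      maximalideal.quotient_is_field[OF Max_SpecD(3)[OF MN(2)] is_cring] .
  moreover have "card (carrier (R Quot M)) = card (carrier (R Quot N))"
    using eq by (simp add: carr residue_card_def)
  ultimately show ?thesis by (intro product_of_two_equicardinal_fieldsI)
qed

text \<open>The two factors are a second system of coordinates, in which the number of coordinates and their
  sizes are known.\<close>
lemma type_II_if_product:
  assumes "product_of_two_equicardinal_fields R"
  shows "type_II (zero_divisor_graph R)"
proof -
  obtain F1 F2 :: "'a ring" and f where F: "field F1" "field F2" and f: "f \<in> ring_iso R (RDirProd F1 F2)"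
    and eq: "card (carrier F1) = card (carrier F2)"
    using assms unfolding product_of_two_equicardinal_fields_def is_ring_iso_def by blast
  interpret F1: field F1 by fact
  interpret F2: field F2 by fact
  have bij: "bij_betw f (carrier R) (carrier F1 \<times> carrier F2)"
    using ring_iso_memE(5)[OF f] by (simp add: RDirProd_carrier)
  have inj: "inj_on f (carrier R)" using bij by (rule bij_betw_imp_inj_on)
  have fR: "f x \<in> carrier F1 \<times> carrier F2" if "x \<in> carrier R" for x using bij_betwE[OF bij] that by blast
  have mult: "f (x \<otimes> y) = (fst (f x) \<otimes>\<^bsub>F1\<^esub> fst (f y), snd (f x) \<otimes>\<^bsub>F2\<^esub> snd (f y))"
    if "x \<in> carrier R" "y \<in> carrier R" for x y
    using ring_iso_memE(2)[OF f that] by (simp add: RDirProd_def DirProd_def monoid.defs split_beta)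
  have f0: "f \<zero> = (\<zero>\<^bsub>F1\<^esub>, \<zero>\<^bsub>F2\<^esub>)"
  proof -
    have "f (\<zero> \<oplus> \<zero>) = f \<zero> \<oplus>\<^bsub>RDirProd F1 F2\<^esub> f \<zero>" using ring_iso_memE(3)[OF f] by blast
    then have "fst (f \<zero>) = fst (f \<zero>) \<oplus>\<^bsub>F1\<^esub> fst (f \<zero>)" "snd (f \<zero>) = snd (f \<zero>) \<oplus>\<^bsub>F2\<^esub> snd (f \<zero>)"
      by (simp_all add: RDirProd_def DirProd_def monoid.defs split_beta prod_eq_iff)
    moreover have "fst (f \<zero>) \<in> carrier F1" "snd (f \<zero>) \<in> carrier F2" using fR[OF zero_closed] by auto
    ultimately show ?thesis using F1.add.l_cancel_one' F2.add.l_cancel_one' by (simp add: prod_eq_iff)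
  qed
  define supp where "supp x = {b. if b then fst (f x) \<noteq> \<zero>\<^bsub>F1\<^esub> else snd (f x) \<noteq> \<zero>\<^bsub>F2\<^esub>}" for x
  define a where "a b = (if b then card (carrier F1) - 1 else card (carrier F2) - 1)" for b
  have fin: "finite (carrier F1)" "finite (carrier F2)"
  proof -
    have "finite (carrier F1 \<times> carrier F2)" using bij finite_carrier bij_betw_finite by blast
    then show "finite (carrier F1)" "finite (carrier F2)"
      using finite_cartesian_productD1 finite_cartesian_productD2 F1.zero_closed F2.zero_closed by blast+
  qed
  interpret S: support_graph "carrier R" supp UNIV a
  proof
    show "finite (carrier R)" by (rule finite_carrier)
    show "0 < a b" for b
    proof -
      have "card {\<zero>\<^bsub>F1\<^esub>, \<one>\<^bsub>F1\<^esub>} \<le> card (carrier F1)" "card {\<zero>\<^bsub>F2\<^esub>, \<one>\<^bsub>F2\<^esub>} \<le> card (carrier F2)"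
        by (rule card_mono[OF fin(1)], simp, rule card_mono[OF fin(2)], simp)
      then show ?thesis by (auto simp: a_def)
    qed
    show "card {x \<in> carrier R. supp x = T} = (\<Prod>b\<in>T. a b)" for T
    proof -
      let ?A = "if True \<in> T then carrier F1 - {\<zero>\<^bsub>F1\<^esub>} else {\<zero>\<^bsub>F1\<^esub>}"
      let ?B = "if False \<in> T then carrier F2 - {\<zero>\<^bsub>F2\<^esub>} else {\<zero>\<^bsub>F2\<^esub>}"
      have sub: "?A \<times> ?B \<subseteq> carrier F1 \<times> carrier F2" by auto
      have supp_T: "supp x = T \<longleftrightarrow> f x \<in> ?A \<times> ?B" if "x \<in> carrier R" for x
      proof -
        have "supp x = T \<longleftrightarrow> (\<forall>b. b \<in> supp x \<longleftrightarrow> b \<in> T)" by auto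
        also have "\<dots> \<longleftrightarrow> (True \<in> supp x \<longleftrightarrow> True \<in> T) \<and> (False \<in> supp x \<longleftrightarrow> False \<in> T)" by (simp add: all_bool_eq)
        also have "\<dots> \<longleftrightarrow> f x \<in> ?A \<times> ?B" using fR[OF that] by (cases "f x") (auto simp: supp_def)
        finally show ?thesis .
      qed
      have im: "f ` {x \<in> carrier R. supp x = T} = ?A \<times> ?B"
      proof
        show "f ` {x \<in> carrier R. supp x = T} \<subseteq> ?A \<times> ?B"
        proof (rule image_subsetI)
          fix x assume "x \<in> {x \<in> carrier R. supp x = T}"
          then have x: "x \<in> carrier R" "supp x = T" by simp_all
          show "f x \<in> ?A \<times> ?B" by (rule iffD1[OF supp_T[OF x(1)] x(2)])
        qed
        show "?A \<times> ?B \<subseteq> f ` {x \<in> carrier R. supp x = T}"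
        proof
          fix p assume p: "p \<in> ?A \<times> ?B"
          then have "p \<in> f ` carrier R" using subsetD[OF sub] by (simp only: bij_betw_imp_surj_on[OF bij])
          then obtain x where x: "x \<in> carrier R" "p = f x" by (rule imageE)
          have "supp x = T" using p unfolding x(2) by (rule iffD2[OF supp_T[OF x(1)]])
          then show "p \<in> f ` {x \<in> carrier R. supp x = T}" using x by (intro image_eqI[of _ _ x]) simp_all
        qed
      qed
      have "inj_on f {x \<in> carrier R. supp x = T}" using inj by (rule inj_on_subset) auto
      then have "card {x \<in> carrier R. supp x = T} = card (f ` {x \<in> carrier R. supp x = T})"
        by (rule card_image[symmetric])
      also have "\<dots> = card (?A \<times> ?B)" by (simp only: im)
      also have "\<dots> = (if True \<in> T then a True else 1) * (if False \<in> T then a False else 1)"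
        using fin by (simp add: card_cartesian_product a_def)
      also have "\<dots> = (\<Prod>b\<in>UNIV. if b \<in> T then a b else 1)" by (simp add: UNIV_bool)
      also have "\<dots> = (\<Prod>b\<in>T. a b)" by (simp add: prod.If_cases)
      finally show ?thesis .
    qed
  qed auto
  have "x \<otimes> y = \<zero> \<longleftrightarrow> supp x \<inter> supp y = {}" if xy: "x \<in> carrier R" "y \<in> carrier R" for x y
  proof -
    have "x \<otimes> y = \<zero> \<longleftrightarrow> f (x \<otimes> y) = f \<zero>" using inj_on_eq_iff[OF inj] xy by simp
    also have "\<dots> \<longleftrightarrow> fst (f x) \<otimes>\<^bsub>F1\<^esub> fst (f y) = \<zero>\<^bsub>F1\<^esub> \<and> snd (f x) \<otimes>\<^bsub>F2\<^esub> snd (f y) = \<zero>\<^bsub>F2\<^esub>"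
      unfolding mult[OF xy] f0 by simp
    also have "\<dots> \<longleftrightarrow> (fst (f x) = \<zero>\<^bsub>F1\<^esub> \<or> fst (f y) = \<zero>\<^bsub>F1\<^esub>) \<and> (snd (f x) = \<zero>\<^bsub>F2\<^esub> \<or> snd (f y) = \<zero>\<^bsub>F2\<^esub>)"
      using fR[OF xy(1)] fR[OF xy(2)] F1.integral_iff F2.integral_iff by (auto simp: mem_Times_iff)
    also have "\<dots> \<longleftrightarrow> (\<forall>b. b \<notin> supp x \<inter> supp y)" by (auto simp: supp_def all_bool_eq)
    finally show ?thesis by blast
  qed
  then have "zero_divisor_graph R = S.G"
    by (rule zero_divisor_graph_eq_support_graph[OF S.support_graph_axioms])
  moreover have "type_II S.G"
    using S.support_graph_coloring(4) eq by (simp add: a_def)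
  ultimately show ?thesis by simp
qed

end

section \<open>The zero-divisor graph of a finite reduced ring\<close>

theorem corollary6p18:
  fixes R :: "('a, 'm) ring_scheme" (structure)
  assumes "cring R"
    and "\<one> \<noteq> \<zero>"
    and "finite (carrier R)"
    and "reduced_ring R"
  shows "edge_chromatic_number (zero_divisor_graph R) = max_degree (zero_divisor_graph R) \<and>
         satisfies_TCC (zero_divisor_graph R) \<and>
         satisfies_TCC (complement_graph (zero_divisor_graph R)) \<and>
         (type_II (zero_divisor_graph R) \<longleftrightarrow> product_of_two_equicardinal_fields R)"
proof -
  interpret finite_reduced_ring R
    by (intro finite_reduced_ring.intro finite_reduced_ring_axioms.intro assms)
  interpret S: support_graph "carrier R" ring_supp Max_Spec "\<lambda>M. residue_card M - 1"
    by (rule support_graph_ring)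
  have G: "zero_divisor_graph R = S.G"
    by (rule zero_divisor_graph_eq_support_graph[OF support_graph_ring zero_iff_ring_supp])
  note coloring = S.support_graph_coloring[OF Max_Spec_nonempty, folded G]
  have prod: "product_of_two_equicardinal_fields R" if "type_II (zero_divisor_graph R)"
  proof -
    note two = conjunct1[OF iffD1[OF coloring(4) that]] conjunct2[OF iffD1[OF coloring(4) that]]
    obtain M N where MN: "Max_Spec = {M, N}" "M \<noteq> N" using two(1) by (auto simp: card_2_iff)
    have in_Spec: "M \<in> Max_Spec" "N \<in> Max_Spec" unfolding MN(1) by simp_all
    have "residue_card M - 1 = residue_card N - 1"
      by (rule bspec[OF bspec[OF two(2) in_Spec(1)] in_Spec(2)])
    then have "residue_card M = residue_card N"
      using residue_card_ge_2[OF in_Spec(1)] residue_card_ge_2[OF in_Spec(2)] by linarith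
    then show ?thesis by (rule product_of_residue_fields[OF MN])
  qed
  have "type_II (zero_divisor_graph R) \<longleftrightarrow> product_of_two_equicardinal_fields R"
    by (rule iffI[OF prod type_II_if_product])
  then show ?thesis by (intro conjI coloring(1-3))
qed

end
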